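(* Let $F_2$ be the free group on two generators. Then the congruence kernel $C(F_2)$ is trivial, $C(F_2)=\{e\}$; that is, the natural homomorphism $\widehat{\mathrm{Aut}(F_2)}\to \mathrm{Aut}(\hat F_2)$ is injective.
   Context: For a group $X$, $\hat X$ (also $\widehat{X}$) denotes its profinite completion. For a finitely generated group $\Gamma$, $\mathrm{Aut}(\hat\Gamma)$ denotes the group of continuous automorphisms of $\hat\Gamma$; it is a profinite group (the topology has as a basis of neighborhoods of the identity the kernels of $\mathrm{Aut}(\hat\Gamma)\to\mathrm{Aut}(\hat\Gamma/U)$ for open characteristic subgroups $U$ of $\hat\Gamma$). Every automorphism of $\Gamma$ extends to $\hat\Gamma$, giving a homomorphism $\mathrm{Aut}(\Gamma)\to\mathrm{Aut}(\hat\Gamma)$, which by the universal property of the profinite completion induces a continuous homomorphism $\widehat{\mathrm{Aut}(\Gamma)}\to\mathrm{Aut}(\hat\Gamma)$. Its kernel is called the congruence kernel of $\Gamma$ and is denoted $C(\Gamma)$. *)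

theory Defs
  imports "HOL-Analysis.Analysis" "HOL-Algebra.Algebra"
begin

section \<open>Free groups\<close>

text \<open>A letter \<open>(a, True)\<close> stands for the generator \<open>a\<close>, and \<open>(a, False)\<close> for its inverse.
  The elements of the free group on \<open>S\<close> are the freely reduced words.\<close>

definition flip_letter :: "'a \<times> bool \<Rightarrow> 'a \<times> bool" where
  "flip_letter l = (fst l, \<not> snd l)"

definition freely_reduced :: "('a \<times> bool) list \<Rightarrow> bool" where
  "freely_reduced w \<longleftrightarrow> successively (\<lambda>x y. y \<noteq> flip_letter x) w"

definition cancel_cons :: "'a \<times> bool \<Rightarrow> ('a \<times> bool) list \<Rightarrow> ('a \<times> bool) list" where
  "cancel_cons x w =
     (case w of [] \<Rightarrow> [x] | y # ys \<Rightarrow> if y = flip_letter x then ys else x # w)"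

text \<open>For reduced \<open>v\<close>, \<open>foldr cancel_cons u v\<close> is the reduced form of the concatenation of
  \<open>u\<close> and \<open>v\<close>.\<close>

definition free_group :: "'a set \<Rightarrow> ('a \<times> bool) list monoid" where
  "free_group S =
     \<lparr>carrier = {w \<in> lists (S \<times> UNIV). freely_reduced w},
      mult = (\<lambda>u v. foldr cancel_cons u v),
      one = []\<rparr>"

definition F2 :: "(nat \<times> bool) list monoid" where
  "F2 = free_group {1, 2}"

lemma flip_flip [simp]: "flip_letter (flip_letter x) = x"
  by (simp add: flip_letter_def)

lemma reduced_cancel_cons: "freely_reduced w \<Longrightarrow> freely_reduced (cancel_cons x w)"
  by (auto simp: freely_reduced_def cancel_cons_def successively_Cons split: list.splits)

lemma cancel_cons_flip:
  "freely_reduced w \<Longrightarrow> cancel_cons x (cancel_cons (flip_letter x) w) = w"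
  by (cases w) (auto simp: freely_reduced_def cancel_cons_def successively_Cons split: list.splits)

lemma reduced_foldr: "freely_reduced v \<Longrightarrow> freely_reduced (foldr cancel_cons u v)"
  by (induction u) (auto simp: reduced_cancel_cons)

lemma foldr_cancel_cons:
  assumes "freely_reduced w"
  shows "foldr cancel_cons (cancel_cons x u) w = cancel_cons x (foldr cancel_cons u w)"
  using cancel_cons_flip[OF reduced_foldr[OF assms], of x]
  by (auto simp: cancel_cons_def[of x u] split: list.splits)

lemma foldr_cancel_assoc:
  assumes "freely_reduced w"
  shows "foldr cancel_cons (foldr cancel_cons u v) w
    = foldr cancel_cons u (foldr cancel_cons v w)"
  by (induction u) (auto simp: foldr_cancel_cons[OF assms])

lemma foldr_reduced: "freely_reduced u \<Longrightarrow> foldr cancel_cons u [] = u"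
  by (induction u) (auto simp: freely_reduced_def cancel_cons_def successively_Cons split: list.splits)

lemma foldr_lists:
  assumes "u \<in> lists (S \<times> UNIV)" "v \<in> lists (S \<times> UNIV)"
  shows "foldr cancel_cons u v \<in> lists (S \<times> UNIV)"
  using assms
proof (induction u)
  case (Cons x u)
  then have "foldr cancel_cons u v \<in> lists (S \<times> UNIV)" "x \<in> S \<times> UNIV"
    by auto
  then show ?case
    by (auto simp: cancel_cons_def[of x] split: list.splits)
qed simp

lemma foldr_inverse:
  "freely_reduced v \<Longrightarrow> foldr cancel_cons (map flip_letter (rev u)) (foldr cancel_cons u v) = v"
proof (induction u)
  case (Cons x u)
  have "cancel_cons (flip_letter x) (cancel_cons x (foldr cancel_cons u v))
      = foldr cancel_cons u v"
    using cancel_cons_flip[OF reduced_foldr[OF Cons.prems], of "flip_letter x" u] by simp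
  with Cons show ?case by simp
qed simp

lemma reduced_inverse: "freely_reduced u \<Longrightarrow> freely_reduced (map flip_letter (rev u))"
  unfolding freely_reduced_def successively_map successively_rev
  by (erule successively_mono) (auto simp: flip_letter_def)

lemma group_free_group: "group (free_group S)"
proof (rule groupI)
  fix x assume x: "x \<in> carrier (free_group S)"
  let ?y = "map flip_letter (rev x)"
  have "?y \<in> carrier (free_group S)"
    using x reduced_inverse[of x]
    by (fastforce simp: free_group_def flip_letter_def)
  moreover have "?y \<otimes>\<^bsub>free_group S\<^esub> x = \<one>\<^bsub>free_group S\<^esub>"
    using foldr_inverse[of "[]" x] foldr_reduced[of x] x
    by (simp add: free_group_def freely_reduced_def)
  ultimately show "\<exists>y\<in>carrier (free_group S). y \<otimes>\<^bsub>free_group S\<^esub> x = \<one>\<^bsub>free_group S\<^esub>"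
    by blast
next
  fix x y assume "x \<in> carrier (free_group S)" "y \<in> carrier (free_group S)"
  then show "x \<otimes>\<^bsub>free_group S\<^esub> y \<in> carrier (free_group S)"
    using foldr_lists[of x S y] reduced_foldr[of y x] unfolding free_group_def by simp
qed (auto simp: free_group_def foldr_cancel_assoc, simp add: freely_reduced_def)


section \<open>The profinite completion\<close>

definition fin_index_normals :: "('a, 'b) monoid_scheme \<Rightarrow> 'a set set" where
  "fin_index_normals G = {N. N \<lhd> G \<and> finite (rcosets\<^bsub>G\<^esub> N)}"

text \<open>The inverse limit of the finite quotients \<open>G Mod N\<close>. For \<open>M \<subseteq> N\<close> the transition map
  \<open>G Mod M \<rightarrow> G Mod N\<close> sends a coset of \<open>M\<close> to the unique coset of \<open>N\<close> containing it.\<close>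

definition profinite_completion ::
    "('a, 'b) monoid_scheme \<Rightarrow> ('a set \<Rightarrow> 'a set) monoid" where
  "profinite_completion G =
     product_group (fin_index_normals G) (\<lambda>N. G Mod N)
       \<lparr>carrier := {x \<in> carrier (product_group (fin_index_normals G) (\<lambda>N. G Mod N)).
          \<forall>M\<in>fin_index_normals G. \<forall>N\<in>fin_index_normals G. M \<subseteq> N \<longrightarrow> x M \<subseteq> x N}\<rparr>"

definition profinite_topology :: "('a, 'b) monoid_scheme \<Rightarrow> ('a set \<Rightarrow> 'a set) topology" where
  "profinite_topology G =
     subtopology
       (product_topology (\<lambda>N. discrete_topology (carrier (G Mod N))) (fin_index_normals G))
       (carrier (profinite_completion G))"

definition to_completion :: "('a, 'b) monoid_scheme \<Rightarrow> 'a \<Rightarrow> ('a set \<Rightarrow> 'a set)" where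
  "to_completion G g = (\<lambda>N\<in>fin_index_normals G. N #>\<^bsub>G\<^esub> g)"

text \<open>The map given by the universal property of the profinite completion: the unique continuous
  homomorphism from the completion of \<open>G\<close> to the profinite group \<open>H\<close>, with topology \<open>T\<close>, that
  extends the homomorphism \<open>f\<close> from \<open>G\<close> to \<open>H\<close>. As for \<^const>\<open>auto\<close>, maps are taken to be
  extensional, since otherwise uniqueness fails off the carrier.\<close>

definition completion_lift ::
    "('a, 'b) monoid_scheme \<Rightarrow> ('c, 'd) monoid_scheme \<Rightarrow> 'c topology \<Rightarrow> ('a \<Rightarrow> 'c)
      \<Rightarrow> (('a set \<Rightarrow> 'a set) \<Rightarrow> 'c)" where
  "completion_lift G H T f =
     (THE F. F \<in> hom (profinite_completion G) H \<and>
             F \<in> extensional (carrier (profinite_completion G)) \<and>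
             continuous_map (profinite_topology G) T F \<and>
             (\<forall>g\<in>carrier G. F (to_completion G g) = f g))"


section \<open>Continuous automorphisms of the profinite completion\<close>

definition cont_auto_group ::
    "('a, 'b) monoid_scheme \<Rightarrow> (('a set \<Rightarrow> 'a set) \<Rightarrow> ('a set \<Rightarrow> 'a set)) monoid" where
  "cont_auto_group G =
     AutoGroup (profinite_completion G)
       \<lparr>carrier := {f \<in> auto (profinite_completion G).
          continuous_map (profinite_topology G) (profinite_topology G) f}\<rparr>"

definition open_characteristic :: "('a, 'b) monoid_scheme \<Rightarrow> ('a set \<Rightarrow> 'a set) set \<Rightarrow> bool" where
  "open_characteristic G U \<longleftrightarrow>
     subgroup U (profinite_completion G) \<and> openin (profinite_topology G) U \<and>
     (\<forall>f\<in>carrier (cont_auto_group G). f ` U = U)"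

text \<open>The kernel of the action of the continuous automorphisms on the quotient by \<open>U\<close>: the
  automorphism induced by \<open>f\<close> sends a coset \<open>C\<close> to \<open>f ` C\<close>.\<close>

definition auto_congruence_subgroup ::
    "('a, 'b) monoid_scheme \<Rightarrow> ('a set \<Rightarrow> 'a set) set
      \<Rightarrow> (('a set \<Rightarrow> 'a set) \<Rightarrow> ('a set \<Rightarrow> 'a set)) set" where
  "auto_congruence_subgroup G U =
     {f \<in> carrier (cont_auto_group G). \<forall>C\<in>carrier (profinite_completion G Mod U). f ` C = C}"

text \<open>The group topology in which the subgroups \<^const>\<open>auto_congruence_subgroup\<close> form a basis of
  neighbourhoods of the identity; their cosets are then a basis of open sets.\<close>

definition cont_auto_topology ::
    "('a, 'b) monoid_scheme \<Rightarrow> (('a set \<Rightarrow> 'a set) \<Rightarrow> ('a set \<Rightarrow> 'a set)) topology" where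
  "cont_auto_topology G =
     topology_generated_by
       {auto_congruence_subgroup G U #>\<^bsub>cont_auto_group G\<^esub> f | U f.
          open_characteristic G U \<and> f \<in> carrier (cont_auto_group G)}"


section \<open>The congruence kernel\<close>

definition auto_extension ::
    "('a, 'b) monoid_scheme \<Rightarrow> ('a \<Rightarrow> 'a) \<Rightarrow> (('a set \<Rightarrow> 'a set) \<Rightarrow> ('a set \<Rightarrow> 'a set))" where
  "auto_extension G \<alpha> =
     completion_lift G (profinite_completion G) (profinite_topology G)
       (\<lambda>g. to_completion G (\<alpha> g))"

definition aut_completion_map ::
    "('a, 'b) monoid_scheme \<Rightarrow> (('a \<Rightarrow> 'a) set \<Rightarrow> ('a \<Rightarrow> 'a) set)
      \<Rightarrow> (('a set \<Rightarrow> 'a set) \<Rightarrow> ('a set \<Rightarrow> 'a set))" where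
  "aut_completion_map G =
     completion_lift (AutoGroup G) (cont_auto_group G) (cont_auto_topology G) (auto_extension G)"

definition congruence_kernel ::
    "('a, 'b) monoid_scheme \<Rightarrow> (('a \<Rightarrow> 'a) set \<Rightarrow> ('a \<Rightarrow> 'a) set) set" where
  "congruence_kernel G =
     kernel (profinite_completion (AutoGroup G)) (cont_auto_group G) (aut_completion_map G)"

end

theory Submission
  imports Defs
begin

text \<open>A finite index subgroup \<open>N\<close> of \<open>Aut(F\<^sub>2)\<close> contains the kernel of the action on some finite
  characteristic quotient of \<open>F\<^sub>2\<close>. By Nielsen reduction, an automorphism acting trivially on the
  abelianization modulo four is a product of an inner one and a word in \<open>x \<mapsto> x, y \<mapsto> x\<^sup>2y\<close> and
  \<open>x \<mapsto> xy\<^sup>2, y \<mapsto> y\<close>. These two automorphisms act as full twists on the fundamental group of the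
  sphere with four punctures, which is commensurable with \<open>F\<^sub>2\<close> through the elliptic involution. A word
  in the twists pushes one puncture along a loop, and the class of this loop in the sphere with the other
  three punctures is the word itself. A finite cover of the latter sphere separates the preimages of
  the pushed puncture, so that the action on a finite quotient of \<open>F\<^sub>2\<close> determines the word modulo \<open>N\<close> up
  to inner automorphisms; these are controlled because finite quotients of \<open>F\<^sub>2\<close> have
  covers whose centre becomes trivial below.

  In the completion of \<open>Aut(F\<^sub>2)\<close>, an element acting trivially on the completion of \<open>F\<^sub>2\<close> then lies in
  every finite index normal subgroup.\<close>

section \<open>Free groups acting on sets\<close>

text \<open>The obstacle is the ambiguity in \<open>\<phi> = conj_aut F2 h \<star> Theta g\<close>:
  a finite quotient sees only the product, and an inner factor might mask a nontrivial
  \<open>g\<close>. So \<open>g\<close> is recovered first. The action of \<open>tau\<close> is made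
  to single out one coset in a finite set. The product preserves this action, so \<open>h\<close>
  must bring the pushed puncture back, and what remains is an element that is central in a finite
  quotient. Hence the covers in which central elements become trivial one level below; they serve a
  second time to deal with \<open>h\<close> once \<open>g\<close> is known.

  The constants have these origins. Since \<open>tau\<close> is the square of a loop around the
  puncture, that loop acts with order three rather than two. Level four, and not two, is taken
  because changing the sign of a generator is invisible modulo two. The finite quotients that detect
  \<open>g\<close> and the centre are kernels of permutation actions given letter by letter, so the
  geometry enters only through tables such as \<open>induced_action\<close>.\<close>

lemma (in group) rcosets_subset_image:
  assumes N: "N \<lhd> G"
    and r: "\<And>g h. \<lbrakk>g \<in> carrier G; h \<in> carrier G; r g = r h\<rbrakk> \<Longrightarrow> g \<otimes> inv h \<in> N"
  shows "rcosets N \<subseteq> (\<lambda>v. N #> inv_into (carrier G) r v) ` r ` carrier G"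
proof
  interpret N: normal N G by (rule N)
  fix C assume "C \<in> rcosets N"
  then obtain g where g: "g \<in> carrier G" "C = N #> g" by (auto simp: RCOSETS_def)
  let ?h = "inv_into (carrier G) r (r g)"
  have h: "?h \<in> carrier G" "r g = r ?h"
    using g by (auto simp: inv_into_into f_inv_into_f)
  then have "g \<in> N #> ?h"
    using r[OF g(1) h] g by (intro N.rcos_module_rev[OF is_group]) auto
  then have "C = N #> ?h"
    using g h N.is_subgroup by (metis repr_independence)
  then show "C \<in> (\<lambda>v. N #> inv_into (carrier G) r v) ` r ` carrier G"
    using g by blast
qed

text \<open>Here \<open>r\<close> is any invariant that separates the cosets of \<open>N\<close>,
  not necessarily a homomorphism, and its values bound the index. Typical choices below are a
  permutation of a finite set or a pair of residues.\<close>

lemma (in group)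
  assumes N: "N \<lhd> G" and fin: "finite (r ` carrier G)"
    and r: "\<And>g h. \<lbrakk>g \<in> carrier G; h \<in> carrier G; r g = r h\<rbrakk> \<Longrightarrow> g \<otimes> inv h \<in> N"
  shows fin_index_normalsI: "N \<in> fin_index_normals G"
    and card_rcosets_le: "card (rcosets N) \<le> card (r ` carrier G)"
proof -
  have sub: "rcosets N \<subseteq> (\<lambda>v. N #> inv_into (carrier G) r v) ` r ` carrier G"
    by (rule rcosets_subset_image[OF N]) (rule r)
  show "N \<in> fin_index_normals G"
    using finite_subset[OF sub] fin N by (simp add: fin_index_normals_def)
  show "card (rcosets N) \<le> card (r ` carrier G)"
    using fin sub by (meson card_image_le card_mono finite_imageI order_trans)
qed

lemma (in group) fin_index_normals_Int:
  assumes "M \<in> fin_index_normals G" "N \<in> fin_index_normals G"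
  shows "M \<inter> N \<in> fin_index_normals G"
proof -
  interpret M: normal M G using assms by (simp add: fin_index_normals_def)
  interpret N: normal N G using assms by (simp add: fin_index_normals_def)
  show ?thesis
  proof (rule fin_index_normalsI[where r = "\<lambda>g. (M #> g, N #> g)"])
    show "M \<inter> N \<lhd> G" by (intro normal_subgroup_intersect M.normal_axioms N.normal_axioms)
    have "(\<lambda>g. (M #> g, N #> g)) ` carrier G \<subseteq> (rcosets M) \<times> (rcosets N)"
      by (auto simp: RCOSETS_def)
    then show "finite ((\<lambda>g. (M #> g, N #> g)) ` carrier G)"
      using assms by (auto simp: fin_index_normals_def intro: finite_subset)
    fix g h assume "g \<in> carrier G" "h \<in> carrier G" "(M #> g, N #> g) = (M #> h, N #> h)"
    then show "g \<otimes> inv h \<in> M \<inter> N"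
      by (metis IntI M.rcos_module_imp M.subgroup_axioms N.rcos_module_imp N.subgroup_axioms
          Pair_inject is_group rcos_self)
  qed
qed

lemma (in group) fin_index_normals_carrier: "carrier G \<in> fin_index_normals G"
  by (rule fin_index_normalsI[where r = "\<lambda>_. ()"])
     (auto simp: normal_inv_iff subgroup_self)

text \<open>The quotient by the preimage embeds into the quotient by \<open>N\<close>, so pulling
  back never increases the index, even along a homomorphism that is not surjective. The
  characteristic cores below rest on this bound.\<close>

lemma (in group)
  assumes f: "f \<in> hom G H" and H: "group H" and N: "N \<in> fin_index_normals H"
  shows fin_index_normals_preimage: "{g \<in> carrier G. f g \<in> N} \<in> fin_index_normals G" (is "?P \<in> _")
    and card_rcosets_preimage_le: "card (rcosets {g \<in> carrier G. f g \<in> N}) \<le> card (rcosets\<^bsub>H\<^esub> N)"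
proof -
  interpret H: group H by (rule H)
  interpret f: group_hom G H f by unfold_locales (rule f)
  interpret N: normal N H using N by (simp add: fin_index_normals_def)
  let ?r = "\<lambda>g. N #>\<^bsub>H\<^esub> f g"
  have P: "?P \<lhd> G"
    unfolding normal_inv_iff
    by (auto intro!: subgroupI N.m_closed N.inv_op_closed2 exI[of _ \<one>] simp: f.hom_inv)
  have fin_H: "finite (rcosets\<^bsub>H\<^esub> N)" using N by (simp add: fin_index_normals_def)
  have sub: "?r ` carrier G \<subseteq> rcosets\<^bsub>H\<^esub> N"
    unfolding RCOSETS_def using f.hom_closed by blast
  then have fin: "finite (?r ` carrier G)" using fin_H by (rule finite_subset)
  have r: "g \<otimes> inv h \<in> ?P" if gh: "g \<in> carrier G" "h \<in> carrier G" "?r g = ?r h" for g h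
  proof -
    have "f g \<in> N #>\<^bsub>H\<^esub> f h"
      using gh by (metis H.rcos_self N.subgroup_axioms f.hom_closed)
    then have "f g \<otimes>\<^bsub>H\<^esub> inv\<^bsub>H\<^esub> f h \<in> N"
      using gh by (intro N.rcos_module_imp[OF H]) auto
    then show ?thesis
      using gh by (simp add: f.hom_inv)
  qed
  show "?P \<in> fin_index_normals G"
    by (rule fin_index_normalsI[where r = ?r, OF P fin r])
  have "card (rcosets ?P) \<le> card (?r ` carrier G)"
    by (rule card_rcosets_le[where r = ?r, OF P fin r])
  also have "\<dots> \<le> card (rcosets\<^bsub>H\<^esub> N)" by (rule card_mono[OF fin_H sub])
  finally show "card (rcosets ?P) \<le> card (rcosets\<^bsub>H\<^esub> N)" .
qed

section \<open>Free groups as reduced words, and their actions\<close>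

lemma one_free_group: "\<one>\<^bsub>free_group S\<^esub> = []"
  by (simp add: free_group_def)

lemma mult_free_group: "u \<otimes>\<^bsub>free_group S\<^esub> v = foldr cancel_cons u v"
  by (simp add: free_group_def)

lemma carrier_free_group: "w \<in> carrier (free_group S) \<longleftrightarrow> w \<in> lists (S \<times> UNIV) \<and> freely_reduced w"
  by (simp add: free_group_def)

lemma cancel_cons_reduced: "freely_reduced (l # w) \<Longrightarrow> cancel_cons l w = l # w"
  by (auto simp: cancel_cons_def freely_reduced_def successively_Cons split: list.splits)

lemma freely_reduced_Cons: "freely_reduced (l # w) \<Longrightarrow> freely_reduced w"
  by (auto simp: freely_reduced_def successively_Cons)

lemma inv_free_group:
  assumes "w \<in> carrier (free_group S)"
  shows "inv\<^bsub>free_group S\<^esub> w = map flip_letter (rev w)"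
proof (rule group.inv_equality[OF group_free_group])
  show "map flip_letter (rev w) \<otimes>\<^bsub>free_group S\<^esub> w = \<one>\<^bsub>free_group S\<^esub>"
    using foldr_inverse[of "[]" w] foldr_reduced[of w] assms
    by (simp add: free_group_def freely_reduced_def)
  show "map flip_letter (rev w) \<in> carrier (free_group S)"
    using assms reduced_inverse[of w]
    by (fastforce simp: free_group_def flip_letter_def)
qed (use assms in auto)

lemma free_group_induct [consumes 1, case_names one mult]:
  assumes w: "w \<in> carrier (free_group S)"
    and one: "P \<one>\<^bsub>free_group S\<^esub>"
    and mult: "\<And>l w. \<lbrakk>l \<in> S \<times> UNIV; w \<in> carrier (free_group S); P w\<rbrakk> \<Longrightarrow> P ([l] \<otimes>\<^bsub>free_group S\<^esub> w)"
  shows "P w"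
  using w
proof (induction w)
  case Nil
  then show ?case using one by (simp add: one_free_group)
next
  case (Cons l w)
  then have w: "w \<in> carrier (free_group S)" and l: "l \<in> S \<times> UNIV" and red: "freely_reduced (l # w)"
    by (auto simp: carrier_free_group freely_reduced_Cons)
  have "[l] \<otimes>\<^bsub>free_group S\<^esub> w = l # w"
    using cancel_cons_reduced[OF red] by (simp add: mult_free_group)
  then show ?case using mult[OF l w Cons.IH[OF w]] by simp
qed

text \<open>As \<open>flip_letter\<close> is an involution, \<open>cancel\<close> makes each letter
  a permutation of \<open>Z\<close>, and \<open>foldr A\<close> then depends only on the reduced
  form of a word. An action is thus specified by its letters alone.\<close>

locale free_action =
  fixes S :: "'a set" and A :: "'a \<times> bool \<Rightarrow> 'b \<Rightarrow> 'b" and Z :: "'b set"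
  assumes closed: "\<lbrakk>l \<in> S \<times> UNIV; z \<in> Z\<rbrakk> \<Longrightarrow> A l z \<in> Z"
    and cancel: "\<lbrakk>l \<in> S \<times> UNIV; z \<in> Z\<rbrakk> \<Longrightarrow> A (flip_letter l) (A l z) = z"
begin

lemma foldr_closed: "\<lbrakk>w \<in> lists (S \<times> UNIV); z \<in> Z\<rbrakk> \<Longrightarrow> foldr A w z \<in> Z"
  by (induction w) (auto intro: closed)

lemma foldr_cancel_cons:
  assumes "l \<in> S \<times> UNIV" "w \<in> lists (S \<times> UNIV)" "z \<in> Z"
  shows "foldr A (cancel_cons l w) z = A l (foldr A w z)"
proof (cases w)
  case (Cons y ys)
  have "A l (A (flip_letter l) (foldr A ys z)) = foldr A ys z"
    using cancel[of "flip_letter l" "foldr A ys z"] assms Cons foldr_closed[of ys z]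
    by (auto simp: flip_letter_def)
  then show ?thesis using Cons by (auto simp: cancel_cons_def)
qed (simp add: cancel_cons_def)

lemma foldr_foldr_cancel_cons:
  assumes "u \<in> lists (S \<times> UNIV)" "v \<in> lists (S \<times> UNIV)" "z \<in> Z"
  shows "foldr A (foldr cancel_cons u v) z = foldr A u (foldr A v z)"
  using assms by (induction u) (auto simp: foldr_cancel_cons foldr_lists)

lemma foldr_mult:
  assumes "u \<in> carrier (free_group S)" "v \<in> carrier (free_group S)" "z \<in> Z"
  shows "foldr A (u \<otimes>\<^bsub>free_group S\<^esub> v) z = foldr A u (foldr A v z)"
  using assms foldr_foldr_cancel_cons[of u v z] by (simp add: mult_free_group carrier_free_group)

lemma foldr_carrier: "\<lbrakk>w \<in> carrier (free_group S); z \<in> Z\<rbrakk> \<Longrightarrow> foldr A w z \<in> Z"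
  using foldr_closed by (simp add: carrier_free_group)

lemma foldr_inv:
  assumes "w \<in> carrier (free_group S)" "z \<in> Z"
  shows "foldr A (inv\<^bsub>free_group S\<^esub> w) (foldr A w z) = z"
    and "foldr A w (foldr A (inv\<^bsub>free_group S\<^esub> w) z) = z"
proof -
  interpret G: group "free_group S" by (rule group_free_group)
  show "foldr A (inv\<^bsub>free_group S\<^esub> w) (foldr A w z) = z"
    and "foldr A w (foldr A (inv\<^bsub>free_group S\<^esub> w) z) = z"
    using assms foldr_mult[of "inv\<^bsub>free_group S\<^esub> w" w z] foldr_mult[of w "inv\<^bsub>free_group S\<^esub> w" z]
    by (simp_all add: G.l_inv G.r_inv one_free_group)
qed

definition action_kernel :: "('a \<times> bool) list set" where
  "action_kernel = {w \<in> carrier (free_group S). \<forall>z\<in>Z. foldr A w z = z}"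

lemma normal_action_kernel: "action_kernel \<lhd> free_group S"
proof -
  interpret G: group "free_group S" by (rule group_free_group)
  show ?thesis
    unfolding G.normal_inv_iff
  proof (intro conjI ballI G.subgroupI)
    show "action_kernel \<noteq> {}"
      using G.one_closed by (force simp: action_kernel_def one_free_group)
    fix w assume w: "w \<in> action_kernel"
    then show "inv\<^bsub>free_group S\<^esub> w \<in> action_kernel"
      using foldr_inv(1) by (fastforce simp: action_kernel_def)
    show "w \<otimes>\<^bsub>free_group S\<^esub> w' \<in> action_kernel" if "w' \<in> action_kernel" for w'
      using w that by (simp add: action_kernel_def foldr_mult)
    fix x assume x: "x \<in> carrier (free_group S)"
    show "x \<otimes>\<^bsub>free_group S\<^esub> w \<otimes>\<^bsub>free_group S\<^esub> inv\<^bsub>free_group S\<^esub> x \<in> action_kernel"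
      using w x by (simp add: action_kernel_def foldr_mult foldr_carrier foldr_inv)
  qed (auto simp: action_kernel_def)
qed

lemma action_kernel_fin_index:
  assumes "finite Z"
  shows "action_kernel \<in> fin_index_normals (free_group S)"
proof -
  interpret G: group "free_group S" by (rule group_free_group)
  show ?thesis
  proof (rule G.fin_index_normalsI[where r = "\<lambda>w. restrict (foldr A w) Z"])
    show "action_kernel \<lhd> free_group S" by (rule normal_action_kernel)
    have "(\<lambda>w. restrict (foldr A w) Z) ` carrier (free_group S) \<subseteq> Z \<rightarrow>\<^sub>E Z"
      using foldr_carrier by fastforce
    then show "finite ((\<lambda>w. restrict (foldr A w) Z) ` carrier (free_group S))"
      using assms finite_PiE[of Z "\<lambda>_. Z"] finite_subset by blast
    fix g h assume g: "g \<in> carrier (free_group S)" and h: "h \<in> carrier (free_group S)"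
      and eq: "restrict (foldr A g) Z = restrict (foldr A h) Z"
    have "foldr A (g \<otimes>\<^bsub>free_group S\<^esub> inv\<^bsub>free_group S\<^esub> h) z = z" if z: "z \<in> Z" for z
    proof -
      have hz: "foldr A (inv\<^bsub>free_group S\<^esub> h) z \<in> Z"
        using foldr_carrier[of "inv\<^bsub>free_group S\<^esub> h" z] h z by simp
      have "foldr A g z = foldr A h z" if "z \<in> Z" for z
        using fun_cong[OF eq, of z] that by simp
      then show ?thesis
        using g h z hz foldr_inv(2)[of h z] foldr_mult[of g "inv\<^bsub>free_group S\<^esub> h" z] by simp
    qed
    then show "g \<otimes>\<^bsub>free_group S\<^esub> inv\<^bsub>free_group S\<^esub> h \<in> action_kernel"
      using g h by (simp add: action_kernel_def)
  qed
qed

end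

lemma foldr_equivariant:
  assumes "\<And>l z. \<lbrakk>l \<in> S \<times> UNIV; z \<in> Z\<rbrakk> \<Longrightarrow> A l z \<in> Z \<and> h (A l z) = B l (h z)"
    and "w \<in> lists (S \<times> UNIV)" "z \<in> Z"
  shows "h (foldr A w z) = foldr B w (h z)"
proof -
  have "foldr A w z \<in> Z \<and> h (foldr A w z) = foldr B w (h z)"
    using assms(2,3) by (induction w) (use assms(1) in \<open>force+\<close>)
  then show ?thesis by blast
qed

definition free_lift :: "('b, 'c) monoid_scheme \<Rightarrow> ('a \<Rightarrow> 'b) \<Rightarrow> ('a \<times> bool) list \<Rightarrow> 'b" where
  "free_lift H f w =
     foldr (\<lambda>l z. (if snd l then f (fst l) else inv\<^bsub>H\<^esub> f (fst l)) \<otimes>\<^bsub>H\<^esub> z) w \<one>\<^bsub>H\<^esub>"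

lemma free_lift_hom:
  assumes "group H" and f: "\<And>a. a \<in> S \<Longrightarrow> f a \<in> carrier H"
  shows "free_lift H f \<in> hom (free_group S) H"
proof -
  interpret H: group H by (rule assms)
  let ?A = "\<lambda>l z. (if snd l then f (fst l) else inv\<^bsub>H\<^esub> f (fst l)) \<otimes>\<^bsub>H\<^esub> z"
  interpret free_action S ?A "carrier H"
    by unfold_locales (auto simp: f flip_letter_def simp flip: H.m_assoc)
  \<comment> \<open>The fold is left translation by the image of \<open>w\<close>; multiplicativity
    follows from the action law evaluated at the unit.\<close>
  have right: "foldr ?A w z = foldr ?A w \<one>\<^bsub>H\<^esub> \<otimes>\<^bsub>H\<^esub> z"
    if "w \<in> lists (S \<times> UNIV)" "z \<in> carrier H" for w z
    using that
  proof (induction w)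
    case (Cons l w)
    then have "foldr ?A w \<one>\<^bsub>H\<^esub> \<in> carrier H" by (intro foldr_closed) auto
    then show ?case using Cons f by (auto simp: H.m_assoc)
  qed simp
  show ?thesis
  proof (rule homI)
    fix u v assume uv: "u \<in> carrier (free_group S)" "v \<in> carrier (free_group S)"
    then show "free_lift H f (u \<otimes>\<^bsub>free_group S\<^esub> v) = free_lift H f u \<otimes>\<^bsub>H\<^esub> free_lift H f v"
      using foldr_mult[of u v "\<one>\<^bsub>H\<^esub>"] right[of u "foldr ?A v \<one>\<^bsub>H\<^esub>"] foldr_carrier[of v "\<one>\<^bsub>H\<^esub>"]
      by (simp add: free_lift_def carrier_free_group)
  qed (auto simp: free_lift_def intro!: foldr_carrier)
qed

lemma hom_free_group_eqI:
  assumes "group H" "f \<in> hom (free_group S) H" "g \<in> hom (free_group S) H"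
    and eq: "\<And>a. a \<in> S \<Longrightarrow> f [(a, True)] = g [(a, True)]"
    and w: "w \<in> carrier (free_group S)"
  shows "f w = g w"
proof -
  interpret G: group "free_group S" by (rule group_free_group)
  interpret H: group H by (rule assms)
  interpret f: group_hom "free_group S" H f by unfold_locales (rule assms)
  interpret g: group_hom "free_group S" H g by unfold_locales (rule assms)
  have letter: "[l] \<in> carrier (free_group S)" if "l \<in> S \<times> UNIV" for l
    using that by (auto simp: carrier_free_group freely_reduced_def)
  have eq': "f [l] = g [l]" if "l \<in> S \<times> UNIV" for l
  proof (cases "snd l")
    case True
    then show ?thesis using eq[of "fst l"] that by (metis mem_Times_iff prod.collapse)
  next
    case False
    then have "[l] = inv\<^bsub>free_group S\<^esub> [(fst l, True)]"
      using letter[of "(fst l, True)"] that by (auto simp: inv_free_group flip_letter_def prod_eq_iff)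
    then show ?thesis
      using eq[of "fst l"] that letter[of "(fst l, True)"]
      by (metis UNIV_I f.hom_inv g.hom_inv mem_Times_iff fst_conv snd_conv)
  qed
  from w show ?thesis
    by (induction rule: free_group_induct) (simp_all add: eq' letter)
qed

text \<open>Actions are taken on left cosets, because \<open>foldr\<close> lets words act from the
  left. For a normal subgroup these are the same sets as the right cosets.\<close>

lemma (in group) l_coset_eq_iff:
  assumes "subgroup N G" "g \<in> carrier G" "h \<in> carrier G"
  shows "g <# N = h <# N \<longleftrightarrow> inv h \<otimes> g \<in> N"
proof
  interpret N: subgroup N G by (rule assms)
  assume eq: "g <# N = h <# N"
  have "g \<in> g <# N" using N.one_closed assms by (force simp: l_coset_def)
  then obtain n where "n \<in> N" "g = h \<otimes> n" using eq by (auto simp: l_coset_def)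
  then show "inv h \<otimes> g \<in> N" using assms N.mem_carrier by (simp flip: m_assoc)
next
  interpret N: subgroup N G by (rule assms)
  assume "inv h \<otimes> g \<in> N"
  then have "h \<otimes> (inv h \<otimes> g) \<in> h <# N" by (auto simp: l_coset_def)
  then have "g \<in> h <# N" using assms by (simp flip: m_assoc)
  then show "g <# N = h <# N" using l_repr_independence assms by metis
qed

lemma (in normal) l_cosets_eq_rcosets: "(\<lambda>g. g <# H) ` carrier G = rcosets H"
  using coset_eq by (auto simp: RCOSETS_def)

lemma (in normal) pow_index_mem:
  assumes "finite (rcosets H)" "g \<in> carrier G"
  shows "g [^] card (rcosets H) \<in> H"
proof -
  interpret Q: group "G Mod H" by (rule factorgroup_is_group)
  have "(H #> g) [^]\<^bsub>G Mod H\<^esub> card (rcosets H) = H"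
    using Q.pow_order_eq_1[of "H #> g"] assms
    by (simp add: Coset.order_def FactGroup_def rcosetsI[OF subset])
  then have "H #> (g [^] card (rcosets H)) = H"
    using FactGroup_pow assms(2) by metis
  then show ?thesis using rcos_self[OF _ is_subgroup] assms(2) by (metis nat_pow_closed)
qed

section \<open>The free group of rank two and its exponent sums\<close>

interpretation F2: group F2
  unfolding F2_def by (rule group_free_group)

abbreviation mult_in_F2 (infixl \<open>\<ast>\<close> 70) where "u \<ast> v \<equiv> u \<otimes>\<^bsub>F2\<^esub> v"

abbreviation mult_in_Aut_F2 (infixl \<open>\<star>\<close> 70) where "\<phi> \<star> \<psi> \<equiv> \<phi> \<otimes>\<^bsub>AutoGroup F2\<^esub> \<psi>"

abbreviation inv_in_F2 (\<open>\<inverse> _\<close> [81] 80) where "\<inverse> u \<equiv> inv\<^bsub>F2\<^esub> u"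

definition gen :: "nat \<Rightarrow> (nat \<times> bool) list" where
  "gen a = [(a, True)]"

lemma letter_carrier_F2: "l \<in> {1, 2} \<times> UNIV \<Longrightarrow> [l] \<in> carrier F2"
  by (auto simp: F2_def carrier_free_group freely_reduced_def)

lemma gen_carrier [simp]: "gen 1 \<in> carrier F2" "gen (Suc 0) \<in> carrier F2" "gen 2 \<in> carrier F2"
  by (simp_all add: gen_def letter_carrier_F2)

lemma gen_carrier': "a \<in> {1, 2} \<Longrightarrow> gen a \<in> carrier F2"
  by auto

lemma one_F2: "\<one>\<^bsub>F2\<^esub> = []"
  by (simp add: F2_def one_free_group)

lemma inv_gen: "a \<in> {1, 2} \<Longrightarrow> \<inverse> gen a = [(a, False)]"
  using gen_carrier'[of a] by (simp add: F2_def inv_free_group gen_def flip_letter_def)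

lemma letter_eq_gen: "[(a, True)] = gen a" "a \<in> {1, 2} \<Longrightarrow> [(a, False)] = \<inverse> gen a"
  by (simp add: gen_def) (metis inv_gen)

lemmas F2_letter_induct = free_group_induct[where S = "{1, 2 :: nat}", folded F2_def, consumes 1, case_names one mult]

lemma F2_induct [consumes 1, case_names one gen1 inv1 gen2 inv2]:
  assumes "w \<in> carrier F2" "P \<one>\<^bsub>F2\<^esub>"
    and "\<And>w. \<lbrakk>w \<in> carrier F2; P w\<rbrakk> \<Longrightarrow> P (gen 1 \<ast> w)"
    and "\<And>w. \<lbrakk>w \<in> carrier F2; P w\<rbrakk> \<Longrightarrow> P (\<inverse> gen 1 \<ast> w)"
    and "\<And>w. \<lbrakk>w \<in> carrier F2; P w\<rbrakk> \<Longrightarrow> P (gen 2 \<ast> w)"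
    and "\<And>w. \<lbrakk>w \<in> carrier F2; P w\<rbrakk> \<Longrightarrow> P (\<inverse> gen 2 \<ast> w)"
  shows "P w"
  using assms(1) unfolding F2_def
proof (induction rule: free_group_induct)
  case one
  then show ?case using assms(2) by (simp add: F2_def)
next
  case (mult l w)
  then obtain a b where "l = (a, b)" "a \<in> {1, 2}" by auto
  moreover have "[(a, b)] = (if b then gen a else \<inverse> gen a)"
    using calculation by (cases b) (simp_all add: letter_eq_gen)
  moreover have "w \<in> carrier F2" using mult by (simp add: F2_def)
  ultimately show ?case using assms(3-6)[of w] mult by (auto simp: F2_def)
qed

definition expo :: "nat \<Rightarrow> (nat \<times> bool) list \<Rightarrow> int" where
  "expo a w = sum_list (map (\<lambda>l. if fst l = a then if snd l then 1 else - 1 else 0) w)"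

lemma expo_mult:
  assumes "u \<in> carrier F2" "v \<in> carrier F2"
  shows "expo a (u \<ast> v) = expo a u + expo a v"
proof -
  let ?A = "\<lambda>l z. (if fst l = a then if snd l then 1 else - 1 else 0) + (z::int)"
  interpret free_action "{1, 2}" ?A UNIV
    by unfold_locales (auto simp: flip_letter_def)
  have shift: "foldr ?A w z = expo a w + z" for w z
    by (induction w) (simp_all add: expo_def)
  show ?thesis
    using foldr_mult[of u v 0] assms by (simp add: shift F2_def)
qed

lemma expo_one [simp]: "expo a \<one>\<^bsub>F2\<^esub> = 0"
  by (simp add: one_F2 expo_def)

lemma expo_inv: "u \<in> carrier F2 \<Longrightarrow> expo a (\<inverse> u) = - expo a u"
  using expo_mult[of "\<inverse> u" u a] by (simp add: F2.l_inv)

lemma expo_gen [simp]: "expo a (gen b) = (if a = b then 1 else 0)"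
  by (simp add: expo_def gen_def)

lemma expo_pow: "u \<in> carrier F2 \<Longrightarrow> expo a (u [^]\<^bsub>F2\<^esub> (k::nat)) = int k * expo a u"
  by (induction k) (simp_all add: expo_mult algebra_simps)

text \<open>The kernel of the abelianization reduced modulo \<open>m\<close>.\<close>

definition expo_kernel :: "int \<Rightarrow> (nat \<times> bool) list set" where
  "expo_kernel m = {w \<in> carrier F2. m dvd expo 1 w \<and> m dvd expo 2 w}"

lemma expo_kernel_fin_index:
  assumes "m > 0"
  shows "expo_kernel m \<in> fin_index_normals F2"
proof (rule F2.fin_index_normalsI[where r = "\<lambda>w. (expo 1 w mod m, expo 2 w mod m)"])
  show "expo_kernel m \<lhd> F2"
    unfolding F2.normal_inv_iff expo_kernel_def
    by (auto intro!: F2.subgroupI exI[of _ "\<one>\<^bsub>F2\<^esub>"] simp: expo_mult expo_inv)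
  have "(\<lambda>w. (expo 1 w mod m, expo 2 w mod m)) ` carrier F2 \<subseteq> {0..<m} \<times> {0..<m}"
    using assms by auto
  then show "finite ((\<lambda>w. (expo 1 w mod m, expo 2 w mod m)) ` carrier F2)"
    using finite_subset by blast
qed (auto simp: expo_kernel_def expo_mult expo_inv mod_eq_dvd_iff)

locale F2_action = free_action "{1, 2 :: nat}" A Z for A :: "nat \<times> bool \<Rightarrow> 'b \<Rightarrow> 'b" and Z
begin

lemmas F2_mult = foldr_mult[folded F2_def]
lemmas F2_carrier = foldr_carrier[folded F2_def]
lemmas F2_inv = foldr_inv[folded F2_def]
definition F2_kernel :: "(nat \<times> bool) list set" where
  "F2_kernel = {w \<in> carrier F2. \<forall>z\<in>Z. foldr A w z = z}"

lemma F2_kernel_fin_index: "finite Z \<Longrightarrow> F2_kernel \<in> fin_index_normals F2"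
  using action_kernel_fin_index[folded F2_def]
  unfolding F2_kernel_def action_kernel_def[folded F2_def] .

lemma F2_kernelD: "\<lbrakk>w \<in> F2_kernel; z \<in> Z\<rbrakk> \<Longrightarrow> foldr A w z = z"
  by (simp add: F2_kernel_def)

end

text \<open>In the action below, a suitable power of \<^term>\<open>gen a\<close> moves exactly the points over the powers
  of \<^term>\<open>gen a\<close>. An element that is central modulo the kernel therefore lies over a power
  of either generator, and the exponent sums show that it is trivial.\<close>

lemma exists_cover_central_trivial:
  assumes N: "N \<in> fin_index_normals F2" and "c > 0"
  obtains K where "K \<in> fin_index_normals F2" "K \<subseteq> N" "K \<subseteq> expo_kernel c"
    "\<And>h. \<lbrakk>h \<in> carrier F2;
       \<And>a. a \<in> {1, 2} \<Longrightarrow> h \<ast> gen a \<ast> \<inverse> h \<ast> \<inverse> gen a \<in> K\<rbrakk> \<Longrightarrow> h \<in> N"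
proof -
  interpret N: normal N F2 using N by (simp add: fin_index_normals_def)
  define n where "n = card (rcosets\<^bsub>F2\<^esub> N)"
  have fin: "finite (rcosets\<^bsub>F2\<^esub> N)" using N by (simp add: fin_index_normals_def)
  then have "n > 0"
    unfolding n_def using N.subgroup_in_rcosets[OF F2.is_group] by (auto simp: card_gt_0_iff)
  \<comment> \<open>The index \<open>n\<close> forces the \<open>n\<close>-th power of each
    generator into \<open>N\<close>; the factor \<open>c\<close> gives
    \<open>K \<subseteq> expo_kernel c\<close> at the end.\<close>
  define m where "m = n * nat c"
  have m: "m > 0" "c dvd int m" using \<open>n > 0\<close> \<open>c > 0\<close> by (auto simp: m_def)
  \<comment> \<open>Passing to \<open>N1\<close> gives each generator order exactly \<open>m\<close>
    in the quotient and lets exponent sums distinguish powers of \<open>gen 1\<close> from powers of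
    \<open>gen 2\<close>.\<close>
  define N1 where "N1 = N \<inter> expo_kernel (int m)"
  have N1: "N1 \<in> fin_index_normals F2"
    unfolding N1_def using N m by (intro F2.fin_index_normals_Int expo_kernel_fin_index) auto
  then interpret N1: normal N1 F2 by (simp add: fin_index_normals_def)
  note N1_sub = N1.is_subgroup
  have N1I: "w \<in> N1" if "w \<in> N" "w \<in> carrier F2" "int m dvd expo 1 w" "int m dvd expo 2 w" for w
    using that unfolding N1_def expo_kernel_def by blast
  have N1D: "w \<in> N" "int m dvd expo 1 w" "int m dvd expo 2 w" if "w \<in> N1" for w
    using that unfolding N1_def expo_kernel_def by blast+
  have pow_mem: "gen a [^]\<^bsub>F2\<^esub> m \<in> N1" if "a \<in> {1, 2}" for a
  proof -
    have "gen a [^]\<^bsub>F2\<^esub> m = (gen a [^]\<^bsub>F2\<^esub> n) [^]\<^bsub>F2\<^esub> nat c"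
      using gen_carrier'[OF that] by (simp add: F2.nat_pow_pow m_def)
    moreover have "gen a [^]\<^bsub>F2\<^esub> n \<in> N"
      unfolding n_def using N.pow_index_mem[OF fin] gen_carrier'[OF that] .
    moreover have "u [^]\<^bsub>F2\<^esub> k \<in> N" if "u \<in> N" for u and k :: nat
      using that by (induction k) (auto intro: N.m_closed)
    ultimately have "gen a [^]\<^bsub>F2\<^esub> m \<in> N" by simp
    then show ?thesis
      using gen_carrier'[OF that] by (intro N1I) (simp_all add: expo_pow)
  qed
  \<comment> \<open>A cover of the Cayley graph of the quotient by \<open>N1\<close>, with group of
    order four. The edge labelled \<open>a\<close> that leaves the vertex \<open>N1\<close> is
    marked, and crossing it in either direction toggles \<open>a\<close> in \<open>J\<close>. For an
    inverse letter that edge starts at the new vertex \<open>D\<close>.\<close>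
  define A where "A = (\<lambda>l (C, J). let D = [l] <#\<^bsub>F2\<^esub> C in
      (D, if (if snd l then C else D) = N1 then (J - {fst l}) \<union> ({fst l} - J) else J))"
  define Z where "Z = (\<lambda>g. g <#\<^bsub>F2\<^esub> N1) ` carrier F2 \<times> Pow {1, 2 :: nat}"
  have lcos_lcos: "g <#\<^bsub>F2\<^esub> (h <#\<^bsub>F2\<^esub> N1) = (g \<ast> h) <#\<^bsub>F2\<^esub> N1"
    if "g \<in> carrier F2" "h \<in> carrier F2" for g h
    using F2.lcos_m_assoc[OF N1.subset that] .
  have nil_lcos: "[] <#\<^bsub>F2\<^esub> (g <#\<^bsub>F2\<^esub> N1) = g <#\<^bsub>F2\<^esub> N1" if "g \<in> carrier F2" for g
    using lcos_lcos[OF F2.one_closed that] that by (simp add: F2.l_one[OF that, unfolded one_F2] one_F2)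
  have flip: "[flip_letter l] \<ast> [l] = \<one>\<^bsub>F2\<^esub>" for l
    by (simp add: F2_def mult_free_group one_free_group cancel_cons_def)
  interpret act: F2_action A Z
  proof
    fix l :: "nat \<times> bool" and z assume l: "l \<in> {1, 2} \<times> UNIV" and z: "z \<in> Z"
    obtain g J where gJ: "z = (g <#\<^bsub>F2\<^esub> N1, J)" "g \<in> carrier F2" "J \<subseteq> {1, 2}"
      using z by (auto simp: Z_def)
    have lc: "[l] \<in> carrier F2" "[flip_letter l] \<in> carrier F2"
      using l by (auto simp: letter_carrier_F2 flip_letter_def)
    show "A l z \<in> Z"
      using gJ l lc by (auto simp: A_def Z_def Let_def lcos_lcos)
    have "[flip_letter l] \<ast> ([l] \<ast> g) = g"
      using lc gJ flip[of l] by (simp flip: F2.m_assoc)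
    then have "[flip_letter l] <#\<^bsub>F2\<^esub> ([l] <#\<^bsub>F2\<^esub> (g <#\<^bsub>F2\<^esub> N1)) = g <#\<^bsub>F2\<^esub> N1"
      using gJ lc by (simp add: lcos_lcos)
    then show "A (flip_letter l) (A l z) = z"
      using gJ by (auto simp: A_def Let_def flip_letter_def)
  qed
  define K where "K = act.F2_kernel"
  have "finite Z"
    using N1 N1.l_cosets_eq_rcosets by (auto simp: Z_def fin_index_normals_def)
  then have K: "K \<in> fin_index_normals F2"
    using act.F2_kernel_fin_index by (simp add: K_def)
  have fst_foldr: "fst (foldr A w z) = w <#\<^bsub>F2\<^esub> fst z" if w: "w \<in> carrier F2" and z: "z \<in> Z" for w z
    using w 
  proof (induction rule: F2_letter_induct)
    case one
    then show ?case using z nil_lcos by (auto simp: one_F2 Z_def)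
  next
    case (mult l w)
    obtain g J where gJ: "z = (g <#\<^bsub>F2\<^esub> N1, J)" "g \<in> carrier F2"
      using z by (auto simp: Z_def)
    have "foldr A ([l] \<ast> w) z = A l (foldr A w z)"
      using act.F2_mult[of "[l]" w z] mult z letter_carrier_F2[of l] by simp
    then show ?case
      using mult gJ letter_carrier_F2[of l] by (auto simp: A_def Let_def lcos_lcos F2.m_assoc split: prod.splits)
  qed
  have z0: "(N1, {}) \<in> Z"
    using F2.lcos_mult_one[OF N1.subset] F2.one_closed by (force simp: Z_def)
  have N1_eq: "g <#\<^bsub>F2\<^esub> N1 = N1 \<longleftrightarrow> g \<in> N1" if "g \<in> carrier F2" for g
    using F2.l_coset_eq_iff[OF N1_sub that F2.one_closed] F2.lcos_mult_one[OF N1.subset] that by simp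
  have foldr_gen: "foldr A (gen a) z = A (a, True) z" for a z
    by (simp add: gen_def)
  have A_gen: "A (a, True) (C, J) = (gen a <#\<^bsub>F2\<^esub> C,
      if C = N1 then (J - {a}) \<union> ({a} - J) else J)" for a C J
    by (simp add: A_def gen_def)
  have foldr_pow_Suc: "foldr A (gen a [^]\<^bsub>F2\<^esub> Suc k) z = A (a, True) (foldr A (gen a [^]\<^bsub>F2\<^esub> k) z)"
    if "a \<in> {1, 2}" "z \<in> Z" for a k z
    using act.F2_mult[of "gen a" "gen a [^]\<^bsub>F2\<^esub> k" z] that gen_carrier'[of a]
      F2.nat_pow_Suc2[of "gen a" k]
    by (simp add: foldr_gen del: F2.nat_pow_Suc)
  \<comment> \<open>The vertices visited from \<open>N1\<close> form a cycle of length exactly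
    \<open>m\<close>, by the exponent sums, so the marked edge is crossed once and \<open>a\<close>
    ends up in the second component.\<close>
  have moved: "foldr A (gen a [^]\<^bsub>F2\<^esub> m) (N1, {}) \<noteq> (N1, {})" if a: "a \<in> {1, 2}" for a
  proof -
    have "foldr A (gen a [^]\<^bsub>F2\<^esub> k) (N1, {}) = ((gen a [^]\<^bsub>F2\<^esub> k) <#\<^bsub>F2\<^esub> N1, {a})"
      if "0 < k" "k \<le> m" for k
      using that
    proof (induction k)
      case (Suc k)
      show ?case
      proof (cases "k = 0")
        case True
        then show ?thesis
          using gen_carrier'[OF a] by (simp add: foldr_gen A_gen)
      next
        case False
        have "gen a [^]\<^bsub>F2\<^esub> k \<notin> N1"
        proof
          assume "gen a [^]\<^bsub>F2\<^esub> k \<in> N1"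
          then have "int m dvd expo a (gen a [^]\<^bsub>F2\<^esub> k)"
            using a N1D(2,3) by auto
          then show False
            using False Suc gen_carrier'[OF a] dvd_imp_le[of m k] by (auto simp: expo_pow)
        qed
        then show ?thesis
          using Suc False a gen_carrier'[OF a] foldr_pow_Suc[OF a z0, of k] F2.nat_pow_Suc2[of "gen a" k]
          by (simp add: A_gen lcos_lcos N1_eq del: F2.nat_pow_Suc)
      qed
    qed simp
    then show ?thesis using \<open>m > 0\<close> by simp
  qed
  \<comment> \<open>A cycle that avoids \<open>N1\<close> never crosses the marked edge labelled
    \<open>a\<close>.\<close>
  have fixed: "foldr A (gen a [^]\<^bsub>F2\<^esub> m) (h <#\<^bsub>F2\<^esub> N1, J) = (h <#\<^bsub>F2\<^esub> N1, J)"
    if a: "a \<in> {1, 2}" and h: "h \<in> carrier F2" "J \<subseteq> {1, 2}"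
      and no: "\<And>k. gen a [^]\<^bsub>F2\<^esub> (k::nat) \<ast> h \<notin> N1" for a h J
  proof -
    have "foldr A (gen a [^]\<^bsub>F2\<^esub> k) (h <#\<^bsub>F2\<^esub> N1, J) = ((gen a [^]\<^bsub>F2\<^esub> k \<ast> h) <#\<^bsub>F2\<^esub> N1, J)" for k :: nat
    proof (induction k)
      case 0
      then show ?case using h by (simp add: one_F2[symmetric]) (simp add: one_F2)
    next
      case (Suc k)
      have "(h <#\<^bsub>F2\<^esub> N1, J) \<in> Z" using h by (simp add: Z_def)
      then show ?case
        using Suc a gen_carrier'[OF a] foldr_pow_Suc[OF a, of _ k] F2.nat_pow_Suc2[of "gen a" k] h no[of k]
        by (simp add: A_gen lcos_lcos N1_eq F2.m_assoc del: F2.nat_pow_Suc)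
    qed
    moreover have "(gen a [^]\<^bsub>F2\<^esub> m \<ast> h) <#\<^bsub>F2\<^esub> N1 = h <#\<^bsub>F2\<^esub> N1"
      using pow_mem[OF a] h gen_carrier'[OF a] F2.l_coset_eq_iff[OF N1_sub]
        N1.inv_op_closed1[of h "gen a [^]\<^bsub>F2\<^esub> m"]
      by (simp add: F2.m_assoc)
    ultimately show ?thesis by simp
  qed
  have K_N1: "K \<subseteq> N1"
  proof
    fix w assume w: "w \<in> K"
    then have wc: "w \<in> carrier F2" by (simp add: K_def act.F2_kernel_def)
    have "w <#\<^bsub>F2\<^esub> N1 = N1"
      using fst_foldr[OF wc z0] w z0 by (simp add: K_def act.F2_kernel_def)
    then show "w \<in> N1" using N1_eq wc by simp
  qed
  have central: "h \<in> N"
    if h: "h \<in> carrier F2"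
      and comm: "\<And>a. a \<in> {1, 2} \<Longrightarrow> h \<ast> gen a \<ast> \<inverse> h \<ast> \<inverse> gen a \<in> K" for h
  proof -
    \<comment> \<open>If \<open>h\<close> commutes with \<open>gen a\<close>, it also carries points
      moved by the \<open>m\<close>-th power of \<open>gen a\<close> to points moved by it; so
      \<open>h\<close> takes the base point to a point over the cycle through
      \<open>N1\<close>.\<close>
    have ex: "\<exists>k. gen a [^]\<^bsub>F2\<^esub> (k::nat) \<ast> h \<in> N1" if a: "a \<in> {1, 2}" for a
    proof (rule ccontr)
      assume no: "\<nexists>k. gen a [^]\<^bsub>F2\<^esub> (k::nat) \<ast> h \<in> N1"
      note ga = gen_carrier'[OF a]
      let ?c = "h \<ast> gen a \<ast> \<inverse> h \<ast> \<inverse> gen a"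
      have swap: "foldr A h (foldr A (gen a) z) = foldr A (gen a) (foldr A h z)" if z: "z \<in> Z" for z
      proof -
        have "?c \<ast> (gen a \<ast> h) = h \<ast> gen a"
          using h ga by (simp add: F2.m_assoc F2.inv_solve_left' flip: F2.m_assoc[of "\<inverse> gen a"])
        moreover have "foldr A (?c \<ast> (gen a \<ast> h)) z = foldr A (gen a \<ast> h) z"
          using act.F2_mult[of ?c "gen a \<ast> h" z] act.F2_carrier[of "gen a \<ast> h" z]
            comm[OF a] h ga z by (simp add: K_def act.F2_kernel_def)
        ultimately show ?thesis
          using act.F2_mult[of h "gen a" z] act.F2_mult[of "gen a" h z] h ga z by simp
      qed
      have "foldr A h (foldr A (gen a [^]\<^bsub>F2\<^esub> k) z) = foldr A (gen a [^]\<^bsub>F2\<^esub> k) (foldr A h z)"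
        if z: "z \<in> Z" for z and k :: nat
      proof (induction k)
        case (Suc k)
        have "foldr A (gen a [^]\<^bsub>F2\<^esub> k) z \<in> Z" "foldr A h z \<in> Z"
          using act.F2_carrier ga h z by simp_all
        then show ?case
          using Suc swap[of "foldr A (gen a [^]\<^bsub>F2\<^esub> k) z"] foldr_pow_Suc[OF a, of _ k] z
          by (simp add: foldr_gen del: F2.nat_pow_Suc)
      qed (simp add: one_F2)
      from this[OF z0, of m]
      have "foldr A h (foldr A (gen a [^]\<^bsub>F2\<^esub> m) (N1, {})) = foldr A (gen a [^]\<^bsub>F2\<^esub> m) (foldr A h (N1, {}))" .
      also have "\<dots> = foldr A h (N1, {})"
        using fixed[OF a h, of "snd (foldr A h (N1, {}))"] no fst_foldr[OF h z0]
          act.F2_carrier[of h "(N1, {})"] h z0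
        by (cases "foldr A h (N1, {})") (auto simp: Z_def)
      finally have "foldr A (gen a [^]\<^bsub>F2\<^esub> m) (N1, {}) = (N1, {})"
        using act.F2_inv(1)[of h] act.F2_carrier[of "gen a [^]\<^bsub>F2\<^esub> m" "(N1, {})"] h ga z0
        by (metis F2.nat_pow_closed)
      then show False using moved[OF a] by simp
    qed
    obtain k :: nat where k: "gen 1 [^]\<^bsub>F2\<^esub> k \<ast> h \<in> N1" using ex[of 1] by auto
    obtain l :: nat where l: "gen 2 [^]\<^bsub>F2\<^esub> l \<ast> h \<in> N1" using ex[of 2] by auto
    \<comment> \<open>Modulo \<open>N1\<close>, \<open>h\<close> is inverse both to a power of
      \<open>gen 1\<close> and to a power of \<open>gen 2\<close>. The latter has exponent sum zero
      in \<open>gen 1\<close>, so the former is trivial.\<close>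
    have "int m dvd expo 1 h"
      using N1D(2)[OF l] h by (simp add: expo_mult expo_pow)
    moreover have "int m dvd int k + expo 1 h"
      using N1D(2)[OF k] h by (simp add: expo_mult expo_pow)
    ultimately have "m dvd k" by (simp add: dvd_add_left_iff)
    then obtain j where "k = m * j" by auto
    then have "gen 1 [^]\<^bsub>F2\<^esub> k = (gen 1 [^]\<^bsub>F2\<^esub> m) [^]\<^bsub>F2\<^esub> j"
      by (simp add: F2.nat_pow_pow)
    moreover have "(gen 1 [^]\<^bsub>F2\<^esub> m) [^]\<^bsub>F2\<^esub> j \<in> N1" for j :: nat
      using pow_mem[of 1] by (induction j) (auto intro: N1.m_closed)
    ultimately have "gen 1 [^]\<^bsub>F2\<^esub> k \<in> N1" by simp
    then have "h \<in> N1"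
      using N1.m_closed[OF N1.m_inv_closed k, of "gen 1 [^]\<^bsub>F2\<^esub> k"] h by (simp flip: F2.m_assoc)
    then show ?thesis by (rule N1D)
  qed
  have "expo_kernel (int m) \<subseteq> expo_kernel c"
    using m dvd_trans by (auto simp: expo_kernel_def)
  then have "N1 \<subseteq> expo_kernel c" unfolding N1_def by blast
  then show thesis
    using that[OF K _ _ central] K_N1 N1D(1) by blast
qed

section \<open>Automorphisms of the free group of rank two\<close>

lemma mult_F2: "u \<ast> v = foldr cancel_cons u v"
  by (simp add: F2_def mult_free_group)

lemma carrier_F2: "w \<in> carrier F2 \<longleftrightarrow> set w \<subseteq> {1, 2} \<times> UNIV \<and> freely_reduced w"
  unfolding F2_def carrier_free_group lists_eq_set by blast

lemma inv_F2: "w \<in> carrier F2 \<Longrightarrow> \<inverse> w = map flip_letter (rev w)"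
  by (simp add: F2_def inv_free_group)

lemmas F2_eval = mult_F2 carrier_F2 inv_F2 one_F2 gen_def freely_reduced_def flip_letter_def cancel_cons_def

lemma hom_F2_eqI:
  assumes "group H" "f \<in> hom F2 H" "g \<in> hom F2 H"
    and eq: "f (gen 1) = g (gen 1)" "f (gen 2) = g (gen 2)" and w: "w \<in> carrier F2"
  shows "f w = g w"
  using hom_free_group_eqI[OF assms(1) assms(2,3)[unfolded F2_def] _ w[unfolded F2_def]] eq
  by (auto simp: gen_def)

lemma free_lift_F2_hom:
  assumes "group H" "f 1 \<in> carrier H" "f 2 \<in> carrier H"
  shows "free_lift H f \<in> hom F2 H"
  by (rule free_lift_hom[where S = "{1, 2 :: nat}", folded F2_def]) (use assms in auto)

section \<open>Automorphism groups\<close>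

lemma mem_autoD:
  assumes "\<phi> \<in> auto G"
  shows "\<phi> \<in> hom G G" "\<phi> \<in> extensional (carrier G)" "bij_betw \<phi> (carrier G) (carrier G)"
  using assms by (auto simp: auto_def Bij_def)

lemma carrier_AutoGroup [simp]: "carrier (AutoGroup G) = auto G"
  by (simp add: AutoGroup_def)

lemma mult_AutoGroup:
  assumes "\<phi> \<in> auto G" "\<psi> \<in> auto G"
  shows "\<phi> \<otimes>\<^bsub>AutoGroup G\<^esub> \<psi> = compose (carrier G) \<phi> \<psi>"
  using assms by (simp add: AutoGroup_def BijGroup_def auto_def)

lemma one_AutoGroup: "\<one>\<^bsub>AutoGroup G\<^esub> = (\<lambda>x\<in>carrier G. x)"
  by (simp add: AutoGroup_def BijGroup_def)

lemma mult_AutoGroup_apply: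
  assumes "\<phi> \<in> auto G" "\<psi> \<in> auto G" "x \<in> carrier G"
  shows "(\<phi> \<otimes>\<^bsub>AutoGroup G\<^esub> \<psi>) x = \<phi> (\<psi> x)"
  using assms by (simp add: mult_AutoGroup compose_def)

lemma auto_eqI:
  assumes "\<phi> \<in> auto G" "\<psi> \<in> auto G" "\<And>x. x \<in> carrier G \<Longrightarrow> \<phi> x = \<psi> x"
  shows "\<phi> = \<psi>"
  using assms by (meson extensionalityI mem_autoD)

lemma (in group) auto_inv_apply:
  assumes "\<phi> \<in> auto G" "x \<in> carrier G"
  shows "\<phi> ((inv\<^bsub>AutoGroup G\<^esub> \<phi>) x) = x" "(inv\<^bsub>AutoGroup G\<^esub> \<phi>) (\<phi> x) = x"
    "(inv\<^bsub>AutoGroup G\<^esub> \<phi>) x \<in> carrier G" "\<phi> x \<in> carrier G"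
proof -
  interpret A: group "AutoGroup G" by (rule AutoGroup)
  have i: "inv\<^bsub>AutoGroup G\<^esub> \<phi> \<in> auto G" using A.inv_closed assms by simp
  show "\<phi> ((inv\<^bsub>AutoGroup G\<^esub> \<phi>) x) = x"
    using A.r_inv[of \<phi>] mult_AutoGroup_apply[OF assms(1) i assms(2)] assms by (simp add: one_AutoGroup)
  show "(inv\<^bsub>AutoGroup G\<^esub> \<phi>) (\<phi> x) = x"
    using A.l_inv[of \<phi>] mult_AutoGroup_apply[OF i assms] assms by (simp add: one_AutoGroup)
  show "(inv\<^bsub>AutoGroup G\<^esub> \<phi>) x \<in> carrier G" "\<phi> x \<in> carrier G"
    using mem_autoD(1)[OF i] mem_autoD(1)[OF assms(1)] assms(2) by (auto simp: hom_def)
qed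

interpretation A2: group "AutoGroup F2"
  by (rule F2.AutoGroup)

lemma auto_closed: "\<lbrakk>\<phi> \<in> auto G; x \<in> carrier G\<rbrakk> \<Longrightarrow> \<phi> x \<in> carrier G"
  using mem_autoD(1) by (auto simp: hom_def)

lemma auto_mult:
  "\<lbrakk>\<phi> \<in> auto G; x \<in> carrier G; y \<in> carrier G\<rbrakk> \<Longrightarrow> \<phi> (x \<otimes>\<^bsub>G\<^esub> y) = \<phi> x \<otimes>\<^bsub>G\<^esub> \<phi> y"
  using mem_autoD(1)[of \<phi> G] by (auto simp: hom_def)

lemma (in group) auto_inv: "\<lbrakk>\<phi> \<in> auto G; x \<in> carrier G\<rbrakk> \<Longrightarrow> \<phi> (inv x) = inv (\<phi> x)"
  using mem_autoD(1)[of \<phi> G] by (metis group_hom.hom_inv group_hom.intro group_hom_axioms.intro is_group)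

lemma auto_F2_eqI:
  assumes "\<phi> \<in> auto F2" "\<psi> \<in> auto F2" "\<phi> (gen 1) = \<psi> (gen 1)" "\<phi> (gen 2) = \<psi> (gen 2)"
  shows "\<phi> = \<psi>"
  using assms by (blast intro: auto_eqI hom_F2_eqI[OF F2.is_group] mem_autoD(1))

text \<open>The restriction makes the map extensional, as membership in \<open>auto\<close>
  demands.\<close>

definition endo :: "(nat \<times> bool) list \<Rightarrow> (nat \<times> bool) list \<Rightarrow> (nat \<times> bool) list \<Rightarrow> (nat \<times> bool) list" where
  "endo u v = restrict (free_lift F2 (\<lambda>a. if a = 1 then u else v)) (carrier F2)"

lemma endo_hom:
  assumes "u \<in> carrier F2" "v \<in> carrier F2"
  shows "endo u v \<in> hom F2 F2"
proof -
  have "free_lift F2 (\<lambda>a. if a = 1 then u else v) \<in> hom F2 F2"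
    by (rule free_lift_F2_hom) (use assms F2.is_group in auto)
  then show ?thesis by (auto simp: hom_def endo_def)
qed

lemma endo_gen:
  assumes "u \<in> carrier F2" "v \<in> carrier F2"
  shows "endo u v (gen 1) = u" "endo u v (gen (Suc 0)) = u" "endo u v (gen 2) = v"
  using assms by (auto simp: endo_def free_lift_def) (simp_all add: gen_def)

text \<open>The words \<open>u'\<close> and \<open>v'\<close> are the images of the generators under
  the inverse, so bijectivity reduces to four evaluations.\<close>

lemma endo_auto:
  assumes c: "u \<in> carrier F2" "v \<in> carrier F2" "u' \<in> carrier F2" "v' \<in> carrier F2"
    and "endo u v u' = gen 1" "endo u v v' = gen 2" "endo u' v' u = gen 1" "endo u' v' v = gen 2"
  shows "endo u v \<in> auto F2"
proof -
  have id: "endo u v (endo u' v' w) = w"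
    if c: "u \<in> carrier F2" "v \<in> carrier F2" "u' \<in> carrier F2" "v' \<in> carrier F2"
      and e: "endo u v u' = gen 1" "endo u v v' = gen 2" and w: "w \<in> carrier F2" for u v u' v' w
  proof -
    have "compose (carrier F2) (endo u v) (endo u' v') w = (\<lambda>x\<in>carrier F2. x) w"
    proof (rule hom_F2_eqI[OF F2.is_group _ _ _ _ w])
      show "compose (carrier F2) (endo u v) (endo u' v') \<in> hom F2 F2"
        using F2.hom_compose[OF endo_hom[OF c(3,4)] endo_hom[OF c(1,2)]] .
      show "(\<lambda>x\<in>carrier F2. x) \<in> hom F2 F2"
        using F2.id_in_auto by (rule mem_autoD)
    qed (use c e in \<open>simp_all add: compose_def endo_gen\<close>)
    then show ?thesis using w by (simp add: compose_def)
  qed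
  have "bij_betw (endo u v) (carrier F2) (carrier F2)"
    using endo_hom[OF c(1,2)] endo_hom[OF c(3,4)] assms
    by (intro bij_betw_byWitness[where f' = "endo u' v'"]) (auto simp: id hom_def)
  then show ?thesis
    using endo_hom[OF c(1,2)] by (auto simp: auto_def Bij_def endo_def)
qed

section \<open>Inner automorphisms\<close>

definition conj_aut :: "('a, 'b) monoid_scheme \<Rightarrow> 'a \<Rightarrow> 'a \<Rightarrow> 'a" where
  "conj_aut G h = (\<lambda>x\<in>carrier G. h \<otimes>\<^bsub>G\<^esub> x \<otimes>\<^bsub>G\<^esub> inv\<^bsub>G\<^esub> h)"

context group
begin

lemma inner_auto:
  assumes "h \<in> carrier G"
  shows "conj_aut G h \<in> auto G"
proof -
  have "conj_aut G h \<in> hom G G"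
    using assms by (auto intro!: homI simp: conj_aut_def m_assoc) (simp flip: m_assoc)
  moreover have "bij_betw (conj_aut G h) (carrier G) (carrier G)"
    using assms by (intro bij_betw_byWitness[where f' = "conj_aut G (inv h)"])
      (auto simp: conj_aut_def m_assoc, auto simp flip: m_assoc)
  ultimately show ?thesis by (auto simp: auto_def Bij_def conj_aut_def)
qed

lemma inner_hom: "conj_aut G \<in> hom G (AutoGroup G)"
proof (rule homI)
  fix g h assume gh: "g \<in> carrier G" "h \<in> carrier G"
  show "conj_aut G (g \<otimes> h) = conj_aut G g \<otimes>\<^bsub>AutoGroup G\<^esub> conj_aut G h"
  proof (rule auto_eqI)
    interpret A: group "AutoGroup G" by (rule AutoGroup)
    show "conj_aut G g \<otimes>\<^bsub>AutoGroup G\<^esub> conj_aut G h \<in> auto G"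
      using A.m_closed[of "conj_aut G g" "conj_aut G h"] inner_auto gh by simp
    show "conj_aut G (g \<otimes> h) x = (conj_aut G g \<otimes>\<^bsub>AutoGroup G\<^esub> conj_aut G h) x" if "x \<in> carrier G" for x
      using that gh
      by (simp add: mult_AutoGroup_apply inner_auto) (simp add: conj_aut_def m_assoc inv_mult_group)
  qed (use gh in \<open>simp_all add: inner_auto\<close>)
qed (simp add: inner_auto)

text \<open>Normality of the inner automorphisms, in the form that moves an inner factor to the
  left.\<close>

lemma auto_inner:
  assumes "\<phi> \<in> auto G" "h \<in> carrier G"
  shows "\<phi> \<otimes>\<^bsub>AutoGroup G\<^esub> conj_aut G h = conj_aut G (\<phi> h) \<otimes>\<^bsub>AutoGroup G\<^esub> \<phi>"
proof (rule auto_eqI)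
  interpret A: group "AutoGroup G" by (rule AutoGroup)
  note c = auto_closed[OF assms]
  show "\<phi> \<otimes>\<^bsub>AutoGroup G\<^esub> conj_aut G h \<in> auto G" "conj_aut G (\<phi> h) \<otimes>\<^bsub>AutoGroup G\<^esub> \<phi> \<in> auto G"
    using A.m_closed assms inner_auto c by auto
  show "(\<phi> \<otimes>\<^bsub>AutoGroup G\<^esub> conj_aut G h) x = (conj_aut G (\<phi> h) \<otimes>\<^bsub>AutoGroup G\<^esub> \<phi>) x" if x: "x \<in> carrier G" for x
    using assms x c inner_auto auto_closed[OF assms(1) x]
    by (simp add: mult_AutoGroup_apply) (simp add: conj_aut_def auto_mult auto_inv)
qed

end

section \<open>The two twists and the puncture\<close>

definition alpha :: "(nat \<times> bool) list \<Rightarrow> (nat \<times> bool) list" where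
  "alpha = endo (gen 1) [(1, True), (1, True), (2, True)]"

definition beta :: "(nat \<times> bool) list \<Rightarrow> (nat \<times> bool) list" where
  "beta = endo [(1, True), (2, True), (2, True)] (gen 2)"

text \<open>With the free group as fundamental group of a torus with one puncture, this commutator
  is the loop around the puncture.\<close>

definition tau :: "(nat \<times> bool) list" where
  "tau = [(1, False), (2, True), (1, True), (2, False)]"

lemma tau_carrier: "tau \<in> carrier F2"
  by (auto simp: tau_def F2_eval)

lemma alpha_auto: "alpha \<in> auto F2"
  unfolding alpha_def
  by (rule endo_auto[where u' = "gen 1" and v' = "[(1, False), (1, False), (2, True)]"])
     (simp_all add: F2_eval endo_def free_lift_def)

lemma beta_auto: "beta \<in> auto F2"
  unfolding beta_def
  by (rule endo_auto[where u' = "[(1, True), (2, False), (2, False)]" and v' = "gen 2"])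
     (simp_all add: F2_eval endo_def free_lift_def)

lemma alpha_gen: "alpha (gen 1) = gen 1" "alpha (gen (Suc 0)) = gen 1" "alpha (gen 2) = [(1, True), (1, True), (2, True)]"
  by (simp_all add: F2_eval endo_def free_lift_def alpha_def)

lemma beta_gen: "beta (gen 1) = [(1, True), (2, True), (2, True)]"
   "beta (gen (Suc 0)) = [(1, True), (2, True), (2, True)]" "beta (gen 2) = gen 2"
  by (simp_all add: F2_eval endo_def free_lift_def beta_def)

lemma alpha_tau:
  "alpha tau = [(1, True), (1, True)] \<ast> tau \<ast> \<inverse> [(1, True), (1, True)]"
  by (simp add: F2_eval endo_def free_lift_def alpha_def tau_def)

lemma beta_tau:
  "beta tau = [(2, False), (2, False)] \<ast> tau \<ast> \<inverse> [(2, False), (2, False)]"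
  by (simp add: F2_eval endo_def free_lift_def beta_def tau_def)

text \<open>The generators are crossed and \<open>beta\<close> is inverted to match filling:
  \<open>alpha\<close> pushes the puncture along the square of \<open>gen 1\<close>, which fills to
  the inverse of \<open>gen 2\<close>, and the inverse of \<open>beta\<close> pushes it along the
  square of \<open>gen 2\<close>, which fills to the inverse of \<open>gen 1\<close>.\<close>

definition Theta :: "(nat \<times> bool) list \<Rightarrow> (nat \<times> bool) list \<Rightarrow> (nat \<times> bool) list" where
  "Theta = free_lift (AutoGroup F2) (\<lambda>a. if a = 2 then alpha else inv\<^bsub>AutoGroup F2\<^esub> beta)"

lemma Theta_hom: "Theta \<in> hom F2 (AutoGroup F2)"
  unfolding Theta_def
  by (rule free_lift_F2_hom) (use A2.is_group alpha_auto A2.inv_closed[of beta] beta_auto in auto)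

lemma Theta_auto: "g \<in> carrier F2 \<Longrightarrow> Theta g \<in> auto F2"
  using Theta_hom by (auto simp: hom_def)

lemma Theta_gen: "Theta (gen 1) = inv\<^bsub>AutoGroup F2\<^esub> beta" "Theta (gen (Suc 0)) = inv\<^bsub>AutoGroup F2\<^esub> beta" "Theta (gen 2) = alpha"
  using alpha_auto A2.inv_closed[of beta] beta_auto by (simp_all add: Theta_def free_lift_def gen_def)

section \<open>Detecting the action on a puncture\<close>

text \<open>Let \<open>P\<close> be the free product of three groups of order two, which contains \<open>F2\<close> with index two,
  and let \<open>F\<close> be the kernel of the map from \<open>P\<close> to Klein's four-group sending the three involutions to
  the three nontrivial elements. It is free on \<open>x\<close>, \<open>t\<close>, \<open>y\<close>. An action of \<open>F\<close> on a set induces an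
  action of \<open>P\<close>, and the following is the restriction of that action to \<open>F2\<close>. The word \<^term>\<open>tau\<close>
  acts on the block \<open>(False, False)\<close> as \<open>t\<close> squared.\<close>

fun induced_action ::
    "('s \<Rightarrow> 's) \<Rightarrow> ('s \<Rightarrow> 's) \<Rightarrow> ('s \<Rightarrow> 's) \<Rightarrow> ('s \<Rightarrow> 's) \<Rightarrow> ('s \<Rightarrow> 's) \<Rightarrow> ('s \<Rightarrow> 's)
      \<Rightarrow> nat \<times> bool \<Rightarrow> (bool \<times> bool) \<times> 's \<Rightarrow> (bool \<times> bool) \<times> 's" where
  "induced_action x x' y y' t t' (a, b) ((i, j), s) =
    (if a = 1 then
      ((\<not> i, j),
        if b then if i then if j then y s else y' (t' s) else if j then t s else s
        else if i then if j then t' s else s else if j then y' s else t (y s))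
     else
      ((i, \<not> j),
        if b then if i then if j then t s else x s else if j then s else t' (x' s)
        else if i then if j then x' s else t' s else if j then x (t s) else s))"

lemma induced_action_F2:
  assumes "\<And>f. f \<in> {x, x', y, y', t, t'} \<Longrightarrow> f \<in> S \<rightarrow> S"
    and "\<And>s. s \<in> S \<Longrightarrow> x (x' s) = s \<and> x' (x s) = s \<and> y (y' s) = s \<and> y' (y s) = s \<and> t (t' s) = s \<and> t' (t s) = s"
  shows "F2_action (induced_action x x' y y' t t') (UNIV \<times> S)"
proof
  have S: "x s \<in> S" "x' s \<in> S" "y s \<in> S" "y' s \<in> S" "t s \<in> S" "t' s \<in> S" if "s \<in> S" for s
    using assms(1) that by blast+
  fix l :: "nat \<times> bool" and z :: "(bool \<times> bool) \<times> 'a"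
  assume l: "l \<in> {1, 2} \<times> UNIV" and z: "z \<in> UNIV \<times> S"
  obtain i j s where z': "z = ((i, j), s)" "s \<in> S" using z by (metis mem_Times_iff prod.collapse)
  show "induced_action x x' y y' t t' l z \<in> UNIV \<times> S"
    using l z' S by auto
  have inv: "x (x' s) = s" "x' (x s) = s" "y (y' s) = s" "y' (y s) = s" "t (t' s) = s" "t' (t s) = s"
    if "s \<in> S" for s
    using assms(2) that by auto
  show "induced_action x x' y y' t t' (flip_letter l) (induced_action x x' y y' t t' l z) = z"
    using l z' by (auto simp: flip_letter_def inv S)
qed

text \<open>Induction is functorial in the set acted upon. This is applied to right multiplication,
  to reduction modulo \<open>K\<close>, and to forgetting the fibre on which \<open>t\<close>
  acts.\<close>

lemma induced_action_equivariant:
  assumes "\<And>s. s \<in> S \<Longrightarrow> h (x s) = x2 (h s) \<and> h (x' s) = x2' (h s) \<and> h (y s) = y2 (h s)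
      \<and> h (y' s) = y2' (h s) \<and> h (t s) = t2 (h s) \<and> h (t' s) = t2' (h s)"
    and "\<And>f. f \<in> {x, x', y, y', t, t'} \<Longrightarrow> f \<in> S \<rightarrow> S"
    and w: "w \<in> carrier F2" and z: "z \<in> UNIV \<times> S"
  shows "map_prod id h (foldr (induced_action x x' y y' t t') w z)
    = foldr (induced_action x2 x2' y2 y2' t2 t2') w (map_prod id h z)"
proof (rule foldr_equivariant[OF _ _ z])
  have S: "x s \<in> S" "x' s \<in> S" "y s \<in> S" "y' s \<in> S" "t s \<in> S" "t' s \<in> S" if "s \<in> S" for s
    using assms(2) that by blast+
  show "w \<in> lists ({1, 2} \<times> UNIV)" using w by (auto simp: carrier_F2)
  fix l :: "nat \<times> bool" and z assume l: "l \<in> {1, 2} \<times> UNIV" and z: "z \<in> (UNIV :: (bool \<times> bool) set) \<times> S"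
  obtain i j s where z': "z = ((i, j), s)" "s \<in> S" using z by (metis mem_Times_iff prod.collapse)
  obtain a b where l': "l = (a, b)" by (cases l) blast
  show "induced_action x x' y y' t t' l z \<in> UNIV \<times> S \<and>
    map_prod id h (induced_action x x' y y' t t' l z) =
    induced_action x2 x2' y2 y2' t2 t2' l (map_prod id h z)"
    using assms(1) S z' l' by auto
qed

text \<open>Since letters act bijectively, a relation twisted by \<open>\<phi>\<close> needs
  checking for the positive generators only.\<close>

lemma (in F2_action) F2_equivariant_hom:
  assumes \<phi>: "\<phi> \<in> hom F2 F2" and G: "G \<in> Z \<rightarrow> Z"
    and gens: "\<And>a z. \<lbrakk>a \<in> {1, 2}; z \<in> Z\<rbrakk> \<Longrightarrow> G (foldr A (gen a) z) = foldr A (\<phi> (gen a)) (G z)"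
    and w: "w \<in> carrier F2" and z: "z \<in> Z"
  shows "G (foldr A w z) = foldr A (\<phi> w) (G z)"
proof -
  interpret \<phi>: group_hom F2 F2 \<phi> by unfold_locales (rule \<phi>)
  have GZ: "G z \<in> Z" if "z \<in> Z" for z using G that by blast
  have inv: "G (foldr A (\<inverse> gen a) z) = foldr A (\<phi> (\<inverse> gen a)) (G z)"
    if a: "a \<in> {1, 2}" and z: "z \<in> Z" for a z
  proof -
    note ga = gen_carrier'[OF a]
    let ?z = "foldr A (\<inverse> gen a) z"
    have z': "?z \<in> Z" using F2_carrier ga z by simp
    have "G z = foldr A (\<phi> (gen a)) (G ?z)"
      using gens[OF a z'] F2_inv(2)[OF ga z] by simp
    then show ?thesis
      using F2_inv(1)[of "\<phi> (gen a)" "G ?z"] ga GZ[OF z'] by (simp add: \<phi>.hom_inv)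
  qed
  from w show ?thesis
  proof (induction rule: F2_letter_induct)
    case one
    then show ?case using \<phi>.hom_one by (simp add: one_F2)
  next
    case (mult l w)
    obtain a b where l: "l = (a, b)" "a \<in> {1, 2}" using mult by auto
    have lc: "[l] \<in> carrier F2" using mult letter_carrier_F2 by blast
    have wz: "foldr A w z \<in> Z" "foldr A (\<phi> w) (G z) \<in> Z" "G z \<in> Z"
      using F2_carrier mult z GZ by simp_all
    have "G (foldr A [l] z) = foldr A (\<phi> [l]) (G z)" if "z \<in> Z" for z
      using gens[OF l(2) that] inv[OF l(2) that] l letter_eq_gen(1)[of a] letter_eq_gen(2)[of a]
      by (cases b) simp_all
    then show ?case
      using F2_mult[OF lc mult(2) z] F2_mult[of "\<phi> [l]" "\<phi> w" "G z"] wz mult lc by simp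
  qed
qed

text \<open>The action on \<open>F2\<close> itself obtained by filling the puncture, that is for trivial \<open>t\<close>.\<close>

definition fill :: "nat \<times> bool \<Rightarrow> (bool \<times> bool) \<times> (nat \<times> bool) list \<Rightarrow> (bool \<times> bool) \<times> (nat \<times> bool) list" where
  "fill = induced_action ((\<ast>) (gen 1)) ((\<ast>) (\<inverse> gen 1))
     ((\<ast>) (gen 2)) ((\<ast>) (\<inverse> gen 2)) (\<lambda>s. s) (\<lambda>s. s)"

interpretation fill: F2_action fill "UNIV \<times> carrier F2"
  unfolding fill_def by (rule induced_action_F2) (auto simp flip: F2.m_assoc)

abbreviation base :: "bool \<times> bool" where "base \<equiv> (False, False)"

lemma fill_letter:
  "fill (1, True) ((i, j), s) = ((\<not> i, j), if i then (if j then gen 2 else \<inverse> gen 2) \<ast> s else s)"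
  "fill (1, False) ((i, j), s) = ((\<not> i, j), if i then s else (if j then \<inverse> gen 2 else gen 2) \<ast> s)"
  "fill (2, True) ((i, j), s) = ((i, \<not> j), if i then if j then s else gen 1 \<ast> s
     else if j then s else \<inverse> gen 1 \<ast> s)"
  "fill (2, False) ((i, j), s) = ((i, \<not> j), if i then if j then \<inverse> gen 1 \<ast> s else s
     else if j then gen 1 \<ast> s else s)"
  by (simp_all add: fill_def)

lemmas fill_letter' = fill_letter[unfolded One_nat_def]

lemma fill_gen: "foldr fill (gen a) z = fill (a, True) z"
  by (simp add: gen_def)

text \<open>Filling multiplies the second component from the left, so it commutes with right
  multiplication, and a word is known from its effect at the identity.\<close>

lemma fill_right_mult:
  assumes "w \<in> carrier F2" "s \<in> carrier F2" "g \<in> carrier F2" "foldr fill w (v, s) = (v', s')"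
  shows "foldr fill w (v, s \<ast> g) = (v', s' \<ast> g)"
proof -
  have "map_prod id (\<lambda>s. s \<ast> g) (foldr fill w (v, s)) = foldr fill w (map_prod id (\<lambda>s. s \<ast> g) (v, s))"
    unfolding fill_def
    by (rule induced_action_equivariant[where S = "carrier F2"]) (use assms in \<open>auto simp: F2.m_assoc\<close>)
  then show ?thesis using assms by simp
qed

text \<open>A push of the puncture becomes trivial when the puncture is filled. The comparison is
  limited to words that return to the base block, because elsewhere the two actions agree only up to
  a change of coordinates.\<close>

definition fill_invariant :: "((nat \<times> bool) list \<Rightarrow> (nat \<times> bool) list) \<Rightarrow> bool" where
  "fill_invariant \<phi> \<longleftrightarrow> (\<forall>w\<in>carrier F2. \<forall>s\<in>carrier F2. \<forall>s'. foldr fill w (base, s) = (base, s')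
     \<longrightarrow> foldr fill (\<phi> w) (base, s) = (base, s'))"

text \<open>The actions \<^term>\<open>foldr fill w\<close> and \<^term>\<open>foldr fill (\<phi> w)\<close> differ by a gauge
  transformation that is trivial on the base block.\<close>

lemma fill_invariant_gauge:
  assumes \<phi>: "\<phi> \<in> auto F2" and k: "\<And>v. k v \<in> carrier F2" "k base = \<one>\<^bsub>F2\<^esub>"
    and G: "G = (\<lambda>(v, s). (v, k v \<ast> s))"
    and gens: "\<And>a v s. \<lbrakk>a \<in> {1, 2}; s \<in> carrier F2\<rbrakk>
      \<Longrightarrow> G (foldr fill (gen a) (v, s)) = foldr fill (\<phi> (gen a)) (G (v, s))"
  shows "fill_invariant \<phi>" "fill_invariant (inv\<^bsub>AutoGroup F2\<^esub> \<phi>)"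
proof -
  have GZ: "G \<in> UNIV \<times> carrier F2 \<rightarrow> UNIV \<times> carrier F2"
    using k by (auto simp: G)
  have equiv: "G (foldr fill w (v, s)) = foldr fill (\<phi> w) (G (v, s))"
    if "w \<in> carrier F2" "s \<in> carrier F2" for w v s
    by (rule fill.F2_equivariant_hom[OF mem_autoD(1)[OF \<phi>] GZ]) (use gens that in auto)
  have G_base: "G (base, s) = (base, s)" if "s \<in> carrier F2" for s
    using that k by (simp add: G)
  show "fill_invariant \<phi>"
    unfolding fill_invariant_def
  proof (intro ballI allI impI)
    fix w s s' assume w: "w \<in> carrier F2" "s \<in> carrier F2" "foldr fill w (base, s) = (base, s')"
    then have "s' \<in> carrier F2" using fill.F2_carrier[of w "(base, s)"] by simp
    then show "foldr fill (\<phi> w) (base, s) = (base, s')"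
      using equiv[OF w(1,2), of base] w G_base by simp
  qed
  show "fill_invariant (inv\<^bsub>AutoGroup F2\<^esub> \<phi>)"
    unfolding fill_invariant_def
  proof (intro ballI allI impI)
    let ?\<psi> = "inv\<^bsub>AutoGroup F2\<^esub> \<phi>"
    fix w s s' assume w: "w \<in> carrier F2" "s \<in> carrier F2" "foldr fill w (base, s) = (base, s')"
    have \<psi>w: "?\<psi> w \<in> carrier F2" "\<phi> (?\<psi> w) = w" using F2.auto_inv_apply[OF \<phi> w(1)] by auto
    obtain v u where vu: "foldr fill (?\<psi> w) (base, s) = (v, u)" "u \<in> carrier F2"
      using fill.F2_carrier[OF \<psi>w(1), of "(base, s)"] w(2)
      by (cases "foldr fill (?\<psi> w) (base, s)") simp
    have "(v, k v \<ast> u) = (base, s')"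
      using equiv[OF \<psi>w(1) w(2), of base] w G_base[OF w(2)] vu \<psi>w(2) by (auto simp: G)
    then show "foldr fill (?\<psi> w) (base, s) = (base, s')"
      using vu k by auto
  qed
qed

lemma (in group) inv_cancel:
  assumes "g \<in> carrier G" "s \<in> carrier G"
  shows "inv g \<otimes> (g \<otimes> s) = s" "g \<otimes> (inv g \<otimes> s) = s"
  using assms by (simp_all flip: m_assoc)

lemma fill_invariant_alpha: "fill_invariant alpha" "fill_invariant (inv\<^bsub>AutoGroup F2\<^esub> alpha)"
proof -
  \<comment> \<open>The square of \<open>gen 1\<close>, which \<open>alpha\<close> inserts, acts by
    \<open>gen 2\<close> on blocks with second component \<open>True\<close> and by its inverse on
    the others. The factor \<open>k\<close> absorbs it whenever \<open>gen 2\<close> changes that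
    component.\<close>
  define k where "k = (\<lambda>v :: bool \<times> bool. if snd v then gen 2 else \<one>\<^bsub>F2\<^esub>)"
  define G where "G = (\<lambda>(v, s). (v, k v \<ast> s))"
  have k: "k v \<in> carrier F2" "k base = \<one>\<^bsub>F2\<^esub>" for v by (simp_all add: k_def)
  have gens: "G (foldr fill (gen a) (v, s)) = foldr fill (alpha (gen a)) (G (v, s))"
    if "a \<in> {1, 2}" "s \<in> carrier F2" for a v s
    using that by (cases v; cases "fst v"; cases "snd v")
      (auto simp: G_def k_def alpha_gen fill_gen fill_letter' F2.inv_cancel)
  show "fill_invariant alpha" "fill_invariant (inv\<^bsub>AutoGroup F2\<^esub> alpha)"
    using fill_invariant_gauge[OF alpha_auto k G_def gens] by blast+
qed

lemma fill_invariant_beta: "fill_invariant beta" "fill_invariant (inv\<^bsub>AutoGroup F2\<^esub> beta)"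
proof -
  \<comment> \<open>The same for \<open>beta\<close>: the inserted square of \<open>gen 2\<close> is
    absorbed where the first component changes.\<close>
  define k where "k = (\<lambda>v :: bool \<times> bool. if fst v then \<inverse> gen 1 else \<one>\<^bsub>F2\<^esub>)"
  define G where "G = (\<lambda>(v, s). (v, k v \<ast> s))"
  have k: "k v \<in> carrier F2" "k base = \<one>\<^bsub>F2\<^esub>" for v by (simp_all add: k_def)
  have gens: "G (foldr fill (gen a) (v, s)) = foldr fill (beta (gen a)) (G (v, s))"
    if "a \<in> {1, 2}" "s \<in> carrier F2" for a v s
    using that by (cases v; cases "fst v"; cases "snd v")
      (auto simp: G_def k_def beta_gen fill_gen fill_letter' F2.inv_cancel)
  show "fill_invariant beta" "fill_invariant (inv\<^bsub>AutoGroup F2\<^esub> beta)"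
    using fill_invariant_gauge[OF beta_auto k G_def gens] by blast+
qed

lemma Theta_inv: "g \<in> carrier F2 \<Longrightarrow> Theta (\<inverse> g) = inv\<^bsub>AutoGroup F2\<^esub> (Theta g)"
  using Theta_hom by (metis A2.is_group F2.is_group group_hom.hom_inv group_hom.intro group_hom_axioms.intro)

lemma Theta_mult_apply:
  "\<lbrakk>g \<in> carrier F2; h \<in> carrier F2; w \<in> carrier F2\<rbrakk> \<Longrightarrow> Theta (g \<ast> h) w = Theta g (Theta h w)"
  using Theta_hom by (simp add: hom_mult[OF Theta_hom] mult_AutoGroup_apply Theta_auto)

text \<open>An automorphism \<^term>\<open>Theta g\<close> pushes the puncture \<^term>\<open>tau\<close> along a path \<open>\<omega>\<close>, from which
  filling recovers \<open>g\<close>.\<close>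

definition push :: "(nat \<times> bool) list \<Rightarrow> bool" where
  "push g \<longleftrightarrow> fill_invariant (Theta g) \<and> (\<exists>\<omega>\<in>carrier F2.
     Theta g tau = \<omega> \<ast> tau \<ast> \<inverse> \<omega> \<and> foldr fill \<omega> (base, \<one>\<^bsub>F2\<^esub>) = (base, \<inverse> g))"

text \<open>The path for the product is that of \<open>g\<close> followed by the image under
  \<open>Theta g\<close> of that of \<open>h\<close>. After filling, \<open>Theta g\<close>
  disappears by \<open>fill_invariant\<close>, and the classes multiply; the order of composition is
  why \<open>push\<close> records inverses.\<close>

lemma push_mult:
  assumes g: "g \<in> carrier F2" and h: "h \<in> carrier F2" and "push g" "push h"
  shows "push (g \<ast> h)"
proof -
  obtain \<omega> where \<omega>: "\<omega> \<in> carrier F2" "Theta g tau = \<omega> \<ast> tau \<ast> \<inverse> \<omega>"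
    "foldr fill \<omega> (base, \<one>\<^bsub>F2\<^esub>) = (base, \<inverse> g)"
    using assms(3) by (auto simp: push_def)
  obtain \<omega>' where \<omega>': "\<omega>' \<in> carrier F2" "Theta h tau = \<omega>' \<ast> tau \<ast> \<inverse> \<omega>'"
    "foldr fill \<omega>' (base, \<one>\<^bsub>F2\<^esub>) = (base, \<inverse> h)"
    using assms(4) by (auto simp: push_def)
  have fi: "fill_invariant (Theta g)" "fill_invariant (Theta h)" using assms by (auto simp: push_def)
  let ?u = "Theta g \<omega>'"
  have u: "?u \<in> carrier F2" using auto_closed[OF Theta_auto[OF g] \<omega>'(1)] .
  have "fill_invariant (Theta (g \<ast> h))"
    using fi g h by (auto simp: fill_invariant_def Theta_mult_apply auto_closed[OF Theta_auto[OF h]])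
  moreover have "Theta (g \<ast> h) tau = (?u \<ast> \<omega>) \<ast> tau \<ast> \<inverse> (?u \<ast> \<omega>)"
    using g h \<omega> \<omega>' u tau_carrier
    by (simp add: Theta_mult_apply auto_mult[OF Theta_auto[OF g]] F2.auto_inv[OF Theta_auto[OF g]]
        F2.inv_mult_group F2.m_assoc)
  moreover have "foldr fill (?u \<ast> \<omega>) (base, \<one>\<^bsub>F2\<^esub>) = (base, \<inverse> (g \<ast> h))"
  proof -
    have "foldr fill \<omega>' (base, \<inverse> g) = (base, \<inverse> h \<ast> \<inverse> g)"
      using fill_right_mult[OF \<omega>'(1) F2.one_closed _ \<omega>'(3), of "\<inverse> g"] g by simp
    then have "foldr fill ?u (base, \<inverse> g) = (base, \<inverse> h \<ast> \<inverse> g)"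
      using fi(1) \<omega>'(1) g by (simp add: fill_invariant_def)
    then show ?thesis
      using fill.F2_mult[OF u \<omega>(1), of "(base, \<one>\<^bsub>F2\<^esub>)"] \<omega> g h by (simp add: F2.inv_mult_group)
  qed
  ultimately show ?thesis using u \<omega>(1) by (auto simp: push_def)
qed

lemma push_Theta:
  assumes "g \<in> carrier F2"
  shows "push g"
proof -
  have one: "push \<one>\<^bsub>F2\<^esub>"
  proof -
    have "Theta \<one>\<^bsub>F2\<^esub> = (\<lambda>x\<in>carrier F2. x)"
      using Theta_hom by (metis A2.is_group F2.is_group group_hom.hom_one group_hom.intro group_hom_axioms.intro one_AutoGroup)
    then show ?thesis
      using tau_carrier by (auto simp: push_def fill_invariant_def one_F2[symmetric] intro!: bexI[of _ "\<one>\<^bsub>F2\<^esub>"]) (simp add: one_F2)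
  qed
  have words: "[(1, True), (1, True)] \<in> carrier F2" "[(1, False), (1, False)] \<in> carrier F2"
    "[(2, True), (2, True)] \<in> carrier F2" "[(2, False), (2, False)] \<in> carrier F2"
    by (auto simp: carrier_F2 freely_reduced_def flip_letter_def)
  have conj_carrier: "w \<ast> tau \<ast> \<inverse> w \<in> carrier F2" if "w \<in> carrier F2" for w
    using that tau_carrier by simp
  have g2: "push (gen 2)"
    unfolding push_def
  proof (intro conjI bexI)
    show "foldr fill [(1, True), (1, True)] (base, \<one>\<^bsub>F2\<^esub>) = (base, \<inverse> gen 2)"
      using F2.inv_closed[OF gen_carrier(3)] by (simp add: fill_letter')
  qed (use words alpha_tau fill_invariant_alpha in \<open>simp_all add: Theta_gen\<close>)
  have i2: "push (\<inverse> gen 2)"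
    unfolding push_def
  proof (intro conjI bexI)
    show "foldr fill [(1, False), (1, False)] (base, \<one>\<^bsub>F2\<^esub>) = (base, \<inverse> (\<inverse> gen 2))"
      by (simp add: fill_letter')
    \<comment> \<open>The path for an inverse automorphism is confirmed by applying the automorphism
      itself.\<close>
    have "alpha ([(1, False), (1, False)] \<ast> tau \<ast> \<inverse> [(1, False), (1, False)]) = tau"
      by (simp add: F2_eval endo_def free_lift_def alpha_def tau_def)
    then show "Theta (\<inverse> gen 2) tau = [(1, False), (1, False)] \<ast> tau \<ast> \<inverse> [(1, False), (1, False)]"
      using F2.auto_inv_apply(2)[OF alpha_auto conj_carrier[OF words(2)]] by (simp add: Theta_inv Theta_gen)
  qed (use words fill_invariant_alpha in \<open>simp_all add: Theta_gen Theta_inv\<close>)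
  have g1: "push (gen 1)"
    unfolding push_def
  proof (intro conjI bexI)
    show "foldr fill [(2, True), (2, True)] (base, \<one>\<^bsub>F2\<^esub>) = (base, \<inverse> gen 1)"
      using F2.inv_closed[OF gen_carrier(2)] by (simp add: fill_letter')
    have "beta ([(2, True), (2, True)] \<ast> tau \<ast> \<inverse> [(2, True), (2, True)]) = tau"
      by (simp add: F2_eval endo_def free_lift_def beta_def tau_def)
    then show "Theta (gen 1) tau = [(2, True), (2, True)] \<ast> tau \<ast> \<inverse> [(2, True), (2, True)]"
      using F2.auto_inv_apply(2)[OF beta_auto conj_carrier[OF words(3)]] by (simp add: Theta_gen)
  qed (use words fill_invariant_beta in \<open>simp_all add: Theta_gen\<close>)
  have i1: "push (\<inverse> gen 1)"
    unfolding push_def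
  proof (intro conjI bexI)
    show "foldr fill [(2, False), (2, False)] (base, \<one>\<^bsub>F2\<^esub>) = (base, \<inverse> (\<inverse> gen 1))"
      by (simp add: fill_letter')
  qed (use words beta_tau fill_invariant_beta beta_auto in \<open>simp_all add: Theta_gen Theta_inv\<close>)
  from assms show ?thesis
  proof (induction rule: F2_induct)
    case (gen1 w)
    then show ?case using push_mult[OF _ _ g1] by simp
  next
    case (inv1 w)
    then show ?case using push_mult[OF _ _ i1] by simp
  next
    case (gen2 w)
    then show ?case using push_mult[OF _ _ g2] by simp
  next
    case (inv2 w)
    then show ?case using push_mult[OF _ _ i2] by simp
  qed (rule one)
qed

text \<open>Here \<open>t\<close> is a permutation of order three supported on a single coset of the subgroup \<open>K\<close> chosen
  below. If conjugation by \<open>h\<close> after \<^term>\<open>Theta g\<close> is trivial in the resulting finite action, then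
  \<open>h \<otimes> \<omega>\<close> normalises the action of \<^term>\<open>tau\<close> and so fixes the support of \<open>t\<close>, so that \<open>h\<close>
  fills to \<open>g\<close> modulo \<open>K\<close>; as filling absorbs \<^term>\<open>Theta g\<close>, this element is central modulo \<open>K\<close>.\<close>

lemma exists_action_detecting_Theta:
  assumes N1: "N1 \<in> fin_index_normals F2"
  obtains K where "K \<in> fin_index_normals F2"
    "\<And>h g. \<lbrakk>h \<in> carrier F2; g \<in> carrier F2;
       \<And>w. w \<in> carrier F2 \<Longrightarrow> conj_aut F2 h (Theta g w) \<ast> \<inverse> w \<in> K\<rbrakk> \<Longrightarrow> g \<in> N1"
proof -
  \<comment> \<open>Modulo three the exponent sums \<open>2\<close> and \<open>-2\<close> are
    nonzero; this keeps \<open>tau\<close> from having fixed points on the other blocks.\<close>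
  obtain K where K: "K \<in> fin_index_normals F2" "K \<subseteq> N1" "K \<subseteq> expo_kernel 3"
    and central: "\<And>h. \<lbrakk>h \<in> carrier F2;
       \<And>a. a \<in> {1, 2} \<Longrightarrow> h \<ast> gen a \<ast> \<inverse> h \<ast> \<inverse> gen a \<in> K\<rbrakk> \<Longrightarrow> h \<in> N1"
    using exists_cover_central_trivial[OF N1, of 3] by auto
  interpret N1: normal N1 F2 using N1 by (simp add: fin_index_normals_def)
  interpret K: normal K F2 using K by (simp add: fin_index_normals_def)
  have lcos: "g <#\<^bsub>F2\<^esub> (h <#\<^bsub>F2\<^esub> K) = (g \<ast> h) <#\<^bsub>F2\<^esub> K"
    if "g \<in> carrier F2" "h \<in> carrier F2" for g h
    using F2.lcos_m_assoc[OF K.subset that] .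
  have one_lcos: "\<one>\<^bsub>F2\<^esub> <#\<^bsub>F2\<^esub> K = K" by (rule F2.lcos_mult_one[OF K.subset])
  define Q where "Q = (\<lambda>g. g <#\<^bsub>F2\<^esub> K) ` carrier F2"
  have KQ: "K \<in> Q" unfolding Q_def using one_lcos F2.one_closed by force
  have QI: "g <#\<^bsub>F2\<^esub> K \<in> Q" if "g \<in> carrier F2" for g using that by (simp add: Q_def)
  let ?m = "\<lambda>g C. g <#\<^bsub>F2\<^esub> C"
  have mQ: "?m g C \<in> Q" if "g \<in> carrier F2" "C \<in> Q" for g C
    using that by (auto simp: Q_def lcos)
  have mm: "?m g (?m h C) = ?m (g \<ast> h) C"
    if "g \<in> carrier F2" "h \<in> carrier F2" "C \<in> Q" for g h C
    using that by (auto simp: Q_def lcos F2.m_assoc)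
  have m_cancel: "?m (\<inverse> g) (?m g C) = C" "?m g (?m (\<inverse> g) C) = C" if "g \<in> carrier F2" "C \<in> Q" for g C
    using that by (auto simp: Q_def lcos F2.inv_cancel)
  define B where "B = induced_action (?m (gen 1)) (?m (\<inverse> gen 1)) (?m (gen 2)) (?m (\<inverse> gen 2)) (\<lambda>C. C) (\<lambda>C. C)"
  \<comment> \<open>Here \<open>up\<close> plays the role of \<open>t\<close>. With order two,
    \<open>t\<close> squared, and so \<open>tau\<close> on the base block, would act trivially. In
    \<open>dn\<close>, adding two is subtracting one modulo three.\<close>
  define up where "up = (\<lambda>(C, i :: nat). (C, if C = K then (i + 1) mod 3 else i))"
  define dn where "dn = (\<lambda>(C, i :: nat). (C, if C = K then (i + 2) mod 3 else i))"
  define lift where "lift = (\<lambda>g (C, i :: nat). (?m g C, i))"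
  define D where "D = induced_action (lift (gen 1)) (lift (\<inverse> gen 1)) (lift (gen 2)) (lift (\<inverse> gen 2)) up dn"
  define S where "S = Q \<times> {..<3 :: nat}"
  interpret B: F2_action B "UNIV \<times> Q"
    unfolding B_def by (rule induced_action_F2) (auto simp: mQ m_cancel)
  have updn: "up (dn s) = s" "dn (up s) = s" if sS: "s \<in> S" for s
  proof -
    obtain C i where s: "s = (C, i)" "i < 3" using sS by (auto simp: S_def)
    then have "i = 0 \<or> i = 1 \<or> i = 2" by auto
    then show "up (dn s) = s" "dn (up s) = s" using s(1) by (auto simp: up_def dn_def)
  qed
  have liftS: "lift g \<in> S \<rightarrow> S" if "g \<in> carrier F2" for g
    using that by (auto simp: lift_def S_def mQ)
  have upS: "up \<in> S \<rightarrow> S" "dn \<in> S \<rightarrow> S" by (auto simp: up_def dn_def S_def)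
  have S_funs: "f \<in> S \<rightarrow> S"
    if "f \<in> {lift (gen 1), lift (\<inverse> gen 1), lift (gen 2), lift (\<inverse> gen 2), up, dn}" for f
    using that liftS upS by (metis F2.inv_closed gen_carrier(1,3) empty_iff insert_iff)
  have lift_cancel: "lift (\<inverse> g) (lift g s) = s" "lift g (lift (\<inverse> g) s) = s"
    if "g \<in> carrier F2" "s \<in> S" for g s
    using that by (auto simp: lift_def S_def m_cancel)
  interpret D: F2_action D "UNIV \<times> S"
    unfolding D_def by (rule induced_action_F2[OF S_funs]) (simp_all add: lift_cancel updn)
  have D_B: "map_prod id fst (foldr D w z) = foldr B w (map_prod id fst z)"
    if "w \<in> carrier F2" "z \<in> UNIV \<times> S" for w z
    unfolding D_def B_def
    by (rule induced_action_equivariant[OF _ S_funs that]) (auto simp: lift_def up_def dn_def split: prod.splits)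
  have fill_B: "map_prod id (\<lambda>s. s <#\<^bsub>F2\<^esub> K) (foldr fill w z) = foldr B w (map_prod id (\<lambda>s. s <#\<^bsub>F2\<^esub> K) z)"
    if "w \<in> carrier F2" "z \<in> UNIV \<times> carrier F2" for w z
    unfolding fill_def B_def
    by (rule induced_action_equivariant[OF _ _ that]) (auto simp: lcos)
  have "finite ((UNIV :: (bool \<times> bool) set) \<times> S)"
    using K(1) K.l_cosets_eq_rcosets by (auto simp: S_def Q_def fin_index_normals_def)
  then have DK: "D.F2_kernel \<in> fin_index_normals F2" by (rule D.F2_kernel_fin_index)
  have not_K: "g \<notin> K" if "\<not> (3 dvd expo 1 g \<and> 3 dvd expo 2 g)" for g
    using that K(3) by (auto simp: expo_kernel_def)
  have moves: "?m u C \<noteq> C" if C: "C \<in> Q" and u: "u \<in> carrier F2" "\<not> (3 dvd expo 1 u \<and> 3 dvd expo 2 u)" for u C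
  proof
    assume eq: "?m u C = C"
    obtain g where g: "g \<in> carrier F2" "C = g <#\<^bsub>F2\<^esub> K" using C by (auto simp: Q_def)
    then have "\<inverse> g \<ast> (u \<ast> g) \<in> K"
      using eq u F2.l_coset_eq_iff[OF K.is_subgroup] by (simp add: lcos)
    moreover have "\<inverse> g \<ast> (u \<ast> g) \<notin> K"
      by (rule not_K) (use g u in \<open>simp add: expo_mult expo_inv\<close>)
    ultimately show False by simp
  qed
  \<comment> \<open>Off the base block \<open>tau\<close> multiplies the coset by a word with an
    exponent sum \<open>2\<close> or \<open>-2\<close>.\<close>
  have tau_B: "foldr B tau (v, C) \<noteq> (v, C)" if C: "C \<in> Q" and v: "v \<noteq> base" for v C
  proof -
    consider "v = (True, False)" | "v = (False, True)" | "v = (True, True)"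
      using v by (metis (full_types) surj_pair)
    then show ?thesis
    proof cases
      case 1
      have "?m (gen 2) (?m (gen 2) C) \<noteq> C"
        using moves[OF C, of "gen 2 \<ast> gen 2"] C by (simp add: expo_mult mm)
      then show ?thesis using 1 by (simp add: tau_def B_def)
    next
      case 2
      have "?m (gen 1) (?m (gen 1) C) \<noteq> C"
        using moves[OF C, of "gen 1 \<ast> gen 1"] C by (simp add: expo_mult mm)
      then show ?thesis using 2 by (simp add: tau_def B_def)
    next
      case 3
      let ?x = "\<inverse> gen 1" and ?y = "\<inverse> gen 2"
      have "?m ?y (?m ?x (?m ?y (?m ?x C))) \<noteq> C"
        using moves[OF C, of "?y \<ast> (?x \<ast> (?y \<ast> ?x))"] C
        by (simp add: expo_mult expo_inv mm)
      then show ?thesis using 3 by (simp add: tau_def B_def)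
    qed
  qed
  have tau_D: "foldr D tau (base, s) = (base, up (up s))" if s: "s \<in> S" for s
  proof -
    have "dn s \<in> S" "lift (gen 2) s \<in> S" using s upS liftS[OF gen_carrier(3)] by blast+
    then show ?thesis
      using s updn lift_cancel[OF gen_carrier(3)] lift_cancel[OF gen_carrier(2)] lift_cancel[OF gen_carrier(1)]
      by (simp add: tau_def D_def)
  qed
  have detect: "g \<in> N1"
    if h: "h \<in> carrier F2" and g: "g \<in> carrier F2"
      and cong: "\<And>w. w \<in> carrier F2 \<Longrightarrow> conj_aut F2 h (Theta g w) \<ast> \<inverse> w \<in> D.F2_kernel" for h g
  proof -
    have inv_fill: "fill_invariant (Theta g)"
      using push_Theta[OF g] by (simp add: push_def)
    obtain \<omega> where \<omega>: "\<omega> \<in> carrier F2" "Theta g tau = \<omega> \<ast> tau \<ast> \<inverse> \<omega>"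
      "foldr fill \<omega> (base, \<one>\<^bsub>F2\<^esub>) = (base, \<inverse> g)"
      using push_Theta[OF g] by (auto simp: push_def)
    have Tc: "Theta g w \<in> carrier F2" if "w \<in> carrier F2" for w
      using auto_closed[OF Theta_auto[OF g] that] .
    have ic: "conj_aut F2 h (Theta g w) \<in> carrier F2" if "w \<in> carrier F2" for w
      using auto_closed[OF F2.inner_auto[OF h] Tc[OF that]] .
    have D_eq: "foldr D (conj_aut F2 h (Theta g w)) z = foldr D w z"
      if w: "w \<in> carrier F2" and z: "z \<in> UNIV \<times> S" for w z
    proof -
      let ?d = "conj_aut F2 h (Theta g w) \<ast> \<inverse> w"
      have d: "?d \<in> carrier F2" "?d \<ast> w = conj_aut F2 h (Theta g w)"
        using w ic[OF w] by (simp_all add: F2.m_assoc)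
      have "foldr D (?d \<ast> w) z = foldr D ?d (foldr D w z)"
        by (rule D.F2_mult[OF d(1) w z])
      also have "\<dots> = foldr D w z"
        by (rule D.F2_kernelD[OF cong[OF w] D.F2_carrier[OF w z]])
      finally show ?thesis using d by simp
    qed
    define k where "k = h \<ast> \<omega>"
    have k: "k \<in> carrier F2" using h \<omega> by (simp add: k_def)
    have tau_k: "conj_aut F2 h (Theta g tau) = k \<ast> tau \<ast> \<inverse> k"
      using \<omega> h tau_carrier by (simp add: conj_aut_def k_def F2.inv_mult_group F2.m_assoc)
    have S0: "(K, 0) \<in> S" "(K, 2) \<in> S" "up (up (K, 0)) = (K, 2)" using KQ by (auto simp: S_def up_def)
    define z1 where "z1 = foldr D k (base, (K, 0))"
    obtain v C i where z1: "z1 = (v, (C, i))" by (metis surj_pair)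
    have z1c: "z1 \<in> UNIV \<times> S" unfolding z1_def using D.F2_carrier[OF k] S0 by simp
    then have C: "C \<in> Q" "(C, i) \<in> S" using z1 by (auto simp: S_def)
    \<comment> \<open>As \<open>tau\<close> and its conjugate by \<open>k\<close> act alike,
      \<open>k\<close> carries the points \<open>(K, 0)\<close> and \<open>(K, 2)\<close>, which
      \<open>tau\<close> links on the base block, to points again linked by \<open>tau\<close>. They
      agree after forgetting the fibre, which rules out the other blocks.\<close>
    have "foldr D tau z1 = foldr D (k \<ast> tau \<ast> \<inverse> k) z1"
      using D_eq[OF tau_carrier z1c] tau_k by simp
    also have "\<dots> = foldr D (k \<ast> tau) (base, (K, 0))"
      using D.F2_mult[of "k \<ast> tau" "\<inverse> k" z1] D.F2_inv(1)[OF k, of "(base, (K, 0))"] k tau_carrier z1c S0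
      by (simp add: z1_def)
    also have "\<dots> = foldr D k (base, (K, 2))"
      using D.F2_mult[OF k tau_carrier, of "(base, (K, 0))"] tau_D[OF S0(1)] S0 by simp
    finally have tau_z1: "foldr D tau z1 = foldr D k (base, (K, 2))" .
    have "map_prod id fst (foldr D k (base, (K, 2))) = map_prod id fst z1"
      unfolding z1_def using D_B[OF k, of "(base, (K, 2))"] D_B[OF k, of "(base, (K, 0))"] S0 by simp
    then have "foldr B tau (v, C) = (v, C)"
      using D_B[OF tau_carrier z1c] tau_z1 z1 by simp
    then have v: "v = base" using tau_B C by blast
    \<comment> \<open>On the base block only the points over the coset \<open>K\<close> are moved by
      \<open>tau\<close>; so \<open>z1\<close> lies over \<open>K\<close>.\<close>
    have "foldr D tau z1 \<noteq> z1"
    proof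
      assume "foldr D tau z1 = z1"
      then have "foldr D k (base, (K, 2)) = foldr D k (base, (K, 0))" using tau_z1 by (simp add: z1_def)
      then have "(base, (K, 2 :: nat)) = (base, (K, 0))"
        using D.F2_inv(1)[OF k, of "(base, (K, 2))"] D.F2_inv(1)[OF k, of "(base, (K, 0))"] S0 by simp
      then show False by simp
    qed
    then have "C = K"
      using tau_D[OF C(2)] z1 v by (auto simp: up_def split: if_splits)
    then have Bk: "foldr B k (base, K) = (base, K)"
      using D_B[OF k, of "(base, (K, 0))"] z1 v S0 by (simp add: z1_def)
    obtain v' s where s: "foldr fill k (base, \<one>\<^bsub>F2\<^esub>) = (v', s)" "s \<in> carrier F2"
      using fill.F2_carrier[OF k, of "(base, \<one>\<^bsub>F2\<^esub>)"] by (cases "foldr fill k (base, \<one>\<^bsub>F2\<^esub>)") simp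
    have "(v', s <#\<^bsub>F2\<^esub> K) = (base, K)"
      using fill_B[OF k, of "(base, \<one>\<^bsub>F2\<^esub>)"] s Bk by (simp add: one_lcos)
    then have v': "v' = base" and "s <#\<^bsub>F2\<^esub> K = \<one>\<^bsub>F2\<^esub> <#\<^bsub>F2\<^esub> K" using one_lcos by auto
    then have sK: "s \<in> K" using F2.l_coset_eq_iff[OF K.is_subgroup s(2) F2.one_closed] s(2) by simp
    \<comment> \<open>This is the class of \<open>h\<close> after filling. It differs from
      \<open>g\<close> by an element of \<open>K\<close>, so it is enough that it commutes with the
      generators modulo \<open>K\<close>.\<close>
    define e where "e = s \<ast> g"
    have e: "e \<in> carrier F2" using s g by (simp add: e_def)
    have "foldr fill h (base, \<inverse> g) = (base, s)"
      using fill.F2_mult[OF h \<omega>(1), of "(base, \<one>\<^bsub>F2\<^esub>)"] \<omega>(3) s v' by (simp add: k_def)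
    then have he: "foldr fill h (base, \<one>\<^bsub>F2\<^esub>) = (base, e)"
      using fill_right_mult[OF h _ g, of "\<inverse> g" base base s] g by (simp add: e_def)
    have "e \<in> N1"
    proof (rule central[OF e])
      fix a :: nat assume a: "a \<in> {1, 2}"
      note ga = gen_carrier'[OF a]
      \<comment> \<open>For a word that fills to \<open>gen a\<close>, the congruence evaluated at
        the point \<open>e\<close> becomes commutation of \<open>e\<close> with
        \<open>gen a\<close>: one side gives \<open>gen a \<ast> e\<close>, the other
        \<open>e \<ast> gen a\<close>.\<close>
      have "\<exists>w\<in>carrier F2. foldr fill w (base, \<one>\<^bsub>F2\<^esub>) = (base, gen a)"
      proof (cases "a = 1")
        case True
        show ?thesis
        proof
          show "foldr fill [(2, False), (2, False)] (base, \<one>\<^bsub>F2\<^esub>) = (base, gen a)"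
            using True by (simp add: fill_letter')
        qed (auto simp: carrier_F2 freely_reduced_def flip_letter_def)
      next
        case False
        then have a2: "a = 2" using a by simp
        show ?thesis
        proof
          show "foldr fill [(1, False), (1, False)] (base, \<one>\<^bsub>F2\<^esub>) = (base, gen a)"
            using a2 by (simp add: fill_letter')
        qed (auto simp: carrier_F2 freely_reduced_def flip_letter_def)
      qed
      then obtain w where w: "w \<in> carrier F2" "foldr fill w (base, \<one>\<^bsub>F2\<^esub>) = (base, gen a)" by blast
      have we: "foldr fill w (base, e) = (base, gen a \<ast> e)"
        using fill_right_mult[OF w(1) F2.one_closed e w(2)] e by simp
      have Tw: "foldr fill (Theta g w) (base, \<one>\<^bsub>F2\<^esub>) = (base, gen a)"
        using inv_fill w by (simp add: fill_invariant_def)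
      have hga: "foldr fill h (base, gen a) = (base, e \<ast> gen a)"
        using fill_right_mult[OF h F2.one_closed ga he] ga by simp
      have "foldr fill (\<inverse> h) (base, e) = (base, \<one>\<^bsub>F2\<^esub>)"
        using fill.F2_inv(1)[OF h, of "(base, \<one>\<^bsub>F2\<^esub>)"] he by simp
      then have conj: "foldr fill (conj_aut F2 h (Theta g w)) (base, e) = (base, e \<ast> gen a)"
        using fill.F2_mult[of "h \<ast> Theta g w" "\<inverse> h" "(base, e)"]
          fill.F2_mult[of h "Theta g w" "(base, \<one>\<^bsub>F2\<^esub>)"] h Tc[OF w(1)] e Tw hga
        by (simp add: conj_aut_def)
      have "foldr B (conj_aut F2 h (Theta g w)) (base, e <#\<^bsub>F2\<^esub> K) = foldr B w (base, e <#\<^bsub>F2\<^esub> K)"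
        using D_B[OF w(1), of "(base, (e <#\<^bsub>F2\<^esub> K, 0))"] D_B[OF ic[OF w(1)], of "(base, (e <#\<^bsub>F2\<^esub> K, 0))"]
          D_eq[OF w(1), of "(base, (e <#\<^bsub>F2\<^esub> K, 0))"] QI[OF e] by (simp add: S_def)
      moreover have "foldr B (conj_aut F2 h (Theta g w)) (base, e <#\<^bsub>F2\<^esub> K) = (base, (e \<ast> gen a) <#\<^bsub>F2\<^esub> K)"
        using fill_B[OF ic[OF w(1)], of "(base, e)"] conj e by simp
      moreover have "foldr B w (base, e <#\<^bsub>F2\<^esub> K) = (base, (gen a \<ast> e) <#\<^bsub>F2\<^esub> K)"
        using fill_B[OF w(1), of "(base, e)"] we e by simp
      ultimately have "(e \<ast> gen a) <#\<^bsub>F2\<^esub> K = (gen a \<ast> e) <#\<^bsub>F2\<^esub> K"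
        by simp
      then have u: "\<inverse> (gen a \<ast> e) \<ast> (e \<ast> gen a) \<in> K" (is "?u \<in> K")
        using F2.l_coset_eq_iff[OF K.is_subgroup] e ga by simp
      have "(gen a \<ast> e) \<ast> ?u \<ast> \<inverse> (gen a \<ast> e) \<in> K"
        using K.inv_op_closed2[OF _ u] e ga by simp
      moreover have "(gen a \<ast> e) \<ast> ?u \<ast> \<inverse> (gen a \<ast> e)
        = e \<ast> gen a \<ast> \<inverse> e \<ast> \<inverse> gen a"
        using e ga by (simp add: F2.inv_mult_group F2.m_assoc F2.inv_cancel)
      ultimately show "e \<ast> gen a \<ast> \<inverse> e \<ast> \<inverse> gen a \<in> K" by simp
    qed
    moreover have "g = \<inverse> s \<ast> e" using s g by (simp add: e_def F2.inv_cancel)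
    ultimately show "g \<in> N1"
      using N1.m_closed[OF N1.m_inv_closed[of s]] sK K(2) by auto
  qed
  show thesis
  proof (rule that[OF DK])
    fix h g
    assume a: "h \<in> carrier F2" "g \<in> carrier F2"
      "\<And>w. w \<in> carrier F2 \<Longrightarrow> conj_aut F2 h (Theta g w) \<ast> \<inverse> w \<in> D.F2_kernel"
    show "g \<in> N1" by (rule detect[OF a])
  qed
qed

section \<open>Nielsen reduction\<close>

fun common_prefix :: "'a list \<Rightarrow> 'a list \<Rightarrow> nat" where
  "common_prefix (x # xs) (y # ys) = (if x = y then Suc (common_prefix xs ys) else 0)"
| "common_prefix _ _ = 0"

lemma common_prefix_commute: "common_prefix xs ys = common_prefix ys xs"
  by (induction xs ys rule: common_prefix.induct) auto

text \<open>The ultrametric inequality: reduced words are vertices of a rooted tree, and the common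
  prefix measures how long two branches run together.\<close>

lemma common_prefix_ultra:
  "min (common_prefix xs ys) (common_prefix ys zs) \<le> common_prefix xs zs"
proof (induction xs ys arbitrary: zs rule: common_prefix.induct)
  case (1 x xs y ys)
  show ?case
  proof (cases zs)
    case (Cons z zs')
    then show ?thesis using 1[of zs'] by auto
  qed simp
qed auto

text \<open>In an ultrametric, of three pairwise values the smallest occurs twice.\<close>

lemma common_prefix_isosceles:
  assumes "common_prefix xs ys < common_prefix ys zs"
  shows "common_prefix xs zs = common_prefix xs ys"
  using assms common_prefix_ultra[of xs ys zs] common_prefix_ultra[of xs zs ys]
  by (auto simp: common_prefix_commute[of zs ys])

lemma take_common_prefix:
  "n \<le> common_prefix xs ys \<Longrightarrow> take n xs = take n ys"
proof (induction xs ys arbitrary: n rule: common_prefix.induct)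
  case (1 x xs y ys)
  then show ?case by (cases n) (auto split: if_splits)
qed auto

lemma common_prefix_le: "common_prefix xs ys \<le> length xs" "common_prefix xs ys \<le> length ys"
  by (induction xs ys rule: common_prefix.induct) auto

section \<open>Cancellation in products of words\<close>

lemma freely_reduced_append_iff:
  "freely_reduced (u @ v) \<longleftrightarrow> freely_reduced u \<and> freely_reduced v \<and>
     (u \<noteq> [] \<longrightarrow> v \<noteq> [] \<longrightarrow> hd v \<noteq> flip_letter (last u))"
  by (auto simp: freely_reduced_def successively_append_iff)

lemma mult_F2_append: "freely_reduced (u @ v) \<Longrightarrow> u \<ast> v = u @ v"
proof (induction u)
  case (Cons l u)
  then have "foldr cancel_cons u v = u @ v" by (simp add: freely_reduced_Cons mult_F2)
  then show ?case using Cons.prems cancel_cons_reduced[of l "u @ v"] by (simp add: mult_F2)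
qed (simp add: mult_F2)

lemma carrier_F2_append:
  assumes "u @ v \<in> carrier F2"
  shows "u \<in> carrier F2" "v \<in> carrier F2" "u \<ast> v = u @ v"
  using assms mult_F2_append by (auto simp: carrier_F2 freely_reduced_append_iff)

lemma length_inv_F2: "u \<in> carrier F2 \<Longrightarrow> length (\<inverse> u) = length u"
  by (simp add: inv_F2)

text \<open>Exactly the common prefix cancels; what is left over on either side meets in two
  different letters.\<close>

lemma length_inv_mult:
  assumes "u \<in> carrier F2" "v \<in> carrier F2"
  shows "length (\<inverse> u \<ast> v) + 2 * common_prefix u v = length u + length v"
  using assms
proof (induction u v rule: common_prefix.induct)
  case (1 x xs y ys)
  have c: "xs \<in> carrier F2" "[x] \<in> carrier F2" "x # xs = [x] \<ast> xs"
    "ys \<in> carrier F2" "[y] \<in> carrier F2" "y # ys = [y] \<ast> ys"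
    using carrier_F2_append[of "[x]" xs] carrier_F2_append[of "[y]" ys] 1(2,3) by simp_all
  show ?case
  proof (cases "x = y")
    case True
    have "\<inverse> (x # xs) \<ast> (y # ys) = \<inverse> ([x] \<ast> xs) \<ast> ([x] \<ast> ys)"
      using c(3,6) True by metis
    also have "\<dots> = \<inverse> xs \<ast> ys"
      using c(1,2,4) by (simp add: F2.inv_mult_group F2.m_assoc) (simp flip: F2.m_assoc)
    finally show ?thesis using 1(1)[OF True c(1) c(4)] True by simp
  next
    case False
    have "freely_reduced (\<inverse> (x # xs) @ (y # ys))"
    proof -
      have "\<inverse> (x # xs) \<in> carrier F2" using 1(2) by simp
      then have "freely_reduced (\<inverse> (x # xs))" "freely_reduced (y # ys)"
        using 1(3) by (simp_all add: carrier_F2)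
      moreover have "last (\<inverse> (x # xs)) = flip_letter x" using 1(2) by (simp add: inv_F2)
      ultimately show ?thesis using False by (simp add: freely_reduced_append_iff)
    qed
    then show ?thesis
      using False 1(2) mult_F2_append length_inv_F2[OF 1(2)] by simp
  qed
next
  case ("2_1" v)
  then show ?case using F2.inv_one by (simp add: one_F2 mult_F2)
next
  case ("2_2" u)
  then show ?case by (simp add: F2.r_one[unfolded one_F2] length_inv_F2)
qed

lemma length_mult:
  assumes "u \<in> carrier F2" "v \<in> carrier F2"
  shows "length (u \<ast> v) + 2 * common_prefix (\<inverse> u) v = length u + length v"
  using length_inv_mult[of "\<inverse> u" v] assms by (simp add: length_inv_F2)

text \<open>If \<open>u\<close> began with the inverse of at least half of its final segment, its middle letter would
  be its own inverse, or its two middle letters would cancel.\<close>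

lemma common_prefix_inv:
  assumes u: "u \<in> carrier F2" "u \<noteq> []"
  shows "2 * common_prefix (\<inverse> u) u < length u"
proof (rule ccontr)
  assume half: "\<not> 2 * common_prefix (\<inverse> u) u < length u"
  define n where "n = length u"
  have n: "n \<le> 2 * common_prefix (\<inverse> u) u" "n > 0"
    using half u(2) by (auto simp: n_def)
  have sym: "u ! i = flip_letter (u ! (n - 1 - i))" if "i < common_prefix (\<inverse> u) u" for i
  proof -
    have "i < n" using that common_prefix_le(2)[of "\<inverse> u" u] by (simp add: n_def)
    have "take (Suc i) (\<inverse> u) = take (Suc i) u" using that by (intro take_common_prefix) simp
    then have "(\<inverse> u) ! i = u ! i" by (metis lessI nth_take)
    then show ?thesis using \<open>i < n\<close> u by (simp add: inv_F2 n_def rev_nth)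
  qed
  show False
  proof (cases "even n")
    case True
    then obtain m where m: "n = 2 * Suc m" using n(2) by (metis evenE gr0_implies_Suc nat_0_less_mult_iff)
    then have "u ! m = flip_letter (u ! Suc m)" using sym[of m] n by simp
    moreover have "u ! Suc m \<noteq> flip_letter (u ! m)"
      using u(1) m by (auto simp: carrier_F2 freely_reduced_def successively_conv_nth n_def)
    ultimately show False by simp
  next
    case False
    then obtain m where "n = 2 * m + 1" using oddE by blast
    then have "u ! m = flip_letter (u ! m)" using sym[of m] n by simp
    then show False by (simp add: flip_letter_def prod_eq_iff)
  qed
qed

section \<open>Elementary automorphisms\<close>

definition swap :: "(nat \<times> bool) list \<Rightarrow> (nat \<times> bool) list" where
  "swap = endo (gen 2) (gen 1)"

definition flip1 :: "(nat \<times> bool) list \<Rightarrow> (nat \<times> bool) list" where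
  "flip1 = endo [(1, False)] (gen 2)"

definition flip2 :: "(nat \<times> bool) list \<Rightarrow> (nat \<times> bool) list" where
  "flip2 = endo (gen 1) [(2, False)]"

definition rho :: "(nat \<times> bool) list \<Rightarrow> (nat \<times> bool) list" where
  "rho = endo [(1, True), (2, True)] (gen 2)"

lemma elementary_auto: "swap \<in> auto F2" "flip1 \<in> auto F2" "flip2 \<in> auto F2" "rho \<in> auto F2"
proof -
  show "swap \<in> auto F2" unfolding swap_def
    by (rule endo_auto[where u' = "gen 2" and v' = "gen 1"]) (simp_all add: F2_eval endo_def free_lift_def)
  show "flip1 \<in> auto F2" unfolding flip1_def
    by (rule endo_auto[where u' = "[(1, False)]" and v' = "gen 2"]) (simp_all add: F2_eval endo_def free_lift_def)
  show "flip2 \<in> auto F2" unfolding flip2_def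
    by (rule endo_auto[where u' = "gen 1" and v' = "[(2, False)]"]) (simp_all add: F2_eval endo_def free_lift_def)
  show "rho \<in> auto F2" unfolding rho_def
    by (rule endo_auto[where u' = "[(1, True), (2, False)]" and v' = "gen 2"]) (simp_all add: F2_eval endo_def free_lift_def)
qed

lemma mult_auto [simp]: "\<lbrakk>\<phi> \<in> auto F2; \<psi> \<in> auto F2\<rbrakk> \<Longrightarrow> \<phi> \<star> \<psi> \<in> auto F2"
  using A2.m_closed by simp

lemmas auto_F2_apply = mult_AutoGroup_apply one_AutoGroup elementary_auto alpha_auto beta_auto
  elementary_auto[THEN auto_closed] alpha_auto[THEN auto_closed] beta_auto[THEN auto_closed]

lemmas auto_F2_eval = F2_eval endo_def free_lift_def swap_def flip1_def flip2_def rho_def alpha_def beta_def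

lemma elementary_relations:
  "swap \<star> swap = \<one>\<^bsub>AutoGroup F2\<^esub>"
  "flip1 \<star> flip1 = \<one>\<^bsub>AutoGroup F2\<^esub>"
  "flip2 \<star> flip2 = \<one>\<^bsub>AutoGroup F2\<^esub>"
  "flip2 = swap \<star> flip1 \<star> swap"
  "rho \<star> flip2 \<star> rho \<star> flip2 = \<one>\<^bsub>AutoGroup F2\<^esub>"
  using A2.one_closed
  by (auto intro!: auto_F2_eqI simp: elementary_auto)
     (simp_all add: auto_F2_apply, simp_all add: auto_F2_eval)

text \<open>The eight signed permutations of the generators are products of the three listed
  involutions, so invariance of \<open>P\<close> passes to all of them.\<close>

lemma signed_permutation:
  assumes l: "l \<in> {1, 2} \<times> UNIV" "l' \<in> {1, 2} \<times> UNIV" "fst l \<noteq> fst l'"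
    and P: "\<And>\<phi> \<sigma>. \<lbrakk>\<phi> \<in> auto F2; \<sigma> \<in> {swap, flip1, flip2}\<rbrakk> \<Longrightarrow> P (\<phi> \<star> \<sigma>) \<longleftrightarrow> P \<phi>"
  obtains \<sigma> where "\<sigma> \<in> auto F2" "\<sigma> (gen 1) = [l]" "\<sigma> (gen 2) = [l']"
    "\<And>\<phi>. \<phi> \<in> auto F2 \<Longrightarrow> P (\<phi> \<star> \<sigma>) \<longleftrightarrow> P \<phi>"
proof -
  let ?\<iota> = "\<one>\<^bsub>AutoGroup F2\<^esub>"
  have \<iota>: "?\<iota> \<in> auto F2" using A2.one_closed by simp
  define \<sigma> where "\<sigma> = (if fst l = 1 then ?\<iota> else swap) \<star>
    ((if snd l then ?\<iota> else flip1) \<star> (if snd l' then ?\<iota> else flip2))"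
  have \<sigma>: "\<sigma> \<in> auto F2"
    using \<iota> elementary_auto by (simp add: \<sigma>_def)
  have P': "P (\<phi> \<star> (if c then ?\<iota> else \<sigma>)) \<longleftrightarrow> P \<phi>"
    if "\<phi> \<in> auto F2" "\<sigma> \<in> {swap, flip1, flip2}" for \<phi> \<sigma> c
    using P[OF that] A2.r_one[of \<phi>] that(1) by simp
  have "P (\<phi> \<star> \<sigma>) \<longleftrightarrow> P \<phi>" if \<phi>: "\<phi> \<in> auto F2" for \<phi>
  proof -
    let ?a = "if fst l = 1 then ?\<iota> else swap" and ?b = "if snd l then ?\<iota> else flip1"
      and ?c = "if snd l' then ?\<iota> else flip2"
    have c: "?a \<in> auto F2" "?b \<in> auto F2" "?c \<in> auto F2" using \<iota> elementary_auto by simp_all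
    have assoc: "\<phi> \<star> (a \<star> (b \<star> c))
        = \<phi> \<star> a \<star> b \<star> c"
      if "a \<in> auto F2" "b \<in> auto F2" "c \<in> auto F2" for a b c
      using that \<phi> by (simp add: A2.m_assoc)
    have "P (\<phi> \<star> ?a \<star> ?b \<star> ?c)
        \<longleftrightarrow> P (\<phi> \<star> ?a \<star> ?b)"
      by (rule P') (rule mult_auto[OF mult_auto[OF \<phi> c(1)] c(2)], blast)
    also have "\<dots> \<longleftrightarrow> P (\<phi> \<star> ?a)"
      by (rule P') (rule mult_auto[OF \<phi> c(1)], blast)
    also have "\<dots> \<longleftrightarrow> P \<phi>"
      by (rule P') (rule \<phi>, blast)
    finally show ?thesis
      unfolding \<sigma>_def assoc[OF c] .
  qed
  moreover have "\<sigma> (gen 1) = [l]" "\<sigma> (gen 2) = [l']"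
  proof -
    obtain a b a' b' where ab: "l = (a, b)" "l' = (a', b')" by (cases l; cases l') blast
    then consider "a = 1" "a' = 2" | "a = 2" "a' = 1" using l by auto
    then have "\<sigma> (gen 1) = [l] \<and> \<sigma> (gen 2) = [l']"
      unfolding \<sigma>_def ab using \<iota>
      by cases (cases b; cases b'; simp add: auto_F2_apply; simp add: auto_F2_eval)+
    then show "\<sigma> (gen 1) = [l]" "\<sigma> (gen 2) = [l']" by auto
  qed
  ultimately show thesis using that[OF \<sigma>] by blast
qed

text \<open>Since no image of a letter is absorbed by its two neighbours, the image of a letter cancels
  against the image of the following word exactly as much as against that of the next letter.\<close>

lemma reduced_images_length:
  assumes \<phi>: "\<phi> \<in> auto F2"
    and half: "\<And>l l'. \<lbrakk>l \<in> {1, 2} \<times> UNIV; l' \<in> {1, 2} \<times> UNIV; l' \<noteq> flip_letter l\<rbrakk>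
       \<Longrightarrow> 2 * common_prefix (\<phi> [flip_letter l]) (\<phi> [l']) \<le> length (\<phi> [l])"
    and middle: "\<And>l l' l''. \<lbrakk>l \<in> {1, 2} \<times> UNIV; l' \<in> {1, 2} \<times> UNIV; l'' \<in> {1, 2} \<times> UNIV;
       l' \<noteq> flip_letter l; l'' \<noteq> flip_letter l'\<rbrakk>
       \<Longrightarrow> common_prefix (\<phi> [flip_letter l]) (\<phi> [l']) + common_prefix (\<phi> [flip_letter l']) (\<phi> [l''])
         < length (\<phi> [l'])"
    and w: "w \<in> carrier F2" "w \<noteq> []" "length (\<phi> w) \<le> 1"
  shows "length w = 1"
proof -
  have fl: "flip_letter l \<in> {1, 2} \<times> UNIV" if "l \<in> {1, 2} \<times> UNIV" for l :: "nat \<times> bool"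
    using that by (auto simp: flip_letter_def)
  have lc: "[l] \<in> carrier F2" if "l \<in> {1, 2} \<times> UNIV" for l using letter_carrier_F2 that .
  have \<phi>c: "\<phi> u \<in> carrier F2" if "u \<in> carrier F2" for u using auto_closed[OF \<phi> that] .
  have inv_letter: "\<inverse> \<phi> [l] = \<phi> [flip_letter l]" if l: "l \<in> {1, 2} \<times> UNIV" for l
    using F2.auto_inv[OF \<phi> lc[OF l]] lc[OF l] by (simp add: inv_F2)
  have cons: "l \<in> {1, 2} \<times> UNIV" "w \<in> carrier F2" "\<phi> (l # w) = \<phi> [l] \<ast> \<phi> w"
    if "l # w \<in> carrier F2" for l w
  proof -
    show "l \<in> {1, 2} \<times> UNIV" using that by (auto simp: carrier_F2)
    show "w \<in> carrier F2" "\<phi> (l # w) = \<phi> [l] \<ast> \<phi> w"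
      using carrier_F2_append[of "[l]" w] that auto_mult[OF \<phi>, of "[l]" w] by auto
  qed
  have prefix: "common_prefix (\<phi> [flip_letter l0]) (\<phi> (l # w)) = common_prefix (\<phi> [flip_letter l0]) (\<phi> [l])"
    if "l0 # l # w \<in> carrier F2" for l0 l w
    using that
  proof (induction w arbitrary: l0 l)
    case (Cons l' w)
    note c0 = cons[OF Cons.prems]
    note c1 = cons[OF c0(2)]
    note c2 = cons[OF c1(2)]
    have red: "l \<noteq> flip_letter l0" "l' \<noteq> flip_letter l"
      using Cons.prems by (auto simp: carrier_F2 freely_reduced_def)
    let ?b = "\<phi> [l]" and ?W = "\<phi> (l' # w)"
    have IH: "common_prefix (\<phi> [flip_letter l]) ?W = common_prefix (\<phi> [flip_letter l]) (\<phi> [l'])"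
      by (rule Cons.IH[OF c0(2)])
    have bc: "?b \<in> carrier F2" "?W \<in> carrier F2" using \<phi>c lc c1 by blast+
    \<comment> \<open>Cancelling \<open>?b\<close> again from the product measures how long a
      beginning of \<open>?b\<close> survives in it. By \<open>middle\<close> this is longer than
      what the preceding letter can reach, so the isosceles property applies.\<close>
    have "length (\<inverse> ?b \<ast> (?b \<ast> ?W)) = length ?W"
      using bc by (simp add: F2.m_assoc[symmetric])
    then have "length ?W + 2 * common_prefix ?b (?b \<ast> ?W) = length ?b + length (?b \<ast> ?W)"
      using length_inv_mult[of ?b "?b \<ast> ?W"] bc by simp
    then have "common_prefix ?b (?b \<ast> ?W) + common_prefix (\<phi> [flip_letter l]) (\<phi> [l']) = length ?b"
      using length_mult[OF bc] inv_letter[OF c1(1)] IH by simp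
    then have "common_prefix (\<phi> [flip_letter l0]) ?b < common_prefix ?b (?b \<ast> ?W)"
      using middle[OF c0(1) c1(1) c2(1) red] by linarith
    from common_prefix_isosceles[OF this] show ?case using c1(3) by simp
  qed simp
  \<comment> \<open>Prepending a letter never shortens the image. The second clause excludes that it
    stays at length one when a second letter is added.\<close>
  have grow: "length (\<phi> (l # w)) \<ge> length (\<phi> w)" "w = [l'] \<Longrightarrow> length (\<phi> w) = 1 \<Longrightarrow> length (\<phi> (l # w)) \<ge> 2"
    if lw: "l # w \<in> carrier F2" "w \<noteq> []" for l w l'
  proof -
    obtain l1 w1 where w1: "w = l1 # w1" using lw by (cases w) auto
    have lw1: "l # l1 # w1 \<in> carrier F2" using lw w1 by simp
    note c0 = cons[OF lw1]
    note c1 = cons[OF c0(2)]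
    have red: "l1 \<noteq> flip_letter l" "flip_letter l \<noteq> flip_letter (flip_letter l1)"
      using lw1 by (auto simp: carrier_F2 freely_reduced_def)
    have len: "length (\<phi> (l # w)) + 2 * common_prefix (\<phi> [flip_letter l]) (\<phi> [l1])
        = length (\<phi> [l]) + length (\<phi> w)"
      using length_mult[of "\<phi> [l]" "\<phi> w"] c0 \<phi>c lc inv_letter prefix[OF lw1] w1 by simp
    then show "length (\<phi> (l # w)) \<ge> length (\<phi> w)"
      using half[OF c0(1) c1(1) red(1)] by linarith
    show "length (\<phi> (l # w)) \<ge> 2" if "w = [l']" "length (\<phi> w) = 1"
    proof -
      have "2 * common_prefix (\<phi> [l1]) (\<phi> [flip_letter l]) \<le> length (\<phi> [flip_letter l1])"
        using half[OF fl[OF c1(1)] fl[OF c0(1)] red(2)] by simp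
      moreover have "length (\<phi> [flip_letter l1]) = 1"
        using that w1 inv_letter[OF c1(1), symmetric] length_inv_F2[OF \<phi>c[OF lc[OF c1(1)]]] by simp
      ultimately have "common_prefix (\<phi> [flip_letter l]) (\<phi> [l1]) = 0"
        by (simp add: common_prefix_commute)
      moreover have "length (\<phi> [l]) > 0"
        using middle[OF c0(1) c0(1) c0(1)] by (metis gr_zeroI less_nat_zero_code flip_letter_def fst_conv snd_conv prod.collapse)
      ultimately show ?thesis using len that by linarith
    qed
  qed
  have pos: "length (\<phi> w) > 0" if "w \<in> carrier F2" "w \<noteq> []" for w
  proof -
    have "\<phi> w \<noteq> \<phi> []"
      using mem_autoD(3)[OF \<phi>] that F2.one_closed by (auto simp: bij_betw_def inj_on_def one_F2)
    moreover have "\<phi> [] = []"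
      using F2.auto_inv_apply \<phi> by (metis A2.is_group F2.is_group group_hom.hom_one group_hom.intro group_hom_axioms.intro mem_autoD(1) one_F2)
    ultimately show ?thesis by simp
  qed
  from w show ?thesis
  proof (induction w)
    case (Cons l w)
    show ?case
    proof (cases "w = []")
      case False
      have "length w = 1"
        using Cons grow(1)[OF Cons.prems(1) False] cons[OF Cons.prems(1)] False by linarith
      then obtain l' where l': "w = [l']" by (cases w) auto
      have "length (\<phi> w) = 1"
        using pos[OF cons(2)[OF Cons.prems(1)] False] Cons.prems(3) grow(1)[OF Cons.prems(1) False] by linarith
      then have "length (\<phi> (l # w)) \<ge> 2" using grow(2)[OF Cons.prems(1) False l'] by simp
      then show ?thesis using Cons.prems by simp
    qed simp
  qed simp
qed

text \<open>Induction on the total length of the images of the generators: a minimal counterexample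
  satisfies the cancellation bounds of \<open>reduced_images_length\<close> and so permutes the
  letters. The ties left by length-reducing moves, usually broken by a well-ordering of words, are
  removed by inner automorphisms, whence the case \<open>inner\<close>.\<close>

lemma nielsen_induct [consumes 1, case_names one inner step]:
  assumes \<phi>: "\<phi> \<in> auto F2"
    and one: "P \<one>\<^bsub>AutoGroup F2\<^esub>"
    and inner: "\<And>\<phi> h. \<lbrakk>\<phi> \<in> auto F2; h \<in> carrier F2; P \<phi>\<rbrakk> \<Longrightarrow> P (conj_aut F2 h \<star> \<phi>)"
    and step: "\<And>\<phi> \<sigma>. \<lbrakk>\<phi> \<in> auto F2; \<sigma> \<in> {swap, flip1, rho}; P \<phi>\<rbrakk> \<Longrightarrow> P (\<phi> \<star> \<sigma>)"
  shows "P \<phi>"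
proof -
  have \<iota>: "\<one>\<^bsub>AutoGroup F2\<^esub> \<in> auto F2" using A2.one_closed by simp
  have invol: "P (\<phi> \<star> \<sigma>) \<longleftrightarrow> P \<phi>"
    if \<phi>: "\<phi> \<in> auto F2" and \<sigma>: "\<sigma> \<in> auto F2" "\<sigma> \<star> \<sigma> = \<one>\<^bsub>AutoGroup F2\<^esub>"
      and st: "\<And>\<phi>. \<phi> \<in> auto F2 \<Longrightarrow> P \<phi> \<Longrightarrow> P (\<phi> \<star> \<sigma>)" for \<phi> \<sigma>
  proof
    assume "P (\<phi> \<star> \<sigma>)"
    then have "P (\<phi> \<star> \<sigma> \<star> \<sigma>)" using st[of "\<phi> \<star> \<sigma>"] \<phi> \<sigma>(1) by simp
    then show "P \<phi>" using \<phi> \<sigma> A2.m_assoc[of \<phi> \<sigma> \<sigma>] by simp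
  qed (rule st[OF \<phi>])
  have swap: "P (\<phi> \<star> swap) \<longleftrightarrow> P \<phi>" if "\<phi> \<in> auto F2" for \<phi>
    by (rule invol[OF that elementary_auto(1) elementary_relations(1)]) (use step in simp)
  have flip1: "P (\<phi> \<star> flip1) \<longleftrightarrow> P \<phi>" if "\<phi> \<in> auto F2" for \<phi>
    by (rule invol[OF that elementary_auto(2) elementary_relations(2)]) (use step in simp)
  have flip2: "P (\<phi> \<star> flip2) \<longleftrightarrow> P \<phi>" if \<phi>: "\<phi> \<in> auto F2" for \<phi>
  proof -
    have "\<phi> \<star> flip2 = \<phi> \<star> swap \<star> flip1 \<star> swap"
      unfolding elementary_relations(4) using \<phi> elementary_auto by (simp add: A2.m_assoc)
    then show ?thesis using swap flip1 \<phi> elementary_auto by simp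
  qed
  \<comment> \<open>The relation with \<open>flip2\<close> expresses the inverse of
    \<open>rho\<close> through generators, so closure under right multiplication by
    \<open>rho\<close> can be reversed.\<close>
  have rho: "P (\<phi> \<star> rho) \<longleftrightarrow> P \<phi>" if \<phi>: "\<phi> \<in> auto F2" for \<phi>
  proof
    assume "P (\<phi> \<star> rho)"
    then have "P (\<phi> \<star> rho \<star> flip2 \<star> rho \<star> flip2)"
      using flip2 step[of _ rho] \<phi> elementary_auto by simp
    also have "\<phi> \<star> rho \<star> flip2 \<star> rho \<star> flip2
      = \<phi> \<star> (rho \<star> flip2 \<star> rho \<star> flip2)"
      using \<phi> elementary_auto by (simp add: A2.m_assoc)
    also have "\<dots> = \<phi>" using \<phi> elementary_relations(5) A2.r_one[of \<phi>] by simp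
    finally show "P \<phi>" .
  qed (use step[OF \<phi>] in simp)
  have inner': "P (conj_aut F2 h \<star> \<phi>) \<longleftrightarrow> P \<phi>" if \<phi>: "\<phi> \<in> auto F2" and h: "h \<in> carrier F2" for \<phi> h
  proof
    assume p: "P (conj_aut F2 h \<star> \<phi>)"
    have "conj_aut F2 (\<inverse> h) \<star> (conj_aut F2 h \<star> \<phi>) = \<phi>"
    proof (rule auto_eqI)
      show "conj_aut F2 (\<inverse> h) \<star> (conj_aut F2 h \<star> \<phi>) \<in> auto F2" "\<phi> \<in> auto F2"
        using \<phi> h F2.inner_auto by auto
      fix x assume "x \<in> carrier F2"
      then show "(conj_aut F2 (\<inverse> h) \<star> (conj_aut F2 h \<star> \<phi>)) x = \<phi> x"
        using \<phi> h F2.inner_auto auto_closed[OF \<phi>]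
        by (simp add: mult_AutoGroup_apply) (simp add: conj_aut_def F2.m_assoc F2.inv_cancel)
    qed
    then show "P \<phi>" using inner[OF _ _ p, of "\<inverse> h"] \<phi> h F2.inner_auto[OF h] by simp
  qed (use inner \<phi> h in blast)
  have signed: thesis
    if l: "l \<in> {1, 2} \<times> UNIV" "l' \<in> {1, 2} \<times> UNIV" "fst l \<noteq> fst l'"
      and "\<And>\<sigma>. \<lbrakk>\<sigma> \<in> auto F2; \<sigma> (gen 1) = [l]; \<sigma> (gen 2) = [l'];
        \<And>\<phi>. \<phi> \<in> auto F2 \<Longrightarrow> P (\<phi> \<star> \<sigma>) \<longleftrightarrow> P \<phi>\<rbrakk> \<Longrightarrow> thesis" for l l' thesis
    by (rule signed_permutation[OF l, of P]) (use swap flip1 flip2 that(4) in auto)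
  from \<phi> show ?thesis
  proof (induction "length (\<phi> (gen 1)) + length (\<phi> (gen 2))" arbitrary: \<phi> rule: less_induct)
    case less
    note \<phi> = \<open>\<phi> \<in> auto F2\<close>
    let ?L = "length (\<phi> (gen 1)) + length (\<phi> (gen 2))"
    show ?case
    proof (rule ccontr)
      assume not_P: "\<not> P \<phi>"
      have red: "?L \<le> length (\<psi> (gen 1)) + length (\<psi> (gen 2))"
        if "\<psi> \<in> auto F2" "P \<psi> \<longleftrightarrow> P \<phi>" for \<psi>
        using less(1)[of \<psi>] that not_P by force
      have fl: "flip_letter l \<in> {1, 2} \<times> UNIV" if "l \<in> {1, 2} \<times> UNIV" for l :: "nat \<times> bool"
        using that by (auto simp: flip_letter_def)
      have lc: "[l] \<in> carrier F2" if "l \<in> {1, 2} \<times> UNIV" for l using letter_carrier_F2 that .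
      have \<phi>l: "\<phi> [l] \<in> carrier F2" if "l \<in> {1, 2} \<times> UNIV" for l using auto_closed[OF \<phi> lc[OF that]] .
      have inv_letter: "\<inverse> \<phi> [l] = \<phi> [flip_letter l]" if l: "l \<in> {1, 2} \<times> UNIV" for l
        using F2.auto_inv[OF \<phi> lc[OF l]] lc[OF l] by (simp add: inv_F2)
      have len_flip: "length (\<phi> [flip_letter l]) = length (\<phi> [l])" if "l \<in> {1, 2} \<times> UNIV" for l
        using inv_letter[OF that] length_inv_F2[OF \<phi>l[OF that]] by simp
      have L: "?L = length (\<phi> [l]) + length (\<phi> [l'])"
        if l: "l \<in> {1, 2} \<times> UNIV" "l' \<in> {1, 2} \<times> UNIV" "fst l \<noteq> fst l'" for l l'
      proof -
        have len: "length (\<phi> [(a, b)]) = length (\<phi> (gen a))" if "a \<in> {1, 2}" for a b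
          using len_flip[of "(a, True)"] that by (cases b) (auto simp: gen_def flip_letter_def)
        obtain a b a' b' where ab: "l = (a, b)" "l' = (a', b')" by (cases l; cases l') blast
        then have a: "a \<in> {1, 2}" "a' \<in> {1, 2}" "a \<noteq> a'" using l by auto
        then have "a = 1 \<and> a' = 2 \<or> a = 2 \<and> a' = 1" by auto
        then show ?thesis using len[OF a(1), of b] len[OF a(2), of b'] ab by auto
      qed
      have pos: "length (\<phi> w) > 0" if "w \<in> carrier F2" "w \<noteq> []" for w
      proof -
        have "\<phi> w \<noteq> \<phi> []"
          using mem_autoD(3)[OF \<phi>] that F2.one_closed by (auto simp: bij_betw_def inj_on_def one_F2)
        moreover have "\<phi> [] = []"
          using group_hom.hom_one[of F2 F2 \<phi>] mem_autoD(1)[OF \<phi>] F2.is_group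
          by (simp add: group_hom_def group_hom_axioms_def one_F2)
        ultimately show ?thesis by simp
      qed
      \<comment> \<open>The elementary Nielsen move on an arbitrary pair of letters with distinct
        generators, reached by a signed permutation followed by \<open>rho\<close>. Minimality then
        limits the cancellation in the product.\<close>
      have moved: thesis
        if l: "l \<in> {1, 2} \<times> UNIV" "l' \<in> {1, 2} \<times> UNIV" "fst l \<noteq> fst l'"
          and "\<And>\<psi>. \<lbrakk>\<psi> \<in> auto F2; P \<psi> \<longleftrightarrow> P \<phi>; \<psi> (gen 1) = \<phi> [l] \<ast> \<phi> [l']; \<psi> (gen 2) = \<phi> [l']\<rbrakk> \<Longrightarrow> thesis"
        for l l' thesis
      proof (rule signed[OF l])
        fix \<sigma> assume \<sigma>: "\<sigma> \<in> auto F2" "\<sigma> (gen 1) = [l]" "\<sigma> (gen 2) = [l']"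
          "\<And>\<phi>. \<phi> \<in> auto F2 \<Longrightarrow> P (\<phi> \<star> \<sigma>) \<longleftrightarrow> P \<phi>"
        let ?\<psi> = "\<phi> \<star> \<sigma> \<star> rho"
        have r: "rho (gen 1) = gen 1 \<ast> gen 2" "rho (gen 2) = gen 2"
          by (simp_all add: auto_F2_eval)
        show thesis
        proof (rule that(4))
          show "?\<psi> \<in> auto F2" using \<phi> \<sigma> elementary_auto by simp
          show "P ?\<psi> \<longleftrightarrow> P \<phi>" using rho \<sigma>(4)[OF \<phi>] \<phi> \<sigma>(1) by simp
          show "?\<psi> (gen 1) = \<phi> [l] \<ast> \<phi> [l']"
          proof -
            have "?\<psi> (gen 1) = \<phi> (\<sigma> (gen 1 \<ast> gen 2))"
              using \<phi> \<sigma>(1) elementary_auto r(1) by (simp add: mult_AutoGroup_apply)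
            also have "\<dots> = \<phi> ([l] \<ast> [l'])" using auto_mult[OF \<sigma>(1)] \<sigma>(2,3) by simp
            also have "\<dots> = \<phi> [l] \<ast> \<phi> [l']" using auto_mult[OF \<phi> lc[OF l(1)] lc[OF l(2)]] .
            finally show ?thesis .
          qed
          show "?\<psi> (gen 2) = \<phi> [l']"
            using \<phi> \<sigma> elementary_auto r(2) by (simp add: mult_AutoGroup_apply)
        qed
      qed
      have N1: "2 * common_prefix (\<phi> [flip_letter l]) (\<phi> [l']) \<le> length (\<phi> [l'])"
        if l: "l \<in> {1, 2} \<times> UNIV" "l' \<in> {1, 2} \<times> UNIV" "fst l \<noteq> fst l'" for l l'
      proof (rule moved[OF l])
        fix \<psi> assume \<psi>: "\<psi> \<in> auto F2" "P \<psi> \<longleftrightarrow> P \<phi>" "\<psi> (gen 1) = \<phi> [l] \<ast> \<phi> [l']" "\<psi> (gen 2) = \<phi> [l']"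
        show ?thesis
          using red[OF \<psi>(1,2)] \<psi>(3,4) L[OF l] length_mult[OF \<phi>l[OF l(1)] \<phi>l[OF l(2)]] inv_letter[OF l(1)] by simp
      qed
      have N1': "2 * common_prefix (\<phi> [flip_letter l]) (\<phi> [l']) \<le> length (\<phi> [l])"
        if l: "l \<in> {1, 2} \<times> UNIV" "l' \<in> {1, 2} \<times> UNIV" "fst l \<noteq> fst l'" for l l'
        using N1[OF fl[OF l(2)] fl[OF l(1)]] l len_flip[OF l(1)] common_prefix_commute[of "\<phi> [l']"]
        by (simp add: flip_letter_def)
      have same: "l' = l" if "l' \<noteq> flip_letter l" "fst l' = fst l" for l l' :: "nat \<times> bool"
        using that by (auto simp: flip_letter_def prod_eq_iff)
      have strict: "2 * common_prefix (\<phi> [flip_letter l]) (\<phi> [l]) < length (\<phi> [l])" if l: "l \<in> {1, 2} \<times> UNIV" for l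
        using common_prefix_inv[OF \<phi>l[OF l]] inv_letter[OF l] pos[OF lc[OF l]] by simp
      have half: "2 * common_prefix (\<phi> [flip_letter l]) (\<phi> [l']) \<le> length (\<phi> [l])"
        "2 * common_prefix (\<phi> [flip_letter l]) (\<phi> [l']) \<le> length (\<phi> [l'])"
        if l: "l \<in> {1, 2} \<times> UNIV" "l' \<in> {1, 2} \<times> UNIV" "l' \<noteq> flip_letter l" for l l'
      proof -
        have "2 * common_prefix (\<phi> [flip_letter l]) (\<phi> [l']) \<le> length (\<phi> [l]) \<and>
          2 * common_prefix (\<phi> [flip_letter l]) (\<phi> [l']) \<le> length (\<phi> [l'])"
        proof (cases "fst l' = fst l")
          case True
          then have "l' = l" using same l by blast
          then show ?thesis using strict[OF l(1)] by simp
        next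
          case False
          then show ?thesis using N1 N1' l by metis
        qed
        then show "2 * common_prefix (\<phi> [flip_letter l]) (\<phi> [l']) \<le> length (\<phi> [l])"
          "2 * common_prefix (\<phi> [flip_letter l]) (\<phi> [l']) \<le> length (\<phi> [l'])" by auto
      qed
      \<comment> \<open>If half of \<open>b = \<phi> [l']\<close> cancels on either side of
        \<open>a = \<phi> [l]\<close>, then \<open>b = e \<ast> \<inverse> d\<close> and
        \<open>a = d \<ast> (m \<ast> \<inverse> e)\<close>. Conjugated by
        \<open>\<inverse> d\<close>, the pair \<open>a \<ast> b\<close>, \<open>b\<close> becomes
        \<open>m\<close>, \<open>\<inverse> d \<ast> e\<close>, which is shorter in total by at
        least the length of \<open>b\<close>.\<close>
      have N2: False
        if l: "l \<in> {1, 2} \<times> UNIV" "l' \<in> {1, 2} \<times> UNIV" "fst l \<noteq> fst l'"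
          and c: "2 * common_prefix (\<phi> [flip_letter l]) (\<phi> [l']) = length (\<phi> [l'])"
            "2 * common_prefix (\<phi> [flip_letter l']) (\<phi> [l]) = length (\<phi> [l'])" for l l'
      proof (rule moved[OF l])
        fix \<psi> assume \<psi>: "\<psi> \<in> auto F2" "P \<psi> \<longleftrightarrow> P \<phi>" "\<psi> (gen 1) = \<phi> [l] \<ast> \<phi> [l']" "\<psi> (gen 2) = \<phi> [l']"
        define a b n where "a = \<phi> [l]" and "b = \<phi> [l']" and "n = common_prefix (\<phi> [flip_letter l]) (\<phi> [l'])"
        have ab: "a \<in> carrier F2" "b \<in> carrier F2" "\<inverse> a = \<phi> [flip_letter l]" "\<inverse> b = \<phi> [flip_letter l']"
          using \<phi>l l inv_letter by (auto simp: a_def b_def)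
        have lb: "length b = 2 * n" "common_prefix (\<inverse> a) b = n" "common_prefix (\<inverse> b) a = n"
          using c ab by (auto simp: a_def b_def n_def)
        have la: "2 * n \<le> length a" using N1'[OF l] by (simp add: a_def n_def)
        have n0: "n > 0" using pos[OF lc[OF l(2)]] lb(1) by (cases "n = 0") (simp_all add: b_def)
        define d e where "d = take n a" and "e = take n b"
        have db: "drop n b = \<inverse> d" and ea: "drop (length a - n) a = \<inverse> e"
          and dc: "d \<in> carrier F2" and ec: "e \<in> carrier F2"
        proof -
          show dc: "d \<in> carrier F2" and ec: "e \<in> carrier F2"
            using carrier_F2_append(1)[of "take n a" "drop n a"] carrier_F2_append(1)[of "take n b" "drop n b"] ab
            by (simp_all add: d_def e_def)
          have inv_take: "\<inverse> (take n (\<inverse> u)) = drop (length u - n) u"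
            if u: "u \<in> carrier F2" "n \<le> length u" for u
          proof -
            have "take n (\<inverse> u) \<in> carrier F2"
              using carrier_F2_append(1)[of "take n (\<inverse> u)" "drop n (\<inverse> u)"] u by simp
            then show ?thesis
              using u by (simp add: inv_F2 take_map rev_map take_rev o_def)
          qed
          have "take n (\<inverse> b) = d" "take n (\<inverse> a) = e"
            using take_common_prefix[of n "\<inverse> b" a] take_common_prefix[of n "\<inverse> a" b] lb
            by (simp_all add: d_def e_def)
          then show "drop n b = \<inverse> d" "drop (length a - n) a = \<inverse> e"
            using inv_take[OF ab(1)] inv_take[OF ab(2)] lb la by auto
        qed
        define m where "m = take (length a - 2 * n) (drop n a)"
        have b_eq: "b = e \<ast> \<inverse> d"
        proof -
          have "take n b \<ast> drop n b = b"
            using carrier_F2_append(3)[of "take n b" "drop n b"] ab(2) by simp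
          then show ?thesis using db by (simp add: e_def)
        qed
        have a_split: "drop n a = m @ drop (length a - n) a"
          using la append_take_drop_id[of "length a - 2 * n" "drop n a"] by (simp add: m_def)
        have mc: "m \<in> carrier F2" and a_eq: "a = d \<ast> (m \<ast> \<inverse> e)"
        proof -
          have da: "drop n a \<in> carrier F2" "a = d \<ast> drop n a"
            using carrier_F2_append(2,3)[of "take n a" "drop n a"] ab by (simp_all add: d_def)
          then have "m @ \<inverse> e \<in> carrier F2" using a_split ea by simp
          from carrier_F2_append(1,3)[OF this] show "m \<in> carrier F2" "a = d \<ast> (m \<ast> \<inverse> e)"
            using da a_split ea by simp_all
        qed
        have lm: "length m \<le> length a - 2 * n" by (simp add: m_def)
        let ?\<chi> = "conj_aut F2 (\<inverse> d) \<star> \<psi>"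
        have \<chi>: "?\<chi> \<in> auto F2" "P ?\<chi> \<longleftrightarrow> P \<phi>"
          using \<psi> inner'[OF \<psi>(1)] dc F2.inner_auto by simp_all
        have "?\<chi> (gen 1) = \<inverse> d \<ast> (a \<ast> b) \<ast> d"
          using \<psi> dc F2.inner_auto ab by (simp add: mult_AutoGroup_apply a_def b_def) (simp add: conj_aut_def a_def b_def)
        also have "\<dots> = m"
          unfolding a_eq b_eq using dc ec mc by (simp add: F2.m_assoc F2.inv_cancel)
        finally have \<chi>1: "?\<chi> (gen 1) = m" .
        have "?\<chi> (gen 2) = \<inverse> d \<ast> b \<ast> d"
          using \<psi> dc F2.inner_auto ab by (simp add: mult_AutoGroup_apply b_def) (simp add: conj_aut_def b_def)
        also have "\<dots> = \<inverse> d \<ast> e"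
          unfolding b_eq using dc ec by (simp add: F2.m_assoc)
        finally have "length (?\<chi> (gen 2)) \<le> 2 * n"
          using length_inv_mult[OF dc ec] by (simp add: d_def e_def)
        then show False
          using red[OF \<chi>] \<chi>1 lm la L[OF l] lb(1) n0 by (simp add: a_def b_def)
      qed
      have middle: "common_prefix (\<phi> [flip_letter l]) (\<phi> [l']) + common_prefix (\<phi> [flip_letter l']) (\<phi> [l''])
         < length (\<phi> [l'])"
        if l: "l \<in> {1, 2} \<times> UNIV" "l' \<in> {1, 2} \<times> UNIV" "l'' \<in> {1, 2} \<times> UNIV"
          and ne: "l' \<noteq> flip_letter l" "l'' \<noteq> flip_letter l'" for l l' l''
      proof (rule ccontr)
        assume neg: "\<not> ?thesis"
        have h: "2 * common_prefix (\<phi> [flip_letter l]) (\<phi> [l']) = length (\<phi> [l'])"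
          "2 * common_prefix (\<phi> [flip_letter l']) (\<phi> [l'']) = length (\<phi> [l'])"
          using neg half(2)[OF l(1,2) ne(1)] half(1)[OF l(2,3) ne(2)] by linarith+
        have f1: "fst l \<noteq> fst l'"
        proof
          assume "fst l = fst l'"
          then have "l' = l" using same[OF ne(1)] by simp
          then show False using strict[OF l(2)] h(1) by simp
        qed
        have f2: "fst l'' \<noteq> fst l'"
        proof
          assume "fst l'' = fst l'"
          then have "l'' = l'" using same[OF ne(2)] by simp
          then show False using strict[OF l(2)] h(2) by simp
        qed
        have "fst l = fst l''" using l f1 f2 by auto
        then consider "l'' = l" | "l'' = flip_letter l"
          by (auto simp: flip_letter_def prod_eq_iff)
        then show False
        proof cases
          case 1
          then show False using N2[OF l(1,2) f1] h by simp
        next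
          case 2
          \<comment> \<open>Both prefixes reach half of \<open>\<phi> [l']\<close>, so this word
            would agree with its own inverse up to the middle.\<close>
          have "min (common_prefix (\<phi> [flip_letter l']) (\<phi> [flip_letter l])) (common_prefix (\<phi> [flip_letter l]) (\<phi> [l']))
            \<le> common_prefix (\<phi> [flip_letter l']) (\<phi> [l'])"
            by (rule common_prefix_ultra)
          then show False using strict[OF l(2)] h 2 by simp
        qed
      qed
      \<comment> \<open>The preimage of a generator has an image of length one and is therefore a
        single letter.\<close>
      have letter: "\<exists>l\<in>{1, 2} \<times> UNIV. \<phi> [l] = gen a" if a: "a \<in> {1, 2}" for a
      proof -
        let ?w = "(inv\<^bsub>AutoGroup F2\<^esub> \<phi>) (gen a)"
        have w: "?w \<in> carrier F2" "\<phi> ?w = gen a"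
          using F2.auto_inv_apply[OF \<phi> gen_carrier'[OF a]] by auto
        have "\<phi> [] = []"
          using group_hom.hom_one[of F2 F2 \<phi>] mem_autoD(1)[OF \<phi>] F2.is_group
          by (simp add: group_hom_def group_hom_axioms_def one_F2)
        then have "?w \<noteq> []" using w by (auto simp: gen_def)
        then have "length ?w = 1"
          using reduced_images_length[OF \<phi> half(1) middle w(1)] w(2) by (simp add: gen_def)
        then obtain l where "?w = [l]" by (metis One_nat_def length_0_conv length_Suc_conv)
        then show ?thesis using w by (auto simp: carrier_F2)
      qed
      obtain l where l: "l \<in> {1, 2} \<times> UNIV" "\<phi> [l] = gen 1" using letter[of 1] by blast
      obtain l' where l': "l' \<in> {1, 2} \<times> UNIV" "\<phi> [l'] = gen 2" using letter[of 2] by blast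
      have "fst l \<noteq> fst l'"
      proof
        assume "fst l = fst l'"
        then have "l' = l \<or> l' = flip_letter l" using same by metis
        then show False
          using l l' inv_letter[OF l(1)] inv_gen[of 1] by (auto simp: gen_def)
      qed
      show False
      proof (rule signed[OF l(1) l'(1) \<open>fst l \<noteq> fst l'\<close>])
        fix \<sigma> assume \<sigma>: "\<sigma> \<in> auto F2" "\<sigma> (gen 1) = [l]" "\<sigma> (gen 2) = [l']"
          "\<And>\<phi>. \<phi> \<in> auto F2 \<Longrightarrow> P (\<phi> \<star> \<sigma>) \<longleftrightarrow> P \<phi>"
        have "\<phi> \<star> \<sigma> = \<one>\<^bsub>AutoGroup F2\<^esub>"
          using \<phi> \<sigma> \<iota> l l' by (intro auto_F2_eqI) (simp_all add: mult_AutoGroup_apply one_AutoGroup)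
        then show False using one \<sigma>(4)[OF \<phi>] not_P by simp
      qed
    qed
  qed
qed

section \<open>The level four congruence subgroup\<close>

definition inner_Theta :: "((nat \<times> bool) list \<Rightarrow> (nat \<times> bool) list) set" where
  "inner_Theta = {conj_aut F2 h \<star> Theta g | h g. h \<in> carrier F2 \<and> g \<in> carrier F2}"

interpretation inner2: group_hom F2 "AutoGroup F2" "conj_aut F2"
  by unfold_locales (rule F2.inner_hom)

interpretation Theta: group_hom F2 "AutoGroup F2" Theta
  by unfold_locales (rule Theta_hom)

lemma inner_auto_F2 [simp]: "h \<in> carrier F2 \<Longrightarrow> conj_aut F2 h \<in> auto F2"
  by (rule F2.inner_auto)

lemma Theta_auto' [simp]: "g \<in> carrier F2 \<Longrightarrow> Theta g \<in> auto F2"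
  by (rule Theta_auto)

lemma inv_auto [simp]: "\<phi> \<in> auto F2 \<Longrightarrow> inv\<^bsub>AutoGroup F2\<^esub> \<phi> \<in> auto F2"
  using A2.inv_closed by simp

lemma one_auto [simp]: "\<one>\<^bsub>AutoGroup F2\<^esub> \<in> auto F2"
  using A2.one_closed by simp

lemma auto_assoc:
  "\<lbrakk>a \<in> auto F2; b \<in> auto F2; c \<in> auto F2\<rbrakk>
    \<Longrightarrow> a \<star> b \<star> c = a \<star> (b \<star> c)"
  using A2.m_assoc by simp

lemma inner_ThetaI:
  "\<lbrakk>h \<in> carrier F2; g \<in> carrier F2\<rbrakk> \<Longrightarrow> conj_aut F2 h \<star> Theta g \<in> inner_Theta"
  unfolding inner_Theta_def by blast

text \<open>A normal subgroup times a subgroup: \<open>auto_inner\<close> collects the inner factors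
  on the left.\<close>

lemma subgroup_inner_Theta: "subgroup inner_Theta (AutoGroup F2)"
proof (rule A2.subgroupI)
  show "inner_Theta \<subseteq> carrier (AutoGroup F2)" by (auto simp: inner_Theta_def)
  show "inner_Theta \<noteq> {}" using inner_ThetaI by blast
  fix x assume "x \<in> inner_Theta"
  then obtain h g where x: "x = conj_aut F2 h \<star> Theta g" "h \<in> carrier F2" "g \<in> carrier F2"
    by (auto simp: inner_Theta_def)
  have "inv\<^bsub>AutoGroup F2\<^esub> x = Theta (\<inverse> g) \<star> conj_aut F2 (\<inverse> h)"
    using x by (simp add: A2.inv_mult_group inner2.hom_inv Theta.hom_inv)
  also have "\<dots> = conj_aut F2 (Theta (\<inverse> g) (\<inverse> h)) \<star> Theta (\<inverse> g)"
    using x by (intro F2.auto_inner Theta_auto) auto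
  finally have eq: "inv\<^bsub>AutoGroup F2\<^esub> x = \<dots>" .
  show "inv\<^bsub>AutoGroup F2\<^esub> x \<in> inner_Theta"
    unfolding eq by (intro inner_ThetaI auto_closed[OF Theta_auto]) (use x in auto)
  fix y assume "y \<in> inner_Theta"
  then obtain h' g' where y: "y = conj_aut F2 h' \<star> Theta g'" "h' \<in> carrier F2" "g' \<in> carrier F2"
    by (auto simp: inner_Theta_def)
  note c = auto_closed[OF Theta_auto[OF x(3)] y(2)]
  have "x \<star> y = conj_aut F2 h \<star> (Theta g \<star> conj_aut F2 h') \<star> Theta g'"
    using x y by (simp add: auto_assoc)
  also have "\<dots> = (conj_aut F2 h \<star> conj_aut F2 (Theta g h')) \<star> (Theta g \<star> Theta g')"
    using x y c by (simp add: F2.auto_inner[OF Theta_auto] auto_assoc)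
  also have "\<dots> = conj_aut F2 (h \<ast> Theta g h') \<star> Theta (g \<ast> g')"
    using x y c by simp
  finally have eq: "x \<star> y = \<dots>" .
  show "x \<star> y \<in> inner_Theta"
    unfolding eq by (intro inner_ThetaI) (use x y c in auto)
qed

lemma inner_Theta_auto: "x \<in> inner_Theta \<Longrightarrow> x \<in> auto F2"
  using subgroup.subset[OF subgroup_inner_Theta] by auto

lemma inner_Theta_mult: "\<lbrakk>x \<in> inner_Theta; y \<in> inner_Theta\<rbrakk> \<Longrightarrow> x \<star> y \<in> inner_Theta"
  using subgroup.m_closed[OF subgroup_inner_Theta] .

lemma inner_Theta_inv: "x \<in> inner_Theta \<Longrightarrow> inv\<^bsub>AutoGroup F2\<^esub> x \<in> inner_Theta"
  using subgroup.m_inv_closed[OF subgroup_inner_Theta] .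

lemma inner_Theta_inner: "h \<in> carrier F2 \<Longrightarrow> conj_aut F2 h \<in> inner_Theta"
  using inner_ThetaI[of h "\<one>\<^bsub>F2\<^esub>"] by simp

lemma inner_Theta_gens: "alpha \<in> inner_Theta" "beta \<in> inner_Theta"
proof -
  have T: "Theta g \<in> inner_Theta" if "g \<in> carrier F2" for g
    using inner_ThetaI[of "\<one>\<^bsub>F2\<^esub>" g] that by simp
  show "alpha \<in> inner_Theta" using T[of "gen 2"] by (simp add: Theta_gen)
  show "beta \<in> inner_Theta" using T[of "\<inverse> gen 1"] beta_auto by (simp add: Theta_gen)
qed

text \<open>Conjugation by an involution is multiplicative and takes inner automorphisms to inner
  ones, so the two twists decide.\<close>

lemma inner_Theta_conj:
  assumes \<sigma>: "\<sigma> \<in> auto F2" "\<sigma> \<star> \<sigma> = \<one>\<^bsub>AutoGroup F2\<^esub>"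
    and gens: "\<sigma> \<star> alpha \<star> \<sigma> \<in> inner_Theta"
      "\<sigma> \<star> beta \<star> \<sigma> \<in> inner_Theta"
    and x: "x \<in> inner_Theta"
  shows "\<sigma> \<star> x \<star> \<sigma> \<in> inner_Theta"
proof -
  let ?c = "\<lambda>x. \<sigma> \<star> x \<star> \<sigma>"
  have \<sigma>\<sigma>: "\<sigma> \<star> (\<sigma> \<star> z) = z" if "z \<in> auto F2" for z
    using that \<sigma> by (simp flip: auto_assoc)
  have c_mult: "?c (x \<star> y) = ?c x \<star> ?c y" if "x \<in> auto F2" "y \<in> auto F2" for x y
    using that \<sigma>(1) \<sigma>\<sigma> by (simp add: auto_assoc)
  have inv\<sigma>: "inv\<^bsub>AutoGroup F2\<^esub> \<sigma> = \<sigma>" using \<sigma> A2.inv_equality by simp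
  have c_inv: "?c (inv\<^bsub>AutoGroup F2\<^esub> x) = inv\<^bsub>AutoGroup F2\<^esub> (?c x)" if "x \<in> auto F2" for x
    using that \<sigma>(1) inv\<sigma> by (simp add: A2.inv_mult_group auto_assoc)
  have c_T: "?c (Theta g) \<in> inner_Theta" if "g \<in> carrier F2" for g
    using that
  proof (induction rule: F2_induct)
    case one
    then show ?case using \<sigma> subgroup.one_closed[OF subgroup_inner_Theta] by simp
  next
    case (gen1 w)
    have "?c (inv\<^bsub>AutoGroup F2\<^esub> beta) \<in> inner_Theta"
      using c_inv beta_auto inner_Theta_inv gens by simp
    then show ?case using gen1 c_mult[of "inv\<^bsub>AutoGroup F2\<^esub> beta" "Theta w"] beta_auto
      by (simp add: Theta_gen inner_Theta_mult)
  next
    case (inv1 w)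
    then show ?case using gens(2) c_mult[of beta "Theta w"] beta_auto
      by (simp add: Theta_gen inner_Theta_mult)
  next
    case (gen2 w)
    then show ?case using gens(1) c_mult[of alpha "Theta w"] alpha_auto
      by (simp add: Theta_gen inner_Theta_mult)
  next
    case (inv2 w)
    have "?c (inv\<^bsub>AutoGroup F2\<^esub> alpha) \<in> inner_Theta"
      using c_inv alpha_auto inner_Theta_inv gens by simp
    then show ?case using inv2 c_mult[of "inv\<^bsub>AutoGroup F2\<^esub> alpha" "Theta w"] alpha_auto
      by (simp add: Theta_gen inner_Theta_mult)
  qed
  obtain h g where x: "x = conj_aut F2 h \<star> Theta g" "h \<in> carrier F2" "g \<in> carrier F2"
    using x by (auto simp: inner_Theta_def)
  have "?c (conj_aut F2 h) = conj_aut F2 (\<sigma> h)"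
    using F2.auto_inner[OF \<sigma>(1) x(2)] auto_closed[OF \<sigma>(1) x(2)] \<sigma> by (simp add: auto_assoc)
  then show ?thesis
    using c_mult[of "conj_aut F2 h" "Theta g"] x c_T[OF x(3)] inner_Theta_inner auto_closed[OF \<sigma>(1) x(2)]
    by (simp add: inner_Theta_mult)
qed

lemma conj_relation_words:
  "[] \<in> carrier F2" "[(2, True)] \<in> carrier F2"
  "[(2, True), (2, True)] \<in> carrier F2" "[(1, False), (1, False)] \<in> carrier F2"
  "[(2, False), (2, False)] \<in> carrier F2" "[(1, True), (1, True)] \<in> carrier F2"
  by (auto simp: carrier_F2 freely_reduced_def flip_letter_def)

lemmas conj_relation_autos =
  conj_relation_words[THEN F2.inner_auto] conj_relation_words[THEN F2.inner_auto, THEN auto_closed]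
  conj_relation_words[THEN F2.inner_auto, unfolded One_nat_def]
  conj_relation_words[THEN F2.inner_auto, THEN auto_closed, unfolded One_nat_def]

text \<open>These lift relations between integral matrices of size two; the inner factors account
  for the discrepancy in the automorphism group.\<close>

lemma conj_relations:
  "swap \<star> alpha \<star> swap = conj_aut F2 [(2, True), (2, True)] \<star> beta"
  "swap \<star> beta \<star> swap = conj_aut F2 [(1, False), (1, False)] \<star> alpha"
  "flip1 \<star> alpha \<star> flip1 \<star> alpha = conj_aut F2 []"
  "flip1 \<star> beta \<star> flip1 \<star> beta = conj_aut F2 [(2, False), (2, False)]"
  "flip2 \<star> alpha \<star> flip2 \<star> alpha = conj_aut F2 [(1, True), (1, True)]"
  "flip2 \<star> beta \<star> flip2 \<star> beta = conj_aut F2 []"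
  "rho \<star> flip1 = conj_aut F2 [(2, True)] \<star> beta \<star> flip1 \<star> rho"
  "rho \<star> flip2 = beta \<star> flip2 \<star> rho"
  "rho \<star> rho = beta"
  "rho \<star> swap \<star> rho = conj_aut F2 [(2, True)] \<star> beta \<star> flip2
     \<star> (swap \<star> rho \<star> swap)"
  "flip1 \<star> flip2 = flip2 \<star> flip1"
  "swap \<star> flip1 = flip2 \<star> swap"
  "swap \<star> flip2 = flip1 \<star> swap"
  by (rule auto_F2_eqI; simp add: auto_F2_apply conj_relation_autos; simp add: auto_F2_eval conj_aut_def)+

lemma inner_Theta_conj_elementary:
  assumes x: "x \<in> inner_Theta" and \<sigma>: "\<sigma> \<in> {swap, flip1, flip2}"
  shows "\<sigma> \<star> x \<star> \<sigma> \<in> inner_Theta"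
proof -
  note words = conj_relation_words
  have div: "\<psi> \<in> inner_Theta"
    if "\<psi> \<star> \<xi> = conj_aut F2 h" "\<psi> \<in> auto F2" "\<xi> \<in> inner_Theta" "h \<in> carrier F2" for \<psi> \<xi> h
  proof -
    have "\<psi> = conj_aut F2 h \<star> inv\<^bsub>AutoGroup F2\<^esub> \<xi>"
      using that inner_Theta_auto[OF that(3)] A2.inv_solve_right[of \<psi> "conj_aut F2 h" \<xi>] by simp
    then show ?thesis using that by (simp add: inner_Theta_mult inner_Theta_inner inner_Theta_inv)
  qed
  note e = elementary_auto alpha_auto beta_auto
  show ?thesis
    using \<sigma>
  proof (elim insertE emptyE)
    assume "\<sigma> = swap"
    moreover have "swap \<star> alpha \<star> swap \<in> inner_Theta"
      "swap \<star> beta \<star> swap \<in> inner_Theta"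
      unfolding conj_relations by (intro inner_Theta_mult inner_Theta_inner inner_Theta_gens words)+
    ultimately show ?thesis using inner_Theta_conj[OF elementary_auto(1) elementary_relations(1)] x by simp
  next
    assume "\<sigma> = flip1"
    moreover have "flip1 \<star> alpha \<star> flip1 \<in> inner_Theta"
      by (rule div[OF conj_relations(3)]) (use e inner_Theta_gens words in simp_all)
    moreover have "flip1 \<star> beta \<star> flip1 \<in> inner_Theta"
      by (rule div[OF conj_relations(4)]) (use e inner_Theta_gens words in simp_all)
    ultimately show ?thesis using inner_Theta_conj[OF elementary_auto(2) elementary_relations(2)] x by simp
  next
    assume "\<sigma> = flip2"
    moreover have "flip2 \<star> alpha \<star> flip2 \<in> inner_Theta"
      by (rule div[OF conj_relations(5)]) (use e inner_Theta_gens words in simp_all)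
    moreover have "flip2 \<star> beta \<star> flip2 \<in> inner_Theta"
      by (rule div[OF conj_relations(6)]) (use e inner_Theta_gens words in simp_all)
    ultimately show ?thesis using inner_Theta_conj[OF elementary_auto(3) elementary_relations(3)] x by simp
  qed
qed

section \<open>Cosets of the level two subgroup\<close>

definition sign_changes :: "((nat \<times> bool) list \<Rightarrow> (nat \<times> bool) list) set" where
  "sign_changes = {\<one>\<^bsub>AutoGroup F2\<^esub>, flip1, flip2, flip1 \<star> flip2}"

text \<open>Modulo two, \<open>swap\<close> and \<open>rho\<close> are involutions generating a
  symmetric group of degree three, and these are its six elements.\<close>

definition transversal :: "((nat \<times> bool) list \<Rightarrow> (nat \<times> bool) list) set" where
  "transversal = {\<one>\<^bsub>AutoGroup F2\<^esub>, swap, rho, swap \<star> rho, rho \<star> swap,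
     swap \<star> (rho \<star> swap)}"

text \<open>The preimage in the automorphism group of the level two congruence subgroup of
  \<open>GL(2, \<int>)\<close>; the six elements of \<^const>\<open>transversal\<close> represent its cosets.\<close>

definition level_two :: "((nat \<times> bool) list \<Rightarrow> (nat \<times> bool) list) set" where
  "level_two = {x \<star> \<epsilon> | x \<epsilon>. x \<in> inner_Theta \<and> \<epsilon> \<in> sign_changes}"

lemma cancel_involution:
  assumes "\<sigma> \<in> auto F2" "\<sigma> \<star> \<sigma> = \<one>\<^bsub>AutoGroup F2\<^esub>" "z \<in> auto F2"
  shows "\<sigma> \<star> (\<sigma> \<star> z) = z"
  using assms by (simp flip: auto_assoc)

lemmas involutions = cancel_involution[OF elementary_auto(1) elementary_relations(1)]
  cancel_involution[OF elementary_auto(2) elementary_relations(2)]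
  cancel_involution[OF elementary_auto(3) elementary_relations(3)]

lemma sign_changes_auto: "\<epsilon> \<in> sign_changes \<Longrightarrow> \<epsilon> \<in> auto F2"
  using elementary_auto by (auto simp: sign_changes_def)

lemma flips_commute:
  "z \<in> auto F2 \<Longrightarrow> flip2 \<star> (flip1 \<star> z) = flip1 \<star> (flip2 \<star> z)"
  using elementary_auto conj_relations(11) by (simp flip: auto_assoc)

lemma sign_changes_mult:
  assumes "\<epsilon> \<in> sign_changes" "\<epsilon>' \<in> sign_changes"
  shows "\<epsilon> \<star> \<epsilon>' \<in> sign_changes"
  using assms elementary_auto
  by (auto simp: sign_changes_def auto_assoc elementary_relations(1-3) involutions conj_relations(11)[symmetric] flips_commute)

lemma sign_changes_conj:
  assumes "\<epsilon> \<in> sign_changes" "x \<in> inner_Theta"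
  obtains y where "y \<in> inner_Theta" "\<epsilon> \<star> x = y \<star> \<epsilon>"
proof -
  have one: "\<exists>y\<in>inner_Theta. \<sigma> \<star> x = y \<star> \<sigma>"
    if x: "x \<in> inner_Theta" and \<sigma>: "\<sigma> \<in> {flip1, flip2}" for x \<sigma>
  proof -
    have "\<sigma> \<in> auto F2" "\<sigma> \<star> \<sigma> = \<one>\<^bsub>AutoGroup F2\<^esub>"
      using \<sigma> elementary_auto elementary_relations by auto
    then show ?thesis
      using inner_Theta_auto[OF x] inner_Theta_conj_elementary[OF x, of \<sigma>] \<sigma>
      by (intro bexI[of _ "\<sigma> \<star> x \<star> \<sigma>"]) (auto simp: auto_assoc)
  qed
  have "\<exists>y\<in>inner_Theta. \<epsilon> \<star> x = y \<star> \<epsilon>"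
    using assms(1) unfolding sign_changes_def
  proof (elim insertE emptyE)
    assume "\<epsilon> = flip1 \<star> flip2"
    moreover obtain y where y: "y \<in> inner_Theta" "flip2 \<star> x = y \<star> flip2"
      using one[OF assms(2), of flip2] by auto
    moreover obtain z where z: "z \<in> inner_Theta" "flip1 \<star> y = z \<star> flip1"
      using one[OF y(1), of flip1] by auto
    moreover have "flip1 \<star> (y \<star> flip2) = z \<star> (flip1 \<star> flip2)"
      using z y elementary_auto inner_Theta_auto by (simp flip: auto_assoc)
    ultimately show ?thesis
      using assms(2) elementary_auto inner_Theta_auto by (intro bexI[of _ z]) (simp_all add: auto_assoc)
  next
    assume "\<epsilon> = \<one>\<^bsub>AutoGroup F2\<^esub>"
    then show ?thesis using assms(2) inner_Theta_auto by (intro bexI[of _ x]) simp_all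
  qed (use one[OF assms(2)] in auto)
  then show thesis using that by blast
qed

lemma level_two_auto: "b \<in> level_two \<Longrightarrow> b \<in> auto F2"
  using inner_Theta_auto sign_changes_auto by (auto simp: level_two_def)

lemma level_two_mult:
  assumes "b \<in> level_two" "b' \<in> level_two"
  shows "b \<star> b' \<in> level_two"
proof -
  obtain x \<epsilon> where b: "b = x \<star> \<epsilon>" "x \<in> inner_Theta" "\<epsilon> \<in> sign_changes"
    using assms by (auto simp: level_two_def)
  obtain x' \<epsilon>' where b': "b' = x' \<star> \<epsilon>'" "x' \<in> inner_Theta" "\<epsilon>' \<in> sign_changes"
    using assms by (auto simp: level_two_def)
  obtain y where y: "y \<in> inner_Theta" "\<epsilon> \<star> x' = y \<star> \<epsilon>"
    using sign_changes_conj[OF b(3) b'(2)] by blast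
  note c = b(2,3) b'(2,3) y(1)
  have "b \<star> b' = x \<star> (\<epsilon> \<star> x') \<star> \<epsilon>'"
    using c b b' inner_Theta_auto sign_changes_auto by (simp add: auto_assoc)
  also have "\<dots> = (x \<star> y) \<star> (\<epsilon> \<star> \<epsilon>')"
    unfolding y(2) using c inner_Theta_auto sign_changes_auto by (simp add: auto_assoc)
  finally show ?thesis
    using inner_Theta_mult[OF b(2) y(1)] sign_changes_mult[OF b(3) b'(3)] by (auto simp: level_two_def)
qed

lemma level_two_inner_Theta: "x \<in> inner_Theta \<Longrightarrow> x \<in> level_two"
  using A2.r_one[of x] inner_Theta_auto[of x] by (force simp: level_two_def sign_changes_def)

lemma one_inner_Theta: "\<one>\<^bsub>AutoGroup F2\<^esub> \<in> inner_Theta"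
  by (rule subgroup.one_closed[OF subgroup_inner_Theta])

lemma level_two_sign_changes: "\<epsilon> \<in> sign_changes \<Longrightarrow> \<epsilon> \<in> level_two"
  using A2.l_one[of \<epsilon>] sign_changes_auto[of \<epsilon>] one_inner_Theta by (force simp: level_two_def)

text \<open>In the table of \<open>transversal_step\<close>, \<open>swap\<close> is the factor past
  which elements of \<open>level_two\<close> have to be moved.\<close>

lemma level_two_swap:
  assumes "b \<in> level_two"
  obtains b' where "b' \<in> level_two" "swap \<star> b = b' \<star> swap"
proof -
  obtain x \<epsilon> where b: "b = x \<star> \<epsilon>" "x \<in> inner_Theta" "\<epsilon> \<in> sign_changes"
    using assms by (auto simp: level_two_def)
  note e = elementary_auto inner_Theta_auto[OF b(2)] sign_changes_auto[OF b(3)]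
  obtain \<epsilon>' where \<epsilon>': "\<epsilon>' \<in> sign_changes" "swap \<star> \<epsilon> = \<epsilon>' \<star> swap"
  proof -
    have "swap \<star> (flip1 \<star> flip2) = flip1 \<star> flip2 \<star> swap"
      using conj_relations(11-13) elementary_auto by (metis auto_assoc)
    then have "\<exists>\<epsilon>'\<in>sign_changes. swap \<star> \<epsilon> = \<epsilon>' \<star> swap"
      using b(3) conj_relations(11-13) elementary_auto by (auto simp: sign_changes_def)
    then show thesis using that by blast
  qed
  let ?y = "swap \<star> x \<star> swap"
  have y: "?y \<in> inner_Theta" using inner_Theta_conj_elementary[OF b(2)] by simp
  have "swap \<star> b = ?y \<star> (swap \<star> \<epsilon>)"
    using b(1) e involutions by (simp add: auto_assoc)
  also have "\<dots> = (?y \<star> \<epsilon>') \<star> swap"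
    unfolding \<epsilon>'(2) using e sign_changes_auto[OF \<epsilon>'(1)] by (simp add: auto_assoc)
  finally show thesis
    using that[of "?y \<star> \<epsilon>'"] y \<epsilon>'(1) by (auto simp: level_two_def)
qed

lemma transversal_auto: "t \<in> transversal \<Longrightarrow> t \<in> auto F2"
  using elementary_auto by (auto simp: transversal_def)

text \<open>Right multiplication by a generator permutes the six cosets; each case is one entry of
  the table.\<close>

lemma transversal_step:
  assumes t: "t \<in> transversal" and \<sigma>: "\<sigma> \<in> {swap, flip1, rho}"
  obtains b t' where "b \<in> level_two" "t' \<in> transversal" "t \<star> \<sigma> = b \<star> t'"
proof -
  let ?m = "\<lambda>x y. x \<star> y"
  define Q where "Q = (\<lambda>z. \<exists>b\<in>level_two. \<exists>t'\<in>transversal. z = b \<star> t')"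
  note e = elementary_auto
  have one: "\<one>\<^bsub>AutoGroup F2\<^esub> \<in> level_two"
    using one_inner_Theta by (rule level_two_inner_Theta)
  have triv: "Q t" if "t \<in> transversal" for t
    using one A2.l_one[of t] transversal_auto[OF that] that unfolding Q_def by (metis carrier_AutoGroup)
  have QI: "Q (?m b t)" if "b \<in> level_two" "t \<in> transversal" for b t
    using that unfolding Q_def by blast
  have swapQ: "Q (?m swap (?m b t))"
    if bt: "b \<in> level_two" "t \<in> transversal" "?m swap t \<in> transversal" for b t
  proof -
    obtain b' where b': "b' \<in> level_two" "?m swap b = ?m b' swap"
      using level_two_swap[OF bt(1)] by blast
    have "?m swap (?m b t) = ?m b' (?m swap t)"
      using b' bt level_two_auto transversal_auto e(1) by (metis auto_assoc)
    then show ?thesis using b'(1) bt(3) unfolding Q_def by metis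
  qed
  have T: "swap \<in> transversal" "rho \<in> transversal" "?m swap rho \<in> transversal" "?m rho swap \<in> transversal"
    "?m swap (?m rho swap) \<in> transversal" "\<one>\<^bsub>AutoGroup F2\<^esub> \<in> transversal"
    by (simp_all add: transversal_def)
  have flips: "flip1 \<in> level_two" "flip2 \<in> level_two"
    by (simp_all add: level_two_sign_changes sign_changes_def)
  have Y: "conj_aut F2 [(2, True)] \<in> level_two"
    by (intro level_two_inner_Theta inner_Theta_inner) (auto simp: carrier_F2 freely_reduced_def)
  have beta: "beta \<in> level_two" by (intro level_two_inner_Theta inner_Theta_gens)
  define b1 where "b1 = ?m (?m (conj_aut F2 [(2, True)]) beta) flip1"
  define b2 where "b2 = ?m beta flip2"
  define b3 where "b3 = ?m (?m (conj_aut F2 [(2, True)]) beta) flip2"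
  have b: "b1 \<in> level_two" "b2 \<in> level_two" "b3 \<in> level_two"
    unfolding b1_def b2_def b3_def by (intro level_two_mult Y beta flips)+
  note bA = b[THEN level_two_auto]
  \<comment> \<open>The equation \<open>r3\<close> is the braid relation of the symmetric group, up
    to a factor in \<open>level_two\<close>.\<close>
  have r1: "?m rho flip1 = ?m b1 rho" and r2: "?m rho flip2 = ?m b2 rho"
    and r3: "?m rho (?m swap rho) = ?m b3 (?m swap (?m rho swap))"
    using conj_relations(7,8,10) e level_two_auto[OF Y] level_two_auto[OF beta]
    by (simp_all add: b1_def b2_def b3_def auto_assoc)
  have "Q (?m t \<sigma>)"
    using t unfolding transversal_def
  proof (elim insertE emptyE)
    assume t: "t = \<one>\<^bsub>AutoGroup F2\<^esub>"
    show "Q (?m t \<sigma>)" using \<sigma> t e triv[OF T(1)] triv[OF T(2)] QI[OF flips(1) T(6)] by auto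
  next
    assume t: "t = swap"
    show "Q (?m t \<sigma>)" using \<sigma> t e triv[OF T(6)] triv[OF T(3)] QI[OF flips(2) T(1)]
      by (auto simp: elementary_relations(1) conj_relations(12))
  next
    assume t: "t = rho"
    have "?m beta \<one>\<^bsub>AutoGroup F2\<^esub> = beta" using beta_auto by simp
    then show "Q (?m t \<sigma>)" using \<sigma> t e triv[OF T(4)] QI[OF b(1) T(2)] QI[OF beta T(6)]
      by (auto simp: r1 conj_relations(9))
  next
    assume t: "t = ?m swap rho"
    have "?m (?m swap rho) swap = ?m swap (?m rho swap)" "?m (?m swap rho) flip1 = ?m swap (?m b1 rho)"
      "?m (?m swap rho) rho = ?m swap (?m beta \<one>\<^bsub>AutoGroup F2\<^esub>)"
      using e beta_auto by (simp_all add: auto_assoc r1 conj_relations(9))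
    then show "Q (?m t \<sigma>)" using \<sigma> t e triv[OF T(5)] swapQ[OF b(1) T(2,3)] swapQ[OF beta T(6)] T(1) by auto
  next
    assume t: "t = ?m rho swap"
    have "?m (?m rho swap) swap = rho" "?m (?m rho swap) flip1 = ?m b2 (?m rho swap)"
      "?m (?m rho swap) rho = ?m b3 (?m swap (?m rho swap))"
    proof -
      show "?m (?m rho swap) swap = rho" using e elementary_relations(1) by (simp add: auto_assoc)
      have "?m (?m rho swap) flip1 = ?m (?m rho flip2) swap"
        using e by (simp add: auto_assoc conj_relations(12))
      then show "?m (?m rho swap) flip1 = ?m b2 (?m rho swap)"
        using e bA by (simp add: r2 auto_assoc)
      show "?m (?m rho swap) rho = ?m b3 (?m swap (?m rho swap))"
        using e r3 by (simp add: auto_assoc)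
    qed
    then show "Q (?m t \<sigma>)" using \<sigma> t triv[OF T(2)] QI[OF b(2) T(4)] QI[OF b(3) T(5)] by auto
  next
    assume t: "t = ?m swap (?m rho swap)"
    have ssr: "?m swap (?m swap (?m rho swap)) = ?m rho swap" using e involutions by simp
    have "?m t swap = ?m swap rho" "?m t flip1 = ?m swap (?m b2 (?m rho swap))"
      "?m t rho = ?m swap (?m b3 (?m swap (?m rho swap)))"
    proof -
      show "?m t swap = ?m swap rho" using e elementary_relations(1) t by (simp add: auto_assoc)
      have "?m t flip1 = ?m swap (?m (?m rho flip2) swap)"
        using e t by (simp add: auto_assoc conj_relations(12))
      then show "?m t flip1 = ?m swap (?m b2 (?m rho swap))"
        using e bA by (simp add: r2 auto_assoc)
      show "?m t rho = ?m swap (?m b3 (?m swap (?m rho swap)))"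
        using e r3 t by (simp add: auto_assoc)
    qed
    then show "Q (?m t \<sigma>)" using \<sigma> triv[OF T(3)] swapQ[OF b(2) T(4,5)] swapQ[OF b(3) T(5)] T(4) ssr by auto
  qed
  then show thesis using that unfolding Q_def by blast
qed

text \<open>Inner factors are absorbed by \<open>level_two\<close> on the left, generators by the
  coset table on the right.\<close>

lemma auto_F2_decomposition:
  assumes "\<phi> \<in> auto F2"
  shows "\<exists>b\<in>level_two. \<exists>t\<in>transversal. \<phi> = b \<star> t"
  using assms
proof (induction rule: nielsen_induct)
  case one
  show ?case
    using level_two_inner_Theta[OF one_inner_Theta] A2.l_one[OF A2.one_closed, symmetric]
    unfolding transversal_def by blast
next
  case (inner \<phi> h)
  then obtain b t where b: "b \<in> level_two" "t \<in> transversal" "\<phi> = b \<star> t" by blast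
  have "conj_aut F2 h \<star> \<phi> = (conj_aut F2 h \<star> b) \<star> t"
    using b inner(2) level_two_auto transversal_auto by (simp add: auto_assoc)
  moreover have "conj_aut F2 h \<star> b \<in> level_two"
    using level_two_mult[OF level_two_inner_Theta[OF inner_Theta_inner[OF inner(2)]] b(1)] .
  ultimately show ?case using b(2) by blast
next
  case (step \<phi> \<sigma>)
  then obtain b t where b: "b \<in> level_two" "t \<in> transversal" "\<phi> = b \<star> t" by blast
  obtain b' t' where t': "b' \<in> level_two" "t' \<in> transversal" "t \<star> \<sigma> = b' \<star> t'"
    using transversal_step[OF b(2) step(2)] by blast
  have "\<sigma> \<in> auto F2" using step(2) elementary_auto by auto
  then have "\<phi> \<star> \<sigma> = (b \<star> b') \<star> t'"
    using b t' level_two_auto transversal_auto by (simp add: auto_assoc)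
  then show ?case using level_two_mult[OF b(1) t'(1)] t'(2) by blast
qed

section \<open>The action on the abelianization\<close>

lemma expo_auto:
  assumes \<phi>: "\<phi> \<in> auto F2" and w: "w \<in> carrier F2"
  shows "expo a (\<phi> w) = expo 1 w * expo a (\<phi> (gen 1)) + expo 2 w * expo a (\<phi> (gen 2))"
proof -
  note c = auto_closed[OF \<phi>] auto_mult[OF \<phi>] F2.auto_inv[OF \<phi>]
  have "\<phi> \<one>\<^bsub>F2\<^esub> = \<one>\<^bsub>F2\<^esub>"
    using group_hom.hom_one[of F2 F2 \<phi>] mem_autoD(1)[OF \<phi>] F2.is_group
    by (simp add: group_hom_def group_hom_axioms_def)
  with w show ?thesis
    by (induction rule: F2_induct) (simp_all add: c expo_mult expo_inv algebra_simps)
qed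

text \<open>Sanov's description of the matrix group generated by the two elementary matrices with
  entry two. It serves to bound \<open>inner_Theta\<close> from above; the converse information
  comes from the coset decomposition.\<close>

definition sanov :: "((nat \<times> bool) list \<Rightarrow> (nat \<times> bool) list) \<Rightarrow> bool" where
  "sanov \<phi> \<longleftrightarrow> expo 1 (\<phi> (gen 1)) mod 4 = 1 \<and> even (expo 2 (\<phi> (gen 1))) \<and>
     even (expo 1 (\<phi> (gen 2))) \<and> expo 2 (\<phi> (gen 2)) mod 4 = 1"

lemma sanov_mult:
  assumes "\<phi> \<in> auto F2" "\<psi> \<in> auto F2" "sanov \<phi>" "sanov \<psi>"
  shows "sanov (\<phi> \<star> \<psi>)"
proof -
  have cross: "(p * q + 2 * r * (2 * s)) mod 4 = 1" if "p mod 4 = 1" "q mod 4 = 1" for p q r s :: int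
  proof -
    have "(p * q + 2 * r * (2 * s)) mod 4 = (p * q + 4 * (r * s)) mod 4" by (simp add: algebra_simps)
    also have "\<dots> = (p * q) mod 4" by simp
    also have "\<dots> = 1" using that by (subst mod_mult_eq[symmetric]) simp
    finally show ?thesis .
  qed
  obtain r s where rs: "expo 2 (\<phi> (gen 1)) = 2 * r" "expo 1 (\<phi> (gen 2)) = 2 * s"
    using assms(3) by (auto simp: sanov_def elim!: evenE)
  obtain r' s' where rs': "expo 2 (\<psi> (gen 1)) = 2 * r'" "expo 1 (\<psi> (gen 2)) = 2 * s'"
    using assms(4) by (auto simp: sanov_def elim!: evenE)
  have e: "expo a ((\<phi> \<star> \<psi>) (gen b))
      = expo 1 (\<psi> (gen b)) * expo a (\<phi> (gen 1)) + expo 2 (\<psi> (gen b)) * expo a (\<phi> (gen 2))"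
    if "b \<in> {1, 2}" for a b
    using expo_auto[OF assms(1) auto_closed[OF assms(2) gen_carrier'[OF that]]] gen_carrier'[OF that] assms
    by (simp add: mult_AutoGroup_apply)
  show ?thesis
    using assms(3,4) e[of 1 1] e[of 1 2] e[of 2 1] e[of 2 2] rs rs'
      cross[of "expo 1 (\<psi> (gen 1))" "expo 1 (\<phi> (gen 1))" r' s]
      cross[of "expo 2 (\<psi> (gen 2))" "expo 2 (\<phi> (gen 2))" s' r]
    by (simp add: sanov_def algebra_simps)
qed

lemma sanov_inner_Theta:
  assumes "x \<in> inner_Theta"
  shows "sanov x"
proof -
  have inner: "sanov (conj_aut F2 h)" if "h \<in> carrier F2" for h
    using that by (simp add: sanov_def conj_aut_def expo_mult expo_inv)
  have inv_alpha: "(inv\<^bsub>AutoGroup F2\<^esub> alpha) (gen 1) = gen 1"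
    "(inv\<^bsub>AutoGroup F2\<^esub> alpha) (gen 2) = [(1, False), (1, False), (2, True)]"
  proof -
    have "alpha (gen 1) = gen 1" "alpha [(1, False), (1, False), (2, True)] = gen 2"
      "[(1, False), (1, False), (2, True)] \<in> carrier F2"
      by (simp_all add: auto_F2_eval)
    then show "(inv\<^bsub>AutoGroup F2\<^esub> alpha) (gen 1) = gen 1"
      "(inv\<^bsub>AutoGroup F2\<^esub> alpha) (gen 2) = [(1, False), (1, False), (2, True)]"
      using F2.auto_inv_apply(2)[OF alpha_auto] gen_carrier(1) by metis+
  qed
  have inv_beta: "(inv\<^bsub>AutoGroup F2\<^esub> beta) (gen 1) = [(1, True), (2, False), (2, False)]"
    "(inv\<^bsub>AutoGroup F2\<^esub> beta) (gen 2) = gen 2"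
  proof -
    have "beta (gen 2) = gen 2" "beta [(1, True), (2, False), (2, False)] = gen 1"
      "[(1, True), (2, False), (2, False)] \<in> carrier F2"
      by (simp_all add: auto_F2_eval)
    then show "(inv\<^bsub>AutoGroup F2\<^esub> beta) (gen 1) = [(1, True), (2, False), (2, False)]"
      "(inv\<^bsub>AutoGroup F2\<^esub> beta) (gen 2) = gen 2"
      using F2.auto_inv_apply(2)[OF beta_auto] gen_carrier(3) by metis+
  qed
  note [simp] = inv_alpha[unfolded One_nat_def] inv_beta[unfolded One_nat_def]
  have gens: "sanov alpha" "sanov (inv\<^bsub>AutoGroup F2\<^esub> alpha)" "sanov beta" "sanov (inv\<^bsub>AutoGroup F2\<^esub> beta)"
    by (simp_all add: sanov_def alpha_gen beta_gen) (simp_all add: expo_def gen_def)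
  have Theta: "sanov (Theta g)" if "g \<in> carrier F2" for g
    using that
  proof (induction rule: F2_induct)
    case one
    then show ?case by (simp add: sanov_def one_AutoGroup)
  qed (use gens sanov_mult alpha_auto beta_auto in \<open>simp_all add: Theta_gen\<close>)
  obtain h g where "x = conj_aut F2 h \<star> Theta g" "h \<in> carrier F2" "g \<in> carrier F2"
    using assms by (auto simp: inner_Theta_def)
  then show ?thesis using sanov_mult inner Theta by simp
qed

text \<open>The elements of \<^const>\<open>transversal\<close> other than the identity act nontrivially modulo two, and
  those of \<^const>\<open>sign_changes\<close> modulo four.\<close>

lemma level_four_inner_Theta:
  assumes \<phi>: "\<phi> \<in> auto F2"
    and four: "\<And>w. w \<in> carrier F2 \<Longrightarrow> \<phi> w \<ast> \<inverse> w \<in> expo_kernel 4"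
  shows "\<phi> \<in> inner_Theta"
proof -
  have cong: "4 dvd expo a (\<phi> (gen b)) - (if a = b then 1 else 0)" if "a \<in> {1, 2}" "b \<in> {1, 2}" for a b
    using four[OF gen_carrier'[OF that(2)]] that auto_closed[OF \<phi> gen_carrier'[OF that(2)]] gen_carrier'[OF that(2)]
    by (auto simp: expo_kernel_def expo_mult expo_inv)
  obtain b t where b: "b \<in> level_two" and t: "t \<in> transversal" and \<phi>_eq: "\<phi> = b \<star> t"
    using auto_F2_decomposition[OF \<phi>] by blast
  obtain x \<epsilon> where x: "x \<in> inner_Theta" and \<epsilon>: "\<epsilon> \<in> sign_changes" and b_eq: "b = x \<star> \<epsilon>"
    using b by (auto simp: level_two_def)
  note c = inner_Theta_auto[OF x] sign_changes_auto[OF \<epsilon>] transversal_auto[OF t]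
  let ?\<delta> = "\<epsilon> \<star> t"
  have \<delta>: "?\<delta> \<in> auto F2" "\<phi> = x \<star> ?\<delta>"
    using c by (simp_all add: \<phi>_eq b_eq auto_assoc)
  have expo_\<phi>: "expo a (\<phi> (gen k)) = expo 1 (\<epsilon> (t (gen k))) * expo a (x (gen 1)) + expo 2 (\<epsilon> (t (gen k))) * expo a (x (gen 2))"
    if "k \<in> {1, 2}" for a k
    using expo_auto[OF c(1) auto_closed[OF \<delta>(1) gen_carrier'[OF that]], of a] c \<delta> gen_carrier'[OF that] auto_closed[OF \<delta>(1) gen_carrier'[OF that]]
    by (simp add: mult_AutoGroup_apply)
  have sx: "sanov x" by (rule sanov_inner_Theta[OF x])
  obtain p q r s where x_eq: "expo 1 (x (gen 1)) = 4 * p + 1" "expo 2 (x (gen 2)) = 4 * q + 1"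
    "expo 2 (x (gen 1)) = 2 * r" "expo 1 (x (gen 2)) = 2 * s"
    using sx unfolding sanov_def by (metis evenE mult_div_mod_eq)
  have eq: "expo 1 (\<phi> (gen k)) = expo 1 (\<epsilon> (t (gen k))) * (4 * p + 1) + expo 2 (\<epsilon> (t (gen k))) * (2 * s)"
    "expo 2 (\<phi> (gen k)) = expo 1 (\<epsilon> (t (gen k))) * (2 * r) + expo 2 (\<epsilon> (t (gen k))) * (4 * q + 1)"
    if "k \<in> {1, 2}" for k
    using expo_\<phi>[OF that, of 1] expo_\<phi>[OF that, of 2] x_eq by simp_all
  define m where "m = (\<lambda>a k. expo a (\<epsilon> (t (gen k))))"
  \<comment> \<open>Modulo two the matrix of \<open>x\<close> is the identity, so the matrix
    \<open>m\<close> of \<open>\<epsilon> \<star> t\<close> is congruent to that of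
    \<open>\<phi>\<close>, hence to the identity.\<close>
  have par: "odd (m 1 1)" "even (m 2 1)" "even (m 1 2)" "odd (m 2 2)"
  proof -
    have "4 dvd m 1 1 * (4 * p + 1) + m 2 1 * (2 * s) - 1" "4 dvd m 1 1 * (2 * r) + m 2 1 * (4 * q + 1)"
      "4 dvd m 1 2 * (4 * p + 1) + m 2 2 * (2 * s)" "4 dvd m 1 2 * (2 * r) + m 2 2 * (4 * q + 1) - 1"
      using cong[of 1 1] cong[of 2 1] cong[of 1 2] cong[of 2 2] eq[of 1] eq[of 2] by (simp_all add: m_def)
    then have "even (m 1 1 * (4 * p + 1) + m 2 1 * (2 * s) - 1)" "even (m 1 1 * (2 * r) + m 2 1 * (4 * q + 1))"
      "even (m 1 2 * (4 * p + 1) + m 2 2 * (2 * s))" "even (m 1 2 * (2 * r) + m 2 2 * (4 * q + 1) - 1)"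
      by (auto dest: dvd_trans[of 2 4, rotated])
    then show "odd (m 1 1)" "even (m 2 1)" "even (m 1 2)" "odd (m 2 2)" by auto
  qed
  note e = elementary_auto
  note eval = auto_F2_apply auto_F2_eval expo_def
  have t1: "t = \<one>\<^bsub>AutoGroup F2\<^esub>"
  proof -
    have "\<epsilon> = \<one>\<^bsub>AutoGroup F2\<^esub> \<or> \<epsilon> = flip1 \<or> \<epsilon> = flip2 \<or> \<epsilon> = flip1 \<star> flip2"
      using \<epsilon> by (simp add: sign_changes_def)
    then have \<epsilon>_even: "even (expo a (\<epsilon> w)) \<longleftrightarrow> even (expo a w)" if "w \<in> carrier F2" "a \<in> {1, 2}" for a w
    proof (elim disjE)
      assume "\<epsilon> = \<one>\<^bsub>AutoGroup F2\<^esub>"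
      then show ?thesis using that by (simp add: one_AutoGroup)
    next
      assume E: "\<epsilon> = flip1"
      have "flip1 (gen 1) = [(1, False)]" "flip1 (gen 2) = gen 2" by (simp_all add: auto_F2_eval)
      then show ?thesis using that expo_auto[OF e(2) that(1), of a] E by (auto simp: expo_def gen_def)
    next
      assume E: "\<epsilon> = flip2"
      have "flip2 (gen 1) = gen 1" "flip2 (gen 2) = [(2, False)]" by (simp_all add: auto_F2_eval)
      then show ?thesis using that expo_auto[OF e(3) that(1), of a] E by (auto simp: expo_def gen_def)
    next
      assume E: "\<epsilon> = flip1 \<star> flip2"
      have "\<epsilon> (gen 1) = [(1, False)]" "\<epsilon> (gen 2) = [(2, False)]"
        unfolding E by (simp_all add: auto_F2_apply) (simp_all add: auto_F2_eval)
      then show ?thesis using that expo_auto[OF c(2) that(1), of a] by (auto simp: expo_def gen_def)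
    qed
    have par': "odd (expo 1 (t (gen 1)))" "even (expo 2 (t (gen 1)))" "even (expo 1 (t (gen 2)))" "odd (expo 2 (t (gen 2)))"
      using par \<epsilon>_even auto_closed[OF c(3)] by (simp_all add: m_def)
    show ?thesis
      using t unfolding transversal_def
    proof (elim insertE emptyE)
      assume E: "t = swap"
      have "t (gen 1) = gen 2" unfolding E by (simp add: auto_F2_eval)
      then show ?thesis using par' by simp
    next
      assume E: "t = rho"
      have "t (gen 1) = [(1, True), (2, True)]" unfolding E by (simp add: auto_F2_eval)
      then show ?thesis using par' by (simp add: expo_def)
    next
      assume E: "t = swap \<star> rho"
      have "t (gen 1) = [(2, True), (1, True)]" unfolding E by (simp add: auto_F2_apply) (simp add: auto_F2_eval)
      then show ?thesis using par' by (simp add: expo_def)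
    next
      assume E: "t = rho \<star> swap"
      have "t (gen 1) = gen 2" unfolding E by (simp add: auto_F2_apply) (simp add: auto_F2_eval)
      then show ?thesis using par' by simp
    next
      assume E: "t = swap \<star> (rho \<star> swap)"
      have "t (gen 2) = [(2, True), (1, True)]" unfolding E by (simp add: auto_F2_apply) (simp add: auto_F2_eval)
      then show ?thesis using par' by (simp add: expo_def)
    qed
  qed
  have m: "m a k = expo a (\<epsilon> (gen k))" if "k \<in> {1, 2}" for a k
    using that t1 gen_carrier'[OF that] by (simp add: m_def one_AutoGroup)
  \<comment> \<open>The off-diagonal entries of \<open>m\<close> and of the matrix of
    \<open>x\<close> are even, so their products vanish modulo four and the diagonal of
    \<open>m\<close> is congruent to that of \<open>\<phi>\<close>.\<close>
  have mod4: "4 dvd m 1 1 - 1" "4 dvd m 2 2 - 1"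
  proof -
    obtain i j where ij: "m 2 1 = 2 * i" "m 1 2 = 2 * j" using par by (auto elim!: evenE)
    have "4 dvd m 1 1 * (4 * p + 1) + 2 * i * (2 * s) - 1" "4 dvd 2 * j * (2 * r) + m 2 2 * (4 * q + 1) - 1"
      using cong[of 1 1] cong[of 2 2] eq[of 1] eq[of 2] ij by (simp_all add: m_def)
    then obtain u v where "m 1 1 * (4 * p + 1) + 2 * i * (2 * s) - 1 = 4 * u" "2 * j * (2 * r) + m 2 2 * (4 * q + 1) - 1 = 4 * v"
      by (auto elim!: dvdE)
    then have "m 1 1 - 1 = 4 * (u - m 1 1 * p - i * s)" "m 2 2 - 1 = 4 * (v - m 2 2 * q - j * r)"
      by (simp_all add: algebra_simps)
    then show "4 dvd m 1 1 - 1" "4 dvd m 2 2 - 1" by simp_all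
  qed
  have "\<epsilon> = \<one>\<^bsub>AutoGroup F2\<^esub>"
    using \<epsilon> unfolding sign_changes_def
  proof (elim insertE emptyE)
    assume E: "\<epsilon> = flip1"
    have "\<epsilon> (gen 1) = [(1, False)]" unfolding E by (simp add: auto_F2_eval)
    then show ?thesis using mod4 by (simp add: m expo_def)
  next
    assume E: "\<epsilon> = flip2"
    have "\<epsilon> (gen 2) = [(2, False)]" unfolding E by (simp add: auto_F2_eval)
    then show ?thesis using mod4 by (simp add: m expo_def)
  next
    assume E: "\<epsilon> = flip1 \<star> flip2"
    have "\<epsilon> (gen 1) = [(1, False)]" unfolding E by (simp add: auto_F2_apply) (simp add: auto_F2_eval)
    then show ?thesis using mod4 by (simp add: m expo_def)
  qed
  then show ?thesis using \<delta> t1 x c by simp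
qed

section \<open>Characteristic cores and congruence subgroups\<close>

lemma (in group) fin_index_normals_INT:
  assumes "finite \<N>" "\<N> \<noteq> {}" "\<N> \<subseteq> fin_index_normals G"
  shows "\<Inter>\<N> \<in> fin_index_normals G"
  using assms by (induction \<N> rule: finite_ne_induct) (auto intro: fin_index_normals_Int)

text \<open>For characteristic \<open>K\<close> this is the kernel of the action on the quotient by
  \<open>K\<close>.\<close>

definition congruence_subgroup :: "('a, 'b) monoid_scheme \<Rightarrow> 'a set \<Rightarrow> ('a \<Rightarrow> 'a) set" where
  "congruence_subgroup G K = {\<phi> \<in> auto G. \<forall>g\<in>carrier G. \<phi> g \<otimes>\<^bsub>G\<^esub> inv\<^bsub>G\<^esub> g \<in> K}"

text \<open>Finitely generated groups satisfy the assumption of this locale.\<close>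

locale finitely_many_small_index = group +
  assumes finite_small_index: "finite {L \<in> fin_index_normals G. card (rcosets L) \<le> n}"
begin

text \<open>A continuous automorphism of the completion yields only homomorphisms from
  \<open>G\<close> to finite quotients, not automorphisms of \<open>G\<close>. Intersecting all
  subgroups of bounded index makes every homomorphism from \<open>G\<close> to
  \<open>G Mod core N\<close> kill \<open>core N\<close>, which is stronger than being
  characteristic.\<close>

definition core :: "'a set \<Rightarrow> 'a set" where
  "core N = \<Inter>{L \<in> fin_index_normals G. card (rcosets L) \<le> card (rcosets N)}"

lemma core_subset: "N \<in> fin_index_normals G \<Longrightarrow> core N \<subseteq> N"
  by (auto simp: core_def)

lemma core_fin_index: "N \<in> fin_index_normals G \<Longrightarrow> core N \<in> fin_index_normals G"
  unfolding core_def by (rule fin_index_normals_INT) (use finite_small_index in auto)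

text \<open>The preimage in \<open>G\<close> of a normal subgroup of \<open>G Mod core N\<close> has no larger index.\<close>

lemma hom_core:
  assumes N: "N \<in> fin_index_normals G" and \<theta>: "\<theta> \<in> hom G (G Mod core N)" and g: "g \<in> core N"
  shows "\<theta> g = core N"
proof -
  interpret K: normal "core N" G using core_fin_index[OF N] by (simp add: fin_index_normals_def)
  interpret Q: group "G Mod core N" by (rule K.factorgroup_is_group)
  have gc: "g \<in> carrier G" using g K.subset by blast
  have "\<theta> g \<in> carrier (G Mod core N)" using \<theta> gc by (auto simp: hom_def)
  then obtain x where x: "x \<in> carrier G" "\<theta> g = core N #> x"
    by (auto simp: carrier_FactGroup)
  \<comment> \<open>The kernel of \<open>\<theta>\<close> followed by reduction modulo
    \<open>L\<close> has index at most that of \<open>N\<close>; it is one of the subgroups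
    intersected in \<open>core N\<close> and contains \<open>g\<close>.\<close>
  have "x \<in> L" if L: "L \<in> fin_index_normals G" "card (rcosets L) \<le> card (rcosets N)" for L
  proof -
    interpret L: normal L G using L by (simp add: fin_index_normals_def)
    have sub: "core N \<subseteq> L" using L by (auto simp: core_def)
    define \<pi> where "\<pi> = (\<lambda>C. L <#> C)"
    have \<pi>_coset: "\<pi> (core N #> y) = L #> y" if y: "y \<in> carrier G" for y
    proof
      show "\<pi> (core N #> y) \<subseteq> L #> y"
      proof
        fix z assume "z \<in> \<pi> (core N #> y)"
        then obtain l k where "l \<in> L" "k \<in> core N" "z = l \<otimes> (k \<otimes> y)"
          by (auto simp: \<pi>_def set_mult_def r_coset_def)
        moreover have "z = (l \<otimes> k) \<otimes> y"
          using calculation y L.mem_carrier K.mem_carrier by (simp add: m_assoc)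
        moreover have "l \<otimes> k \<in> L" using calculation sub by (blast intro: L.m_closed)
        ultimately show "z \<in> L #> y" unfolding r_coset_def by blast
      qed
      show "L #> y \<subseteq> \<pi> (core N #> y)"
      proof
        fix z assume "z \<in> L #> y"
        then obtain l where l: "l \<in> L" "z = l \<otimes> (\<one> \<otimes> y)" using y by (auto simp: r_coset_def)
        then show "z \<in> \<pi> (core N #> y)"
          using K.one_closed by (force simp: \<pi>_def set_mult_def r_coset_def)
      qed
    qed
    have \<pi>_hom: "\<pi> \<in> hom (G Mod core N) (G Mod L)"
    proof (rule homI)
      fix C assume "C \<in> carrier (G Mod core N)"
      then obtain y where y: "y \<in> carrier G" "C = core N #> y" by (auto simp: carrier_FactGroup)
      then show "\<pi> C \<in> carrier (G Mod L)" by (simp add: \<pi>_coset carrier_FactGroup)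
      fix D assume "D \<in> carrier (G Mod core N)"
      then obtain z where z: "z \<in> carrier G" "D = core N #> z" by (auto simp: carrier_FactGroup)
      show "\<pi> (C \<otimes>\<^bsub>G Mod core N\<^esub> D) = \<pi> C \<otimes>\<^bsub>G Mod L\<^esub> \<pi> D"
        using y z by (simp add: K.rcos_sum L.rcos_sum \<pi>_coset)
    qed
    interpret QL: group "G Mod L" by (rule L.factorgroup_is_group)
    have comp: "\<pi> \<circ> \<theta> \<in> hom G (G Mod L)"
      using \<theta> \<pi>_hom by (rule Group.hom_compose)
    let ?P = "{g \<in> carrier G. (\<pi> \<circ> \<theta>) g \<in> {\<one>\<^bsub>G Mod L\<^esub>}}"
    have one: "{\<one>\<^bsub>G Mod L\<^esub>} \<in> fin_index_normals (G Mod L)"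
    proof -
      have "finite (carrier (G Mod L))" using L by (simp add: FactGroup_def fin_index_normals_def)
      then show ?thesis
        using QL.one_is_normal by (auto simp: fin_index_normals_def RCOSETS_def)
    qed
    have card1: "card (rcosets\<^bsub>G Mod L\<^esub> {\<one>\<^bsub>G Mod L\<^esub>}) \<le> card (rcosets L)"
    proof -
      have fin: "finite (carrier (G Mod L))" using L by (simp add: FactGroup_def fin_index_normals_def)
      have "rcosets\<^bsub>G Mod L\<^esub> {\<one>\<^bsub>G Mod L\<^esub>} = (\<lambda>C. {\<one>\<^bsub>G Mod L\<^esub>} #>\<^bsub>G Mod L\<^esub> C) ` carrier (G Mod L)"
        by (auto simp: RCOSETS_def)
      moreover have "card (carrier (G Mod L)) = card (rcosets L)" by (simp add: FactGroup_def)
      ultimately show ?thesis using card_image_le[OF fin] by metis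
    qed
    have "?P \<in> fin_index_normals G"
      by (rule fin_index_normals_preimage[OF comp QL.is_group one])
    moreover have "card (rcosets ?P) \<le> card (rcosets N)"
      using card_rcosets_preimage_le[OF comp QL.is_group one] card1 L(2) by linarith
    ultimately have "g \<in> ?P" using g unfolding core_def by blast
    then have "L #> x = L" using x \<pi>_coset by simp
    then show "x \<in> L" using coset_join1[OF _ x(1) L.is_subgroup] by simp
  qed
  then have "x \<in> core N" by (auto simp: core_def)
  then show ?thesis using x coset_join2[OF x(1) K.is_subgroup] by simp
qed

lemma auto_core:
  assumes N: "N \<in> fin_index_normals G" and \<phi>: "\<phi> \<in> auto G" and g: "g \<in> core N"
  shows "\<phi> g \<in> core N"
proof -
  interpret K: normal "core N" G using core_fin_index[OF N] by (simp add: fin_index_normals_def)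
  have gc: "g \<in> carrier G" using g K.subset by blast
  have "(\<lambda>g. core N #> g) \<circ> \<phi> \<in> hom G (G Mod core N)"
    using mem_autoD(1)[OF \<phi>] K.r_coset_hom_Mod by (rule Group.hom_compose)
  from hom_core[OF N this g] have "core N #> \<phi> g = core N" by simp
  then show ?thesis using coset_join1[OF _ auto_closed[OF \<phi> gc] K.is_subgroup] by simp
qed

text \<open>An automorphism permutes the finitely many cosets of \<open>core N\<close>, and two with
  the same permutation differ by an element of the congruence subgroup.\<close>

lemma congruence_subgroup_fin_index:
  assumes N: "N \<in> fin_index_normals G"
  shows "congruence_subgroup G (core N) \<in> fin_index_normals (AutoGroup G)"
proof -
  let ?A = "AutoGroup G" and ?K = "core N"
  interpret A: group ?A by (rule AutoGroup)
  interpret K: normal ?K G using core_fin_index[OF N] by (simp add: fin_index_normals_def)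
  have inv_auto: "inv\<^bsub>?A\<^esub> \<phi> \<in> auto G" if "\<phi> \<in> auto G" for \<phi> using A.inv_closed that by simp
  have mult_auto: "\<phi> \<otimes>\<^bsub>?A\<^esub> \<psi> \<in> auto G" if "\<phi> \<in> auto G" "\<psi> \<in> auto G" for \<phi> \<psi> using A.m_closed that by simp
  have sub: "subgroup (congruence_subgroup G ?K) ?A"
  proof (rule A.subgroupI)
    show "congruence_subgroup G ?K \<subseteq> carrier ?A" by (auto simp: congruence_subgroup_def)
    have "\<one>\<^bsub>?A\<^esub> \<in> congruence_subgroup G ?K"
      using A.one_closed K.one_closed by (simp add: congruence_subgroup_def) (simp add: one_AutoGroup)
    then show "congruence_subgroup G ?K \<noteq> {}" by blast
    fix \<phi> assume \<phi>: "\<phi> \<in> congruence_subgroup G ?K"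
    then have \<phi>a: "\<phi> \<in> auto G" by (simp add: congruence_subgroup_def)
    show "inv\<^bsub>?A\<^esub> \<phi> \<in> congruence_subgroup G ?K"
      unfolding congruence_subgroup_def
    proof (intro CollectI conjI ballI inv_auto[OF \<phi>a])
      fix g assume g: "g \<in> carrier G"
      note i = auto_inv_apply[OF \<phi>a g]
      have "g \<otimes> inv ((inv\<^bsub>?A\<^esub> \<phi>) g) \<in> ?K"
        using \<phi> i unfolding congruence_subgroup_def by force
      then have "inv (g \<otimes> inv ((inv\<^bsub>?A\<^esub> \<phi>) g)) \<in> ?K" by (rule K.m_inv_closed)
      then show "(inv\<^bsub>?A\<^esub> \<phi>) g \<otimes> inv g \<in> ?K" using i g by (simp add: inv_mult_group)
    qed
    fix \<psi> assume \<psi>: "\<psi> \<in> congruence_subgroup G ?K"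
    then have \<psi>a: "\<psi> \<in> auto G" by (simp add: congruence_subgroup_def)
    show "\<phi> \<otimes>\<^bsub>?A\<^esub> \<psi> \<in> congruence_subgroup G ?K"
      unfolding congruence_subgroup_def
    proof (intro CollectI conjI ballI mult_auto[OF \<phi>a \<psi>a])
      fix g assume g: "g \<in> carrier G"
      note c = auto_closed[OF \<psi>a g] auto_closed[OF \<phi>a auto_closed[OF \<psi>a g]]
      have "\<phi> (\<psi> g) \<otimes> inv (\<psi> g) \<in> ?K" "\<psi> g \<otimes> inv g \<in> ?K"
        using \<phi> \<psi> c g by (auto simp: congruence_subgroup_def)
      then have "(\<phi> (\<psi> g) \<otimes> inv (\<psi> g)) \<otimes> (\<psi> g \<otimes> inv g) \<in> ?K" by (rule K.m_closed)
      then show "(\<phi> \<otimes>\<^bsub>?A\<^esub> \<psi>) g \<otimes> inv g \<in> ?K"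
        using c g \<phi>a \<psi>a by (simp add: mult_AutoGroup_apply m_assoc inv_cancel)
    qed
  qed
  show ?thesis
  proof (rule A.fin_index_normalsI[where r = "\<lambda>\<phi>. restrict (\<lambda>C. \<phi> ` C) (rcosets ?K)"])
    show "congruence_subgroup G ?K \<lhd> ?A"
      unfolding A.normal_inv_iff
    proof (intro conjI sub ballI)
      fix \<psi> \<phi> assume "\<psi> \<in> carrier ?A" and \<phi>: "\<phi> \<in> congruence_subgroup G ?K"
      then have \<psi>a: "\<psi> \<in> auto G" and \<phi>a: "\<phi> \<in> auto G" by (simp_all add: congruence_subgroup_def)
      note \<psi>i = inv_auto[OF \<psi>a]
      show "\<psi> \<otimes>\<^bsub>?A\<^esub> \<phi> \<otimes>\<^bsub>?A\<^esub> inv\<^bsub>?A\<^esub> \<psi> \<in> congruence_subgroup G ?K"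
        unfolding congruence_subgroup_def
      proof (intro CollectI conjI ballI mult_auto \<psi>a \<phi>a \<psi>i)
        fix g assume g: "g \<in> carrier G"
        let ?g = "(inv\<^bsub>?A\<^esub> \<psi>) g"
        note i = auto_inv_apply[OF \<psi>a g]
        have "\<phi> ?g \<otimes> inv ?g \<in> ?K" using \<phi> i by (auto simp: congruence_subgroup_def)
        then have "\<psi> (\<phi> ?g \<otimes> inv ?g) \<in> ?K" by (rule auto_core[OF N \<psi>a])
        moreover have "\<psi> (\<phi> ?g \<otimes> inv ?g) = \<psi> (\<phi> ?g) \<otimes> inv g"
          using auto_mult[OF \<psi>a auto_closed[OF \<phi>a i(3)]] auto_inv[OF \<psi>a i(3)] i by simp
        ultimately show "(\<psi> \<otimes>\<^bsub>?A\<^esub> \<phi> \<otimes>\<^bsub>?A\<^esub> inv\<^bsub>?A\<^esub> \<psi>) g \<otimes> inv g \<in> ?K"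
          using g i \<psi>a \<phi>a \<psi>i mult_auto by (simp add: mult_AutoGroup_apply)
      qed
    qed
    have coset_image: "\<phi> ` (?K #> g) = ?K #> \<phi> g" if \<phi>: "\<phi> \<in> auto G" and g: "g \<in> carrier G" for \<phi> g
    proof
      show "\<phi> ` (?K #> g) \<subseteq> ?K #> \<phi> g"
        using auto_core[OF N \<phi>] auto_mult[OF \<phi> K.mem_carrier g] by (auto simp: r_coset_def)
      show "?K #> \<phi> g \<subseteq> \<phi> ` (?K #> g)"
      proof
        fix z assume "z \<in> ?K #> \<phi> g"
        then obtain k where k: "k \<in> ?K" "z = k \<otimes> \<phi> g" by (auto simp: r_coset_def)
        let ?k = "(inv\<^bsub>?A\<^esub> \<phi>) k"
        have "?k \<in> ?K" using auto_core[OF N inv_auto[OF \<phi>] k(1)] .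
        moreover have "\<phi> (?k \<otimes> g) = z"
          using auto_mult[OF \<phi> _ g] auto_inv_apply[OF \<phi>] k K.mem_carrier by simp
        ultimately show "z \<in> \<phi> ` (?K #> g)" by (force simp: r_coset_def)
      qed
    qed
    have "(\<lambda>\<phi>. restrict (\<lambda>C. \<phi> ` C) (rcosets ?K)) ` carrier ?A \<subseteq> rcosets ?K \<rightarrow>\<^sub>E rcosets ?K"
      using coset_image auto_closed by (fastforce simp: RCOSETS_def)
    moreover have "finite (rcosets ?K \<rightarrow>\<^sub>E rcosets ?K)"
      using core_fin_index[OF N] by (intro finite_PiE) (auto simp: fin_index_normals_def)
    ultimately show "finite ((\<lambda>\<phi>. restrict (\<lambda>C. \<phi> ` C) (rcosets ?K)) ` carrier ?A)"
      by (rule finite_subset)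
    fix \<phi> \<psi> assume a: "\<phi> \<in> carrier ?A" "\<psi> \<in> carrier ?A"
      and eq: "restrict (\<lambda>C. \<phi> ` C) (rcosets ?K) = restrict (\<lambda>C. \<psi> ` C) (rcosets ?K)"
    then have \<phi>: "\<phi> \<in> auto G" and \<psi>: "\<psi> \<in> auto G" by simp_all
    show "\<phi> \<otimes>\<^bsub>?A\<^esub> inv\<^bsub>?A\<^esub> \<psi> \<in> congruence_subgroup G ?K"
      unfolding congruence_subgroup_def
    proof (intro CollectI conjI ballI mult_auto \<phi> inv_auto \<psi>)
      fix g assume g: "g \<in> carrier G"
      let ?g = "(inv\<^bsub>?A\<^esub> \<psi>) g"
      note i = auto_inv_apply[OF \<psi> g]
      have "?K #> ?g \<in> rcosets ?K" using i by (intro rcosetsI K.subset)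
      then have "\<phi> ` (?K #> ?g) = \<psi> ` (?K #> ?g)" using fun_cong[OF eq, of "?K #> ?g"] by simp
      then have "?K #> \<phi> ?g = ?K #> g" using coset_image[OF \<phi> i(3)] coset_image[OF \<psi> i(3)] i(1) by simp
      then have "\<phi> ?g \<in> ?K #> g" using rcos_self[OF auto_closed[OF \<phi> i(3)] K.is_subgroup] by simp
      then have "\<phi> ?g \<otimes> inv g \<in> ?K" using K.rcos_module_imp[OF is_group g] by simp
      then show "(\<phi> \<otimes>\<^bsub>?A\<^esub> inv\<^bsub>?A\<^esub> \<psi>) g \<otimes> inv g \<in> ?K"
        using g \<phi> \<psi> inv_auto by (simp add: mult_AutoGroup_apply)
    qed
  qed
qed

end

text \<open>A normal subgroup of index at most \<open>n\<close> is the stabilizer of a point under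
  some assignment of self-maps of \<open>{..<n}\<close> to the letters; there are finitely many such
  data.\<close>

lemma F2_finite_small_index: "finite {L \<in> fin_index_normals F2. card (rcosets\<^bsub>F2\<^esub> L) \<le> n}"
proof -
  let ?S = "{1, 2 :: nat} \<times> (UNIV :: bool set)"
  define W where "W = (?S \<rightarrow>\<^sub>E ({..<n} \<rightarrow>\<^sub>E {..<n})) \<times> {..<n}"
  have "finite W" unfolding W_def by (intro finite_cartesian_product finite_PiE) auto
  have "L \<in> (\<lambda>(A, i). {w \<in> carrier F2. foldr A w i = i}) ` W"
    if L: "L \<in> fin_index_normals F2" "card (rcosets\<^bsub>F2\<^esub> L) \<le> n" for L
  proof -
    interpret L: normal L F2 using L by (simp add: fin_index_normals_def)
    define Q where "Q = (\<lambda>g. g <#\<^bsub>F2\<^esub> L) ` carrier F2"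
    have Q: "finite Q" "card Q \<le> n"
      using L L.l_cosets_eq_rcosets by (auto simp: Q_def fin_index_normals_def)
    then obtain \<iota> where \<iota>: "\<iota> ` Q \<subseteq> {..<n}" "inj_on \<iota> Q"
      using card_le_inj[of Q "{..<n}"] by auto
    have lcos: "g <#\<^bsub>F2\<^esub> (h <#\<^bsub>F2\<^esub> L) = (g \<ast> h) <#\<^bsub>F2\<^esub> L"
      if "g \<in> carrier F2" "h \<in> carrier F2" for g h
      using F2.lcos_m_assoc[OF L.subset that] .
    have LQ: "L \<in> Q" using F2.lcos_mult_one[OF L.subset] F2.one_closed by (force simp: Q_def)
    have mQ: "g <#\<^bsub>F2\<^esub> C \<in> Q" if "g \<in> carrier F2" "C \<in> Q" for g C
      using that by (auto simp: Q_def lcos)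
    \<comment> \<open>The action on cosets, transported to labels by \<open>\<iota>\<close>. Labels
      outside the image are fixed, and restriction puts \<open>A\<close> into a finite space of
      extensional functions.\<close>
    define A where "A = (\<lambda>l\<in>?S. \<lambda>j\<in>{..<n}. if j \<in> \<iota> ` Q then \<iota> ([l] <#\<^bsub>F2\<^esub> inv_into Q \<iota> j) else j)"
    have A: "A \<in> ?S \<rightarrow>\<^sub>E ({..<n} \<rightarrow>\<^sub>E {..<n})"
      unfolding A_def
    proof (intro restrict_PiE_iff[THEN iffD2] ballI)
      fix l j assume l: "l \<in> ?S" and j: "j \<in> {..<n}"
      show "(if j \<in> \<iota> ` Q then \<iota> ([l] <#\<^bsub>F2\<^esub> inv_into Q \<iota> j) else j) \<in> {..<n}"
        using j \<iota>(1) mQ[OF letter_carrier_F2[OF l] inv_into_into[of j \<iota> Q]] by (auto simp: image_subset_iff)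
    qed
    have foldr_A: "foldr A w (\<iota> C) = \<iota> (w <#\<^bsub>F2\<^esub> C) \<and> w <#\<^bsub>F2\<^esub> C \<in> Q" if w: "w \<in> carrier F2" and C: "C \<in> Q" for w C
      using w
    proof (induction w)
      case Nil
      obtain g where "g \<in> carrier F2" "C = g <#\<^bsub>F2\<^esub> L" using C by (auto simp: Q_def)
      then have "[] <#\<^bsub>F2\<^esub> C = C" using lcos[OF F2.one_closed, of g] by (simp add: one_F2[symmetric])
      then show ?case using C by simp
    next
      case (Cons l w)
      have lw: "[l] \<in> carrier F2" "w \<in> carrier F2" "[l] \<ast> w = l # w"
        using carrier_F2_append[of "[l]" w] Cons.prems by auto
      have l: "l \<in> ?S" using Cons.prems by (auto simp: carrier_F2)
      obtain g where g: "g \<in> carrier F2" "C = g <#\<^bsub>F2\<^esub> L" using C by (auto simp: Q_def)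
      have IH: "foldr A w (\<iota> C) = \<iota> (w <#\<^bsub>F2\<^esub> C)" "w <#\<^bsub>F2\<^esub> C \<in> Q" using Cons.IH[OF lw(2)] by auto
      have "A l (\<iota> (w <#\<^bsub>F2\<^esub> C)) = \<iota> ([l] <#\<^bsub>F2\<^esub> (w <#\<^bsub>F2\<^esub> C))"
        using l IH(2) \<iota> by (auto simp: A_def)
      also have "[l] <#\<^bsub>F2\<^esub> (w <#\<^bsub>F2\<^esub> C) = (l # w) <#\<^bsub>F2\<^esub> C"
        using g lw F2.m_assoc[OF lw(1,2) g(1)] Cons.prems by (simp add: lcos)
      finally show ?case using IH(1) mQ[OF Cons.prems C] by simp
    qed
    have eq: "L = {w \<in> carrier F2. foldr A w (\<iota> L) = \<iota> L}"
    proof -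
      have "w \<in> L \<longleftrightarrow> foldr A w (\<iota> L) = \<iota> L" if w: "w \<in> carrier F2" for w
      proof -
        have "foldr A w (\<iota> L) = \<iota> L \<longleftrightarrow> w <#\<^bsub>F2\<^esub> L = L"
          using foldr_A[OF w LQ] \<iota>(2) LQ by (metis inj_on_eq_iff)
        also have "\<dots> \<longleftrightarrow> w <#\<^bsub>F2\<^esub> L = \<one>\<^bsub>F2\<^esub> <#\<^bsub>F2\<^esub> L"
          using F2.lcos_mult_one[OF L.subset] by simp
        also have "\<dots> \<longleftrightarrow> w \<in> L"
          using F2.l_coset_eq_iff[OF L.is_subgroup w F2.one_closed] w by simp
        finally show ?thesis by simp
      qed
      then show ?thesis using L.subset by blast
    qed
    have "(A, \<iota> L) \<in> W" using A \<iota>(1) LQ by (auto simp: W_def)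
    moreover have "L = (case (A, \<iota> L) of (A, i) \<Rightarrow> {w \<in> carrier F2. foldr A w i = i})"
      unfolding prod.case by (rule eq)
    ultimately show ?thesis by (rule image_eqI[rotated])
  qed
  then have "{L \<in> fin_index_normals F2. card (rcosets\<^bsub>F2\<^esub> L) \<le> n}
      \<subseteq> (\<lambda>(A, i). {w \<in> carrier F2. foldr A w i = i}) ` W" by blast
  then show ?thesis using \<open>finite W\<close> by (meson finite_imageI finite_subset)
qed

interpretation F2: finitely_many_small_index F2
  by unfold_locales (rule F2_finite_small_index)

theorem F2_congruence_subgroup_property:
  assumes N: "N \<in> fin_index_normals (AutoGroup F2)"
  obtains K where "K \<in> fin_index_normals F2" "congruence_subgroup F2 K \<subseteq> N"
proof -
  interpret N: normal N "AutoGroup F2" using N by (simp add: fin_index_normals_def)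
  define N0 where "N0 = {h \<in> carrier F2. conj_aut F2 h \<in> N}"
  have "N0 \<in> fin_index_normals F2"
    unfolding N0_def by (rule F2.fin_index_normals_preimage[OF F2.inner_hom A2.is_group N])
  then obtain K1 where K1: "K1 \<in> fin_index_normals F2"
    and central: "\<And>h. \<lbrakk>h \<in> carrier F2;
       \<And>a. a \<in> {1, 2} \<Longrightarrow> h \<ast> gen a \<ast> \<inverse> h \<ast> \<inverse> gen a \<in> K1\<rbrakk> \<Longrightarrow> h \<in> N0"
    using exists_cover_central_trivial[of N0 1] by (metis zero_less_one)
  \<comment> \<open>Requiring \<open>Theta g \<in> C\<close> in \<open>N1\<close> ensures that
    \<open>Theta g\<close> is trivial modulo \<open>core K1\<close>; a congruence for the product
    then descends to the inner factor.\<close>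
  define C where "C = congruence_subgroup F2 (F2.core K1)"
  have C: "C \<in> fin_index_normals (AutoGroup F2)"
    unfolding C_def by (rule F2.congruence_subgroup_fin_index[OF K1])
  interpret C: normal C "AutoGroup F2" using C by (simp add: fin_index_normals_def)
  define N1 where "N1 = {g \<in> carrier F2. Theta g \<in> N \<inter> C}"
  have "N1 \<in> fin_index_normals F2"
    unfolding N1_def
    by (rule F2.fin_index_normals_preimage[OF Theta_hom A2.is_group A2.fin_index_normals_Int[OF N C]])
  then obtain K2 where K2: "K2 \<in> fin_index_normals F2"
    and detect: "\<And>h g. \<lbrakk>h \<in> carrier F2; g \<in> carrier F2;
       \<And>w. w \<in> carrier F2 \<Longrightarrow> conj_aut F2 h (Theta g w) \<ast> \<inverse> w \<in> K2\<rbrakk> \<Longrightarrow> g \<in> N1"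
    using exists_action_detecting_Theta by metis
  \<comment> \<open>\<open>K2\<close> recovers \<open>g\<close>, level four provides the
    decomposition into \<open>h\<close> and \<open>g\<close>, and \<open>core K1\<close> places
    \<open>\<phi>\<close> in \<open>C\<close>.\<close>
  define K where "K = K2 \<inter> (expo_kernel 4 \<inter> F2.core K1)"
  have "K \<in> fin_index_normals F2"
    unfolding K_def by (intro F2.fin_index_normals_Int K2 expo_kernel_fin_index F2.core_fin_index K1) simp
  moreover have "congruence_subgroup F2 K \<subseteq> N"
  proof
    fix \<phi> assume \<phi>K: "\<phi> \<in> congruence_subgroup F2 K"
    then have \<phi>: "\<phi> \<in> auto F2" and cong: "\<And>w. w \<in> carrier F2 \<Longrightarrow> \<phi> w \<ast> \<inverse> w \<in> K"
      by (simp_all add: congruence_subgroup_def)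
    have "\<phi> \<in> inner_Theta"
      by (rule level_four_inner_Theta[OF \<phi>]) (use cong in \<open>auto simp: K_def\<close>)
    then obtain h g where hg: "\<phi> = conj_aut F2 h \<star> Theta g" "h \<in> carrier F2" "g \<in> carrier F2"
      by (auto simp: inner_Theta_def)
    have "g \<in> N1"
    proof (rule detect[OF hg(2,3)])
      fix w assume w: "w \<in> carrier F2"
      then have "\<phi> w = conj_aut F2 h (Theta g w)"
        using hg by (simp add: mult_AutoGroup_apply)
      then show "conj_aut F2 h (Theta g w) \<ast> \<inverse> w \<in> K2"
        using cong[OF w] by (simp add: K_def)
    qed
    then have TN: "Theta g \<in> N" and TC: "Theta g \<in> C" by (simp_all add: N1_def)
    have "\<phi> \<in> C" using \<phi> cong by (auto simp: C_def congruence_subgroup_def K_def)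
    moreover have inn: "conj_aut F2 h = \<phi> \<star> inv\<^bsub>AutoGroup F2\<^esub> Theta g"
      using hg A2.inv_solve_right[of "conj_aut F2 h" \<phi> "Theta g"] by simp
    ultimately have hC: "conj_aut F2 h \<in> C" using C.m_closed C.m_inv_closed[OF TC] by metis
    have "h \<in> N0"
    proof (rule central[OF hg(2)])
      fix a :: nat assume a: "a \<in> {1, 2}"
      then have "conj_aut F2 h (gen a) \<ast> \<inverse> gen a \<in> F2.core K1"
        using hC gen_carrier'[OF a] by (simp add: C_def congruence_subgroup_def)
      then show "h \<ast> gen a \<ast> \<inverse> h \<ast> \<inverse> gen a \<in> K1"
        using F2.core_subset[OF K1] gen_carrier'[OF a] by (auto simp: conj_aut_def)
    qed
    then have "conj_aut F2 h \<in> N" by (simp add: N0_def)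
    then show "\<phi> \<in> N" using TN hg N.m_closed by simp
  qed
  ultimately show thesis using that by blast
qed

section \<open>Profinite completions\<close>

lemma fin_index_normalsD:
  "N \<in> fin_index_normals G \<Longrightarrow> N \<lhd> G" "N \<in> fin_index_normals G \<Longrightarrow> finite (rcosets\<^bsub>G\<^esub> N)"
  by (simp_all add: fin_index_normals_def)

lemma carrier_profinite_completion:
  "x \<in> carrier (profinite_completion G) \<longleftrightarrow>
     x \<in> extensional (fin_index_normals G) \<and> (\<forall>N\<in>fin_index_normals G. x N \<in> rcosets\<^bsub>G\<^esub> N) \<and>
     (\<forall>M\<in>fin_index_normals G. \<forall>N\<in>fin_index_normals G. M \<subseteq> N \<longrightarrow> x M \<subseteq> x N)"
  by (auto simp: profinite_completion_def PiE_iff FactGroup_def)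

lemma mult_profinite_completion:
  "x \<otimes>\<^bsub>profinite_completion G\<^esub> y = (\<lambda>N\<in>fin_index_normals G. x N <#>\<^bsub>G\<^esub> y N)"
  by (simp add: profinite_completion_def product_group_def)

lemma one_profinite_completion:
  "\<one>\<^bsub>profinite_completion G\<^esub> = (\<lambda>N\<in>fin_index_normals G. N)"
  by (simp add: profinite_completion_def product_group_def)

context group
begin

abbreviation completion where "completion \<equiv> profinite_completion G"

lemma completion_eqI:
  assumes "x \<in> carrier completion" "y \<in> carrier completion" "\<And>N. N \<in> fin_index_normals G \<Longrightarrow> x N = y N"
  shows "x = y"
  using assms by (auto simp: carrier_profinite_completion intro: extensionalityI)

text \<open>Coordinates are handled through arbitrary representatives, since any member of a coset
  names it.\<close>

lemma completion_mem:
  assumes x: "x \<in> carrier completion" and N: "N \<in> fin_index_normals G" and g: "g \<in> x N"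
  shows "g \<in> carrier G" "x N = N #> g"
proof -
  interpret N: normal N G using N by (rule fin_index_normalsD)
  obtain h where h: "h \<in> carrier G" "x N = N #> h"
    using x N by (auto simp: carrier_profinite_completion RCOSETS_def)
  show "g \<in> carrier G" using g h N.rcosets_carrier[OF is_group] N.subset rcosetsI by blast
  show "x N = N #> g" using g h repr_independence[OF _ h(1) N.is_subgroup] by simp
qed

lemma completion_nonempty:
  assumes x: "x \<in> carrier completion" and N: "N \<in> fin_index_normals G"
  obtains g where "g \<in> x N"
proof -
  interpret N: normal N G using N by (rule fin_index_normalsD)
  obtain h where h: "h \<in> carrier G" "x N = N #> h"
    using x N by (auto simp: carrier_profinite_completion RCOSETS_def)
  then show thesis using that rcos_self[OF h(1) N.is_subgroup] by simp
qed

lemma completion_mono: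
  "\<lbrakk>x \<in> carrier completion; M \<in> fin_index_normals G; N \<in> fin_index_normals G; M \<subseteq> N; g \<in> x M\<rbrakk> \<Longrightarrow> g \<in> x N"
  unfolding carrier_profinite_completion by blast

lemma completion_mult_mem:
  assumes "N \<in> fin_index_normals G" "g \<in> x N" "h \<in> y N"
  shows "g \<otimes> h \<in> (x \<otimes>\<^bsub>completion\<^esub> y) N"
  using assms by (auto simp: mult_profinite_completion set_mult_def)

lemma group_completion: "group completion"
proof -
  have G: "group (G Mod N)" if "N \<in> fin_index_normals G" for N
    using that by (intro normal.factorgroup_is_group fin_index_normalsD)
  let ?P = "product_group (fin_index_normals G) (\<lambda>N. G Mod N)"
  interpret P: group ?P using G by simp
  have cP: "x \<in> carrier ?P \<longleftrightarrow> x \<in> extensional (fin_index_normals G) \<and> (\<forall>N\<in>fin_index_normals G. x N \<in> rcosets N)" for x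
    by (auto simp: PiE_iff FactGroup_def)
  have sub: "x \<in> carrier ?P" if "x \<in> carrier completion" for x
    using that unfolding cP carrier_profinite_completion by blast
  have "subgroup (carrier completion) ?P"
  proof (rule P.subgroupI)
    show "carrier completion \<subseteq> carrier ?P" using sub by blast
    have "\<one>\<^bsub>?P\<^esub> \<in> carrier completion"
    proof -
      have "N \<in> rcosets N" if "N \<in> fin_index_normals G" for N
        using that normal.axioms(1)[OF fin_index_normalsD(1)] subgroup.subgroup_in_rcosets[OF _ is_group] by blast
      then show ?thesis by (auto simp: carrier_profinite_completion)
    qed
    then show "carrier completion \<noteq> {}" by blast
    fix x assume x: "x \<in> carrier completion"
    note xP = sub[OF x]
    have inv_x: "(inv\<^bsub>?P\<^esub> x) N = inv\<^bsub>G Mod N\<^esub> (x N)" if "N \<in> fin_index_normals G" for N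
      using inv_product_group[of x "fin_index_normals G" "\<lambda>N. G Mod N"] xP G that by simp
    show "inv\<^bsub>?P\<^esub> x \<in> carrier completion"
      unfolding carrier_profinite_completion
    proof (intro conjI ballI impI)
      have "inv\<^bsub>?P\<^esub> x \<in> carrier ?P" using xP by (rule P.inv_closed)
      then show "inv\<^bsub>?P\<^esub> x \<in> extensional (fin_index_normals G)"
        and "\<And>N. N \<in> fin_index_normals G \<Longrightarrow> (inv\<^bsub>?P\<^esub> x) N \<in> rcosets N"
        unfolding cP by blast+
      fix M N assume MN: "M \<in> fin_index_normals G" "N \<in> fin_index_normals G" "M \<subseteq> N"
      have i: "inv\<^bsub>G Mod L\<^esub> (x L) = set_inv (x L)" if "L \<in> fin_index_normals G" for L
        using normal.inv_FactGroup[OF fin_index_normalsD(1)[OF that]] x that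
        by (simp add: carrier_profinite_completion FactGroup_def)
      show "(inv\<^bsub>?P\<^esub> x) M \<subseteq> (inv\<^bsub>?P\<^esub> x) N"
        using MN x completion_mono[OF x MN] by (auto simp: inv_x i SET_INV_def)
    qed
    fix y assume y: "y \<in> carrier completion"
    note yP = sub[OF y]
    show "x \<otimes>\<^bsub>?P\<^esub> y \<in> carrier completion"
      unfolding carrier_profinite_completion
    proof (intro conjI ballI impI)
      have "x \<otimes>\<^bsub>?P\<^esub> y \<in> carrier ?P" using xP yP by (rule P.m_closed)
      then show "x \<otimes>\<^bsub>?P\<^esub> y \<in> extensional (fin_index_normals G)"
        and "\<And>N. N \<in> fin_index_normals G \<Longrightarrow> (x \<otimes>\<^bsub>?P\<^esub> y) N \<in> rcosets N"
        unfolding cP by blast+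
      fix M N assume MN: "M \<in> fin_index_normals G" "N \<in> fin_index_normals G" "M \<subseteq> N"
      then show "(x \<otimes>\<^bsub>?P\<^esub> y) M \<subseteq> (x \<otimes>\<^bsub>?P\<^esub> y) N"
        using mono_set_mult[of "x M" "x N" "y M" "y N" G] x y by (simp add: carrier_profinite_completion)
    qed
  qed
  then have "group (?P\<lparr>carrier := carrier completion\<rparr>)" by (rule P.subgroup_imp_group)
  moreover have "?P\<lparr>carrier := carrier completion\<rparr> = completion"
    by (simp add: profinite_completion_def)
  ultimately show ?thesis by simp
qed

lemma completion_mult_coset:
  assumes x: "x \<in> carrier completion" "y \<in> carrier completion" and N: "N \<in> fin_index_normals G"
    and "g \<in> x N" "h \<in> y N"
  shows "(x \<otimes>\<^bsub>completion\<^esub> y) N = N #> (g \<otimes> h)"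
proof -
  interpret C: group completion by (rule group_completion)
  show ?thesis
    using completion_mem(2)[OF C.m_closed[OF x] N] completion_mult_mem[of N g x h y] assms by simp
qed

lemma to_completion_carrier: "g \<in> carrier G \<Longrightarrow> to_completion G g \<in> carrier completion"
  unfolding carrier_profinite_completion
  by (auto simp: to_completion_def r_coset_def intro!: rcosetsI[unfolded r_coset_def] normal_imp_subgroup[THEN subgroup.subset] fin_index_normalsD)

lemma to_completion_mem:
  assumes "g \<in> carrier G" "N \<in> fin_index_normals G"
  shows "g \<in> to_completion G g N"
  using assms rcos_self[OF assms(1) normal_imp_subgroup[OF fin_index_normalsD(1)]] by (simp add: to_completion_def)

lemma to_completion_mult:
  assumes "g \<in> carrier G" "h \<in> carrier G"
  shows "to_completion G (g \<otimes> h) = to_completion G g \<otimes>\<^bsub>completion\<^esub> to_completion G h"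
proof (rule completion_eqI)
  interpret C: group completion by (rule group_completion)
  show "to_completion G (g \<otimes> h) \<in> carrier completion"
    "to_completion G g \<otimes>\<^bsub>completion\<^esub> to_completion G h \<in> carrier completion"
    using assms by (auto intro: to_completion_carrier C.m_closed)
  fix N assume N: "N \<in> fin_index_normals G"
  have "(to_completion G g \<otimes>\<^bsub>completion\<^esub> to_completion G h) N = N #> (g \<otimes> h)"
    by (rule completion_mult_coset[OF to_completion_carrier[OF assms(1)] to_completion_carrier[OF assms(2)] N
        to_completion_mem[OF assms(1) N] to_completion_mem[OF assms(2) N]])
  moreover have "to_completion G (g \<otimes> h) N = N #> (g \<otimes> h)"
    using N by (simp add: to_completion_def)
  ultimately show "to_completion G (g \<otimes> h) N = (to_completion G g \<otimes>\<^bsub>completion\<^esub> to_completion G h) N"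
    by simp
qed

section \<open>The topology of the completion\<close>

lemma topspace_profinite: "topspace (profinite_topology G) = carrier completion"
proof -
  have "carrier completion \<subseteq> (\<Pi>\<^sub>E N\<in>fin_index_normals G. carrier (G Mod N))"
    by (auto simp: profinite_completion_def)
  then show ?thesis by (auto simp: profinite_topology_def topspace_subtopology)
qed

text \<open>A basic open set constrains finitely many coordinates, and for compatible families these
  are all determined by the coordinate at the intersection. So one coordinate suffices.\<close>

lemma openin_profinite_iff:
  "openin (profinite_topology G) U \<longleftrightarrow> U \<subseteq> carrier completion \<and>
     (\<forall>x\<in>U. \<exists>N\<in>fin_index_normals G. \<forall>y\<in>carrier completion. y N = x N \<longrightarrow> y \<in> U)"
  (is "?L \<longleftrightarrow> ?R")
proof
  assume L: ?L
  let ?P = "product_topology (\<lambda>N. discrete_topology (carrier (G Mod N))) (fin_index_normals G)"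
  obtain T where T: "openin ?P T" "U = T \<inter> carrier completion"
    using L by (auto simp: profinite_topology_def openin_subtopology)
  have "\<exists>N\<in>fin_index_normals G. \<forall>y\<in>carrier completion. y N = x N \<longrightarrow> y \<in> U" if x: "x \<in> U" for x
  proof -
    have "x \<in> T" using T x by blast
    from bspec[OF T(1)[unfolded openin_product_topology_alt] this]
    obtain V where V: "x \<in> Pi\<^sub>E (fin_index_normals G) V"
        "finite {N \<in> fin_index_normals G. V N \<noteq> topspace (discrete_topology (carrier (G Mod N)))}"
        "Pi\<^sub>E (fin_index_normals G) V \<subseteq> T"
      by blast
    \<comment> \<open>Inserting \<open>carrier G\<close> keeps the family nonempty when no
      coordinate is constrained.\<close>
    let ?F = "insert (carrier G) {N \<in> fin_index_normals G. V N \<noteq> carrier (G Mod N)}"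
    have M: "\<Inter>?F \<in> fin_index_normals G"
      by (rule fin_index_normals_INT) (use V(2) fin_index_normals_carrier in auto)
    have "y \<in> U" if y: "y \<in> carrier completion" "y (\<Inter>?F) = x (\<Inter>?F)" for y
    proof -
      have xc: "x \<in> carrier completion" using x T by blast
      have "y N \<in> V N" if N: "N \<in> fin_index_normals G" for N
      proof (cases "V N = carrier (G Mod N)")
        case True
        then show ?thesis using y(1) N by (simp add: carrier_profinite_completion FactGroup_def)
      next
        case False
        then have sub: "\<Inter>?F \<subseteq> N" using N by blast
        obtain g where g: "g \<in> x (\<Inter>?F)" using completion_nonempty[OF xc M] .
        have "y N = N #> g" "x N = N #> g"
          using completion_mem(2)[OF y(1) N] completion_mem(2)[OF xc N]
            completion_mono[OF y(1) M N sub] completion_mono[OF xc M N sub g] g y(2) by auto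
        then show ?thesis using V(1) N by (auto simp: PiE_iff)
      qed
      then have "y \<in> Pi\<^sub>E (fin_index_normals G) V"
        using y(1) by (auto simp: PiE_iff carrier_profinite_completion)
      then show ?thesis using V(3) T(2) y(1) by blast
    qed
    then show ?thesis using M by blast
  qed
  moreover have "U \<subseteq> carrier completion" using T by blast
  ultimately show ?R by blast
next
  assume R: ?R
  have basic: "openin (profinite_topology G) {y \<in> carrier completion. y N = C}"
    if N: "N \<in> fin_index_normals G" and C: "C \<in> rcosets N" for N C
  proof -
    let ?P = "product_topology (\<lambda>N. discrete_topology (carrier (G Mod N))) (fin_index_normals G)"
    have "openin ?P {y \<in> topspace ?P. y N \<in> {C}}"
      using C by (intro openin_continuous_map_preimage[OF continuous_map_product_projection[OF N]])
        (simp add: FactGroup_def)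
    moreover have "{y \<in> carrier completion. y N = C} = {y \<in> topspace ?P. y N \<in> {C}} \<inter> carrier completion"
      by (auto simp: profinite_completion_def)
    ultimately show ?thesis unfolding profinite_topology_def openin_subtopology by blast
  qed
  show ?L
  proof (subst openin_subopen, intro ballI)
    fix x assume x: "x \<in> U"
    then obtain N where N: "N \<in> fin_index_normals G" "\<forall>y\<in>carrier completion. y N = x N \<longrightarrow> y \<in> U"
      using R by blast
    have xc: "x \<in> carrier completion" using x R by blast
    then have "x N \<in> rcosets N" using N(1) by (simp add: carrier_profinite_completion)
    then show "\<exists>T. openin (profinite_topology G) T \<and> x \<in> T \<and> T \<subseteq> U"
      using basic[OF N(1)] N(2) xc by (intro exI[of _ "{y \<in> carrier completion. y N = x N}"]) auto
  qed
qed

lemma Hausdorff_profinite: "Hausdorff_space (profinite_topology G)"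
  unfolding profinite_topology_def
  by (intro Hausdorff_space_subtopology) (simp add: Hausdorff_space_product_topology)

lemma to_completion_dense:
  assumes x: "x \<in> carrier completion"
  shows "x \<in> profinite_topology G closure_of (to_completion G ` carrier G)"
  unfolding in_closure_of topspace_profinite
proof (intro conjI x allI impI, elim conjE)
  fix T assume T: "x \<in> T" "openin (profinite_topology G) T"
  then obtain N where N: "N \<in> fin_index_normals G" "\<forall>y\<in>carrier completion. y N = x N \<longrightarrow> y \<in> T"
    unfolding openin_profinite_iff by blast
  obtain g where g: "g \<in> x N" using completion_nonempty[OF x N(1)] .
  have "to_completion G g \<in> T"
    using N completion_mem[OF x N(1) g] to_completion_carrier by (simp add: to_completion_def)
  then show "\<exists>y. y \<in> to_completion G ` carrier G \<and> y \<in> T"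
    using completion_mem(1)[OF x N(1) g] by blast
qed

text \<open>The image of \<open>G\<close> is dense and \<open>T\<close> is Hausdorff, so continuous
  extensions are unique. The definite description is thereby replaced by a check on a
  candidate.\<close>

lemma completion_lift_eqI:
  assumes T: "Hausdorff_space T"
    and F: "F \<in> hom completion H" "F \<in> extensional (carrier completion)"
      "continuous_map (profinite_topology G) T F" "\<And>g. g \<in> carrier G \<Longrightarrow> F (to_completion G g) = f g"
  shows "completion_lift G H T f = F"
  unfolding completion_lift_def
proof (rule the_equality)
  show "F \<in> hom completion H \<and> F \<in> extensional (carrier completion) \<and>
    continuous_map (profinite_topology G) T F \<and> (\<forall>g\<in>carrier G. F (to_completion G g) = f g)"
    using F by blast
  fix F' assume F': "F' \<in> hom completion H \<and> F' \<in> extensional (carrier completion) \<and>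
    continuous_map (profinite_topology G) T F' \<and> (\<forall>g\<in>carrier G. F' (to_completion G g) = f g)"
  show "F' = F"
  proof (rule extensionalityI)
    fix x assume "x \<in> carrier completion"
    then show "F' x = F x"
      by (rule forall_in_closure_of_eq[OF to_completion_dense T]) (use F F' in auto)
  qed (use F F' in auto)
qed

end

section \<open>The action of the completed automorphism group\<close>

context finitely_many_small_index
begin

interpretation A: group "AutoGroup G"
  by (rule AutoGroup)

text \<open>Changing \<open>g\<close> within its coset of \<open>K\<close>, or \<open>\<phi>\<close>
  within its congruence class, alters the image by an element of \<open>K\<close>.\<close>

lemma completion_action_independent:
  assumes K: "normal K G" "\<And>\<phi> k. \<lbrakk>\<phi> \<in> auto G; k \<in> K\<rbrakk> \<Longrightarrow> \<phi> k \<in> K" and N: "normal N G" "K \<subseteq> N"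
    and \<phi>: "\<phi> \<in> auto G" "\<psi> \<in> auto G" "\<psi> \<in> congruence_subgroup G K #>\<^bsub>AutoGroup G\<^esub> \<phi>"
    and g: "g \<in> carrier G" "h \<in> K #> g"
  shows "N #> \<psi> h = N #> \<phi> g"
proof -
  interpret K: normal K G by (rule K)
  interpret N: normal N G by (rule N)
  obtain k where k: "k \<in> K" "h = k \<otimes> g" using g by (auto simp: r_coset_def)
  obtain \<gamma> where \<gamma>: "\<gamma> \<in> congruence_subgroup G K" "\<psi> = \<gamma> \<otimes>\<^bsub>AutoGroup G\<^esub> \<phi>"
    using \<phi>(3) by (auto simp: r_coset_def)
  have \<gamma>a: "\<gamma> \<in> auto G" using \<gamma> by (simp add: congruence_subgroup_def)
  note c = auto_closed[OF \<phi>(1) g(1)]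
  have hc: "h \<in> carrier G" using k g by simp
  have "\<psi> h = \<psi> k \<otimes> \<gamma> (\<phi> g)"
    using k g \<gamma> \<gamma>a \<phi>(1,2) auto_mult[OF \<phi>(2)] by (simp add: mult_AutoGroup_apply)
  also have "\<dots> = (\<psi> k \<otimes> (\<gamma> (\<phi> g) \<otimes> inv (\<phi> g))) \<otimes> \<phi> g"
    using c auto_closed[OF \<gamma>a c] auto_closed[OF \<phi>(2) K.mem_carrier[OF k(1)]] by (simp add: m_assoc)
  finally have eq: "\<psi> h = (\<psi> k \<otimes> (\<gamma> (\<phi> g) \<otimes> inv (\<phi> g))) \<otimes> \<phi> g" .
  have "\<psi> k \<otimes> (\<gamma> (\<phi> g) \<otimes> inv (\<phi> g)) \<in> N"
    using K(2)[OF \<phi>(2) k(1)] \<gamma>(1) c N(2) by (auto simp: congruence_subgroup_def)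
  then have "\<psi> h \<in> N #> \<phi> g" unfolding eq r_coset_def by blast
  then show ?thesis using repr_independence[OF _ c N.is_subgroup] by simp
qed

abbreviation congruence_core :: "'a set \<Rightarrow> ('a \<Rightarrow> 'a) set" where
  "congruence_core N \<equiv> congruence_subgroup G (core N)"

text \<open>The coordinate at \<open>N\<close> is read off at the level of \<open>core N\<close>,
  whose cosets are permuted by all automorphisms. The value is independent of both choices by
  \<open>completion_action_eq\<close>.\<close>

definition completion_action ::
    "(('a \<Rightarrow> 'a) set \<Rightarrow> ('a \<Rightarrow> 'a) set) \<Rightarrow> ('a set \<Rightarrow> 'a set) \<Rightarrow> ('a set \<Rightarrow> 'a set)" where
  "completion_action x = (\<lambda>y\<in>carrier completion. \<lambda>N\<in>fin_index_normals G.
     N #> (SOME \<phi>. \<phi> \<in> x (congruence_core N)) (SOME g. g \<in> y (core N)))"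

lemma auto_completion_mem:
  assumes "x \<in> carrier A.completion" "N \<in> fin_index_normals G" "\<phi> \<in> x (congruence_core N)"
  shows "\<phi> \<in> auto G"
  using A.completion_mem(1)[OF assms(1) congruence_subgroup_fin_index[OF assms(2)] assms(3)] by simp

lemma congruence_subgroup_mono: "K \<subseteq> L \<Longrightarrow> congruence_subgroup G K \<subseteq> congruence_subgroup G L"
  by (auto simp: congruence_subgroup_def)

text \<open>Two levels are compared through a third below both. The freedom in \<open>M\<close>
  allows the coordinate at \<open>core N\<close> to be computed from representatives chosen for
  \<open>N\<close>.\<close>

lemma completion_action_eq:
  assumes x: "x \<in> carrier A.completion" and y: "y \<in> carrier completion"
    and N: "N \<in> fin_index_normals G" and M: "M \<in> fin_index_normals G" "core M \<subseteq> N"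
    and \<phi>: "\<phi> \<in> x (congruence_core M)" and g: "g \<in> y (core M)"
  shows "completion_action x y N = N #> \<phi> g"
proof -
  have indep: "N #> \<psi> h = N #> \<phi> g"
    if M: "M \<in> fin_index_normals G" "core M \<subseteq> N" and L: "L \<in> fin_index_normals G" "L \<subseteq> core M"
      and \<phi>: "\<phi> \<in> x (congruence_core M)" and g: "g \<in> y (core M)"
      and \<psi>: "\<psi> \<in> x (congruence_core L)" and h: "h \<in> y (core L)" for L M \<phi> g \<psi> h
  proof -
    have sub: "core L \<subseteq> core M" using core_subset[OF L(1)] L(2) by blast
    note cM = congruence_subgroup_fin_index[OF M(1)] and cL = congruence_subgroup_fin_index[OF L(1)]
    have \<phi>': "\<phi> \<in> auto G" "\<psi> \<in> auto G"
      using auto_completion_mem[OF x M(1) \<phi>] auto_completion_mem[OF x L(1) \<psi>] by auto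
    have "\<psi> \<in> x (congruence_core M)"
      using A.completion_mono[OF x cL cM congruence_subgroup_mono[OF sub] \<psi>] .
    then have "\<psi> \<in> congruence_core M #>\<^bsub>AutoGroup G\<^esub> \<phi>" using A.completion_mem(2)[OF x cM \<phi>] by simp
    moreover have "h \<in> core M #> g"
      using completion_mono[OF y core_fin_index[OF L(1)] core_fin_index[OF M(1)] sub h]
        completion_mem(2)[OF y core_fin_index[OF M(1)] g] by simp
    ultimately show ?thesis
      using completion_action_independent[where K = "core M" and N = N and \<phi> = \<phi> and \<psi> = \<psi> and g = g and h = h]
        fin_index_normalsD(1)[OF core_fin_index[OF M(1)]] auto_core[OF M(1)]
        fin_index_normalsD(1)[OF N] M(2) \<phi>' completion_mem(1)[OF y core_fin_index[OF M(1)] g] by simp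
  qed
  let ?\<phi> = "SOME \<phi>. \<phi> \<in> x (congruence_core N)" and ?g = "SOME g. g \<in> y (core N)"
  have \<phi>0: "?\<phi> \<in> x (congruence_core N)"
    using A.completion_nonempty[OF x congruence_subgroup_fin_index[OF N]] by (metis someI_ex)
  have g0: "?g \<in> y (core N)"
    using completion_nonempty[OF y core_fin_index[OF N]] by (metis someI_ex)
  define L where "L = core M \<inter> core N"
  have L: "L \<in> fin_index_normals G" unfolding L_def by (intro fin_index_normals_Int core_fin_index M N)
  obtain \<psi> where \<psi>: "\<psi> \<in> x (congruence_core L)"
    using A.completion_nonempty[OF x congruence_subgroup_fin_index[OF L]] .
  obtain h where h: "h \<in> y (core L)" using completion_nonempty[OF y core_fin_index[OF L]] .
  have "N #> \<psi> h = N #> \<phi> g" by (rule indep[OF M L _ \<phi> g \<psi> h]) (simp add: L_def)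
  moreover have "N #> \<psi> h = N #> ?\<phi> ?g"
    by (rule indep[OF N core_subset[OF N] L _ \<phi>0 g0 \<psi> h]) (simp add: L_def)
  ultimately show ?thesis using y N by (simp add: completion_action_def)
qed

lemma completion_representatives:
  assumes x: "x \<in> carrier A.completion" and y: "y \<in> carrier completion" and N: "N \<in> fin_index_normals G"
  obtains \<phi> g where "\<phi> \<in> x (congruence_core N)" "g \<in> y (core N)" "\<phi> \<in> auto G" "g \<in> carrier G"
proof -
  obtain \<phi> where \<phi>: "\<phi> \<in> x (congruence_core N)"
    using A.completion_nonempty[OF x congruence_subgroup_fin_index[OF N]] .
  obtain g where g: "g \<in> y (core N)" using completion_nonempty[OF y core_fin_index[OF N]] .
  show thesis
    using that[OF \<phi> g auto_completion_mem[OF x N \<phi>] completion_mem(1)[OF y core_fin_index[OF N] g]] .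
qed

lemma completion_action_closed:
  assumes x: "x \<in> carrier A.completion" and y: "y \<in> carrier completion"
  shows "completion_action x y \<in> carrier completion"
  unfolding carrier_profinite_completion
proof (intro conjI ballI impI)
  show "completion_action x y \<in> extensional (fin_index_normals G)"
    using y by (simp add: completion_action_def)
  fix N assume N: "N \<in> fin_index_normals G"
  obtain \<phi> g where \<phi>: "\<phi> \<in> x (congruence_core N)" "g \<in> y (core N)" "\<phi> \<in> auto G" "g \<in> carrier G"
    using completion_representatives[OF x y N] .
  have "N \<subseteq> carrier G"
    by (rule subgroup.subset[OF normal_imp_subgroup[OF fin_index_normalsD(1)[OF N]]])
  then have "N #> \<phi> g \<in> rcosets N" by (rule rcosetsI[OF _ auto_closed[OF \<phi>(3,4)]])
  then show "completion_action x y N \<in> rcosets N"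
    using completion_action_eq[where x = x and y = y, OF x y N N core_subset[OF N] \<phi>(1,2)] by simp
next
  fix M N assume M: "M \<in> fin_index_normals G" and N: "N \<in> fin_index_normals G" and MN: "M \<subseteq> N"
  obtain \<phi> g where \<phi>: "\<phi> \<in> x (congruence_core M)" "g \<in> y (core M)" "\<phi> \<in> auto G" "g \<in> carrier G"
    using completion_representatives[OF x y M] .
  have "core M \<subseteq> N" using core_subset[OF M] MN by blast
  then show "completion_action x y M \<subseteq> completion_action x y N"
    using completion_action_eq[where x = x and y = y, OF x y M M core_subset[OF M] \<phi>(1,2)] completion_action_eq[where x = x and y = y, OF x y N M _ \<phi>(1,2)] MN
    by (auto simp: r_coset_def)
qed

interpretation C: group completion by (rule group_completion)
interpretation AC: group A.completion by (rule A.group_completion)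

lemma completion_action_mult:
  assumes x: "x \<in> carrier A.completion" and y: "y \<in> carrier completion" "z \<in> carrier completion"
  shows "completion_action x (y \<otimes>\<^bsub>completion\<^esub> z) = completion_action x y \<otimes>\<^bsub>completion\<^esub> completion_action x z"
proof (rule completion_eqI)
  show "completion_action x (y \<otimes>\<^bsub>completion\<^esub> z) \<in> carrier completion"
    "completion_action x y \<otimes>\<^bsub>completion\<^esub> completion_action x z \<in> carrier completion"
    using completion_action_closed[OF x] y by simp_all
  fix N assume N: "N \<in> fin_index_normals G"
  interpret N: normal N G using N by (rule fin_index_normalsD)
  obtain \<phi> g where \<phi>: "\<phi> \<in> x (congruence_core N)" "g \<in> y (core N)" "\<phi> \<in> auto G" "g \<in> carrier G"
    using completion_representatives[OF x y(1) N] .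
  obtain h where h: "h \<in> z (core N)" "h \<in> carrier G"
    using completion_representatives[OF x y(2) N] by metis
  note e = completion_action_eq[where x = x and \<phi> = \<phi>, OF x _ N N core_subset[OF N] \<phi>(1)]
  have "completion_action x (y \<otimes>\<^bsub>completion\<^esub> z) N = N #> \<phi> (g \<otimes> h)"
    by (rule e) (use y completion_mult_mem[where x = y and y = z, OF core_fin_index[OF N] \<phi>(2) h(1)] in auto)
  also have "\<dots> = (N #> \<phi> g) <#> (N #> \<phi> h)"
    using \<phi> h auto_mult[OF \<phi>(3,4) h(2)] auto_closed[OF \<phi>(3)] by (simp add: N.rcos_sum)
  also have "\<dots> = (completion_action x y \<otimes>\<^bsub>completion\<^esub> completion_action x z) N"
    using e[OF y(1) \<phi>(2)] e[OF y(2) h(1)] N by (simp add: mult_profinite_completion)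
  finally show "completion_action x (y \<otimes>\<^bsub>completion\<^esub> z) N
      = (completion_action x y \<otimes>\<^bsub>completion\<^esub> completion_action x z) N" .
qed

lemma completion_action_comp:
  assumes x: "x \<in> carrier A.completion" "x' \<in> carrier A.completion" and y: "y \<in> carrier completion"
  shows "completion_action (x \<otimes>\<^bsub>A.completion\<^esub> x') y = completion_action x (completion_action x' y)"
proof (rule completion_eqI)
  have c: "x \<otimes>\<^bsub>A.completion\<^esub> x' \<in> carrier A.completion" "completion_action x' y \<in> carrier completion"
    using AC.m_closed[OF x] completion_action_closed[OF x(2) y] by simp_all
  show "completion_action (x \<otimes>\<^bsub>A.completion\<^esub> x') y \<in> carrier completion"
    "completion_action x (completion_action x' y) \<in> carrier completion"
    using completion_action_closed[OF c(1) y] completion_action_closed[OF x(1) c(2)] by simp_all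
  fix N assume N: "N \<in> fin_index_normals G"
  obtain \<phi> g where \<phi>: "\<phi> \<in> x' (congruence_core N)" "g \<in> y (core N)" "\<phi> \<in> auto G" "g \<in> carrier G"
    using completion_representatives[OF x(2) y N] .
  obtain \<psi> where \<psi>: "\<psi> \<in> x (congruence_core N)" "\<psi> \<in> auto G"
    using completion_representatives[OF x(1) y N] by metis
  have "completion_action x' y (core N) = core N #> \<phi> g"
    by (rule completion_action_eq[where x = x' and y = y, OF x(2) y core_fin_index[OF N] N subset_refl \<phi>(1,2)])
  then have m: "\<phi> g \<in> completion_action x' y (core N)"
    using rcos_self[OF auto_closed[OF \<phi>(3,4)] normal_imp_subgroup[OF fin_index_normalsD(1)[OF core_fin_index[OF N]]]] by simp
  have "completion_action x (completion_action x' y) N = N #> \<psi> (\<phi> g)"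
    by (rule completion_action_eq[where x = x, OF x(1) c(2) N N core_subset[OF N] \<psi>(1) m])
  moreover have "completion_action (x \<otimes>\<^bsub>A.completion\<^esub> x') y N = N #> (\<psi> \<otimes>\<^bsub>AutoGroup G\<^esub> \<phi>) g"
    by (rule completion_action_eq[where y = y, OF c(1) y N N core_subset[OF N] _ \<phi>(2)])
       (rule A.completion_mult_mem[where x = x and y = x', OF congruence_subgroup_fin_index[OF N] \<psi>(1) \<phi>(1)])
  ultimately show "completion_action (x \<otimes>\<^bsub>A.completion\<^esub> x') y N = completion_action x (completion_action x' y) N"
    using \<phi> \<psi> by (simp add: mult_AutoGroup_apply)
qed

lemma completion_action_trivial:
  assumes x: "x \<in> carrier A.completion" and y: "y \<in> carrier completion" and N: "N \<in> fin_index_normals G"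
    and "x (congruence_core N) = congruence_core N"
  shows "completion_action x y (core N) = y (core N)"
proof -
  obtain g where g: "g \<in> y (core N)" "g \<in> carrier G"
    using completion_representatives[OF x y N] by metis
  interpret K: normal "congruence_core N" "AutoGroup G"
    using congruence_subgroup_fin_index[OF N] by (rule fin_index_normalsD)
  have "\<one>\<^bsub>AutoGroup G\<^esub> \<in> x (congruence_core N)" using assms(4) K.one_closed by simp
  then have "completion_action x y (core N) = core N #> \<one>\<^bsub>AutoGroup G\<^esub> g"
    by (rule completion_action_eq[where x = x and y = y, OF x y core_fin_index[OF N] N subset_refl _ g(1)])
  then show ?thesis
    using g completion_mem(2)[OF y core_fin_index[OF N] g(1)] by (simp add: one_AutoGroup)
qed

lemma completion_action_one:
  assumes y: "y \<in> carrier completion"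
  shows "completion_action \<one>\<^bsub>A.completion\<^esub> y = y"
proof (rule completion_eqI)
  show "completion_action \<one>\<^bsub>A.completion\<^esub> y \<in> carrier completion"
    using completion_action_closed[OF AC.one_closed y] .
  fix N assume N: "N \<in> fin_index_normals G"
  have "\<one>\<^bsub>A.completion\<^esub> (congruence_core N) = congruence_core N"
    using congruence_subgroup_fin_index[OF N] by (simp add: one_profinite_completion)
  then have eq: "completion_action \<one>\<^bsub>A.completion\<^esub> y (core N) = y (core N)"
    by (rule completion_action_trivial[OF AC.one_closed y N])
  obtain g where g: "g \<in> y (core N)" using completion_nonempty[OF y core_fin_index[OF N]] .
  note c = completion_action_closed[OF AC.one_closed y]
  show "completion_action \<one>\<^bsub>A.completion\<^esub> y N = y N"
    using completion_mem(2)[OF y N completion_mono[OF y core_fin_index[OF N] N core_subset[OF N] g]]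
      completion_mem(2)[OF c N completion_mono[OF c core_fin_index[OF N] N core_subset[OF N]], of g] g eq by simp
qed (rule y)

text \<open>The coordinate of the image at \<open>N\<close> depends only on that of the argument at
  \<open>core N\<close>.\<close>

lemma completion_action_continuous:
  assumes x: "x \<in> carrier A.completion"
  shows "continuous_map (profinite_topology G) (profinite_topology G) (completion_action x)"
  unfolding continuous_map_def topspace_profinite
proof (intro conjI allI impI)
  show "completion_action x \<in> carrier completion \<rightarrow> carrier completion"
    using completion_action_closed[OF x] by blast
  fix U assume U: "openin (profinite_topology G) U"
  show "openin (profinite_topology G) {y \<in> carrier completion. completion_action x y \<in> U}"
    unfolding openin_profinite_iff
  proof (intro conjI ballI)
    fix y assume "y \<in> {y \<in> carrier completion. completion_action x y \<in> U}"
    then have y: "y \<in> carrier completion" "completion_action x y \<in> U" by auto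
    obtain N where N: "N \<in> fin_index_normals G"
      "\<forall>z\<in>carrier completion. z N = completion_action x y N \<longrightarrow> z \<in> U"
      using U y(2) unfolding openin_profinite_iff by blast
    have "completion_action x z \<in> U" if z: "z \<in> carrier completion" "z (core N) = y (core N)" for z
    proof -
      obtain \<phi> g where \<phi>: "\<phi> \<in> x (congruence_core N)" "g \<in> y (core N)"
        using completion_representatives[OF x y(1) N(1)] .
      have "completion_action x z N = completion_action x y N"
        using completion_action_eq[where x = x and y = y, OF x y(1) N(1) N(1) core_subset[OF N(1)] \<phi>]
          completion_action_eq[where x = x and y = z, OF x z(1) N(1) N(1) core_subset[OF N(1)] \<phi>(1)] \<phi>(2) z(2) by simp
      then show ?thesis using N(2) completion_action_closed[OF x z(1)] by blast
    qed
    then show "\<exists>N\<in>fin_index_normals G. \<forall>z\<in>carrier completion. z N = y N \<longrightarrow>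
        z \<in> {y \<in> carrier completion. completion_action x y \<in> U}"
      using core_fin_index[OF N(1)] by blast
  qed blast
qed

lemma completion_action_auto:
  assumes x: "x \<in> carrier A.completion"
  shows "completion_action x \<in> auto completion"
proof -
  have inv: "completion_action (inv\<^bsub>A.completion\<^esub> x) (completion_action x y) = y"
    "completion_action x (completion_action (inv\<^bsub>A.completion\<^esub> x) y) = y" if "y \<in> carrier completion" for y
    using completion_action_comp[of "inv\<^bsub>A.completion\<^esub> x" x y] completion_action_comp[of x "inv\<^bsub>A.completion\<^esub> x" y]
      x that completion_action_one[OF that] by simp_all
  have "bij_betw (completion_action x) (carrier completion) (carrier completion)"
    by (rule bij_betw_byWitness[where f' = "completion_action (inv\<^bsub>A.completion\<^esub> x)"])
       (use x inv completion_action_closed in auto)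
  moreover have "completion_action x \<in> hom completion completion"
    using x by (intro homI completion_action_closed completion_action_mult)
  ultimately show ?thesis by (simp add: auto_def Bij_def completion_action_def)
qed

section \<open>The action as a homomorphism to the continuous automorphisms\<close>

lemma carrier_cont_auto:
  "f \<in> carrier (cont_auto_group G) \<longleftrightarrow>
    f \<in> auto completion \<and> continuous_map (profinite_topology G) (profinite_topology G) f"
  by (simp add: cont_auto_group_def)

lemma mult_cont_auto:
  assumes "f \<in> carrier (cont_auto_group G)" "g \<in> carrier (cont_auto_group G)"
  shows "f \<otimes>\<^bsub>cont_auto_group G\<^esub> g = compose (carrier completion) f g"
  using assms by (simp add: cont_auto_group_def AutoGroup_def BijGroup_def auto_def)

lemma one_cont_auto: "\<one>\<^bsub>cont_auto_group G\<^esub> = (\<lambda>y\<in>carrier completion. y)"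
  by (simp add: cont_auto_group_def AutoGroup_def BijGroup_def)

lemma completion_action_cont_auto:
  "x \<in> carrier A.completion \<Longrightarrow> completion_action x \<in> carrier (cont_auto_group G)"
  by (simp add: carrier_cont_auto completion_action_auto completion_action_continuous)

lemma completion_action_comp_eq:
  assumes x: "x \<in> carrier A.completion" "x' \<in> carrier A.completion"
  shows "completion_action (x \<otimes>\<^bsub>A.completion\<^esub> x')
    = completion_action x \<otimes>\<^bsub>cont_auto_group G\<^esub> completion_action x'"
  unfolding mult_cont_auto[OF completion_action_cont_auto[OF x(1)] completion_action_cont_auto[OF x(2)]]
  by (rule extensionalityI[of _ "carrier completion"])
     (use x completion_action_comp in \<open>auto simp: compose_def, simp add: completion_action_def\<close>)

lemma completion_action_to_completion:
  assumes \<phi>: "\<phi> \<in> auto G" and g: "g \<in> carrier G"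
  shows "completion_action (to_completion (AutoGroup G) \<phi>) (to_completion G g) = to_completion G (\<phi> g)"
proof (rule completion_eqI)
  have c: "to_completion (AutoGroup G) \<phi> \<in> carrier A.completion" "to_completion G g \<in> carrier completion"
    using A.to_completion_carrier to_completion_carrier \<phi> g by simp_all
  show "completion_action (to_completion (AutoGroup G) \<phi>) (to_completion G g) \<in> carrier completion"
    "to_completion G (\<phi> g) \<in> carrier completion"
    using c completion_action_closed to_completion_carrier auto_closed[OF \<phi> g] by auto
  fix N assume N: "N \<in> fin_index_normals G"
  have "\<phi> \<in> to_completion (AutoGroup G) \<phi> (congruence_core N)"
    using A.to_completion_mem[OF _ congruence_subgroup_fin_index[OF N]] \<phi> by simp
  from completion_action_eq[OF c N N core_subset[OF N] this to_completion_mem[OF g core_fin_index[OF N]]]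
  show "completion_action (to_completion (AutoGroup G) \<phi>) (to_completion G g) N = to_completion G (\<phi> g) N"
    unfolding to_completion_def[of G "\<phi> g"] using N by simp
qed

lemma auto_extension_eq:
  assumes \<phi>: "\<phi> \<in> auto G"
  shows "auto_extension G \<phi> = completion_action (to_completion (AutoGroup G) \<phi>)"
  unfolding auto_extension_def
proof (rule completion_lift_eqI[OF Hausdorff_profinite])
  have c: "to_completion (AutoGroup G) \<phi> \<in> carrier A.completion"
    using A.to_completion_carrier \<phi> by simp
  show "completion_action (to_completion (AutoGroup G) \<phi>) \<in> hom completion completion"
    "completion_action (to_completion (AutoGroup G) \<phi>) \<in> extensional (carrier completion)"
    using mem_autoD[OF completion_action_auto[OF c]] by auto
  show "continuous_map (profinite_topology G) (profinite_topology G) (completion_action (to_completion (AutoGroup G) \<phi>))"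
    by (rule completion_action_continuous[OF c])
qed (rule completion_action_to_completion[OF \<phi>])

end

section \<open>Elements with trivial coordinates\<close>

lemma (in group) completion_diff:
  assumes x: "x \<in> carrier completion" "y \<in> carrier completion" and N: "N \<in> fin_index_normals G"
    and eq: "x N = y N"
  shows "(x \<otimes>\<^bsub>completion\<^esub> inv\<^bsub>completion\<^esub> y) N = N"
proof -
  interpret C: group completion by (rule group_completion)
  interpret N: normal N G using N by (rule fin_index_normalsD)
  let ?w = "x \<otimes>\<^bsub>completion\<^esub> inv\<^bsub>completion\<^esub> y"
  have w: "?w \<in> carrier completion" "?w \<otimes>\<^bsub>completion\<^esub> y = x" using x by (simp_all add: C.m_assoc)
  obtain a where a: "a \<in> ?w N" using completion_nonempty[OF w(1) N] .
  obtain g where g: "g \<in> y N" using completion_nonempty[OF x(2) N] .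
  note c = completion_mem(1)[OF w(1) N a] completion_mem(1)[OF x(2) N g]
  have "N #> (a \<otimes> g) = N #> g"
    using completion_mult_coset[OF w(1) x(2) N a g] completion_mem(2)[OF x(2) N g] w(2) eq by simp
  then have "a \<otimes> g \<in> N #> g" using rcos_self[of "a \<otimes> g" N] c N.is_subgroup by simp
  then have "a \<otimes> g \<otimes> inv g \<in> N" using N.rcos_module_imp[OF is_group c(2)] by simp
  then have "a \<in> N" using c by (simp add: m_assoc)
  then show ?thesis using completion_mem(2)[OF w(1) N a] coset_join2[OF c(1) N.is_subgroup] by simp
qed

lemma (in group) completion_mult_left_trivial:
  assumes x: "x \<in> carrier completion" "y \<in> carrier completion" and N: "N \<in> fin_index_normals G"
    and eq: "x N = N"
  shows "(x \<otimes>\<^bsub>completion\<^esub> y) N = y N"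
proof -
  interpret N: normal N G using N by (rule fin_index_normalsD)
  obtain g where g: "g \<in> y N" using completion_nonempty[OF x(2) N] .
  have "\<one> \<in> x N" using eq N.one_closed by simp
  then show ?thesis
    using completion_mult_coset[OF x N _ g, of \<one>] completion_mem[OF x(2) N g] by simp
qed

lemma (in group) one_completion: "N \<in> fin_index_normals G \<Longrightarrow> \<one>\<^bsub>completion\<^esub> N = N"
  by (simp add: one_profinite_completion)

lemma (in group) completion_trivial_mono:
  assumes x: "x \<in> carrier completion" and M: "M \<in> fin_index_normals G" "N \<in> fin_index_normals G" "M \<subseteq> N"
    and eq: "x M = M"
  shows "x N = N"
proof -
  interpret M: normal M G using M(1) by (rule fin_index_normalsD)
  interpret N: normal N G using M(2) by (rule fin_index_normalsD)
  have "\<one> \<in> x N" using completion_mono[OF x M, of \<one>] eq M.one_closed by simp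
  from completion_mem(2)[OF x M(2) this] show ?thesis using coset_mult_one[OF N.subset] by simp
qed

context finitely_many_small_index
begin

interpretation A: group "AutoGroup G"
  by (rule AutoGroup)
interpretation C: group completion by (rule group_completion)
interpretation AC: group A.completion by (rule A.group_completion)

lemma cont_autoD:
  assumes "f \<in> carrier (cont_auto_group G)"
  shows "f \<in> auto completion" "f \<in> hom completion completion" "f \<in> extensional (carrier completion)"
    "bij_betw f (carrier completion) (carrier completion)"
    "continuous_map (profinite_topology G) (profinite_topology G) f"
    "\<And>y. y \<in> carrier completion \<Longrightarrow> f y \<in> carrier completion"
  using assms mem_autoD[of f completion] auto_closed[of f completion] by (auto simp: carrier_cont_auto)

lemma cont_auto_mult_closed:
  assumes f: "f \<in> carrier (cont_auto_group G)" and g: "g \<in> carrier (cont_auto_group G)"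
  shows "f \<otimes>\<^bsub>cont_auto_group G\<^esub> g \<in> carrier (cont_auto_group G)"
proof -
  interpret CA: group "AutoGroup completion" by (rule C.AutoGroup)
  have "compose (carrier completion) f g \<in> auto completion"
    using CA.m_closed[of f g] cont_autoD(1)[OF f] cont_autoD(1)[OF g] by (simp add: mult_AutoGroup)
  moreover have "continuous_map (profinite_topology G) (profinite_topology G) (compose (carrier completion) f g)"
    by (rule continuous_map_eq[OF continuous_map_compose[OF cont_autoD(5)[OF g] cont_autoD(5)[OF f]]])
       (simp add: topspace_profinite compose_def)
  ultimately show ?thesis by (simp add: mult_cont_auto[OF f g] carrier_cont_auto)
qed

text \<open>By continuity \<open>y\<close> may be replaced by an element \<open>g\<close> of
  \<open>core N\<close> without changing the image modulo \<open>core N\<close>. The continuous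
  automorphism then induces a homomorphism from \<open>G\<close> to the quotient, which kills
  \<open>core N\<close>.\<close>

lemma cont_auto_core:
  assumes f: "f \<in> carrier (cont_auto_group G)" and N: "N \<in> fin_index_normals G"
    and y: "y \<in> carrier completion" "y (core N) = core N"
  shows "f y (core N) = core N"
proof -
  let ?K = "core N"
  have K: "?K \<in> fin_index_normals G" by (rule core_fin_index[OF N])
  interpret K: normal ?K G using K by (rule fin_index_normalsD)
  note fc = cont_autoD(6)[OF f]
  have "openin (profinite_topology G) {z \<in> carrier completion. z ?K = f y ?K}"
    unfolding openin_profinite_iff using K by auto
  from openin_continuous_map_preimage[OF cont_autoD(5)[OF f] this]
  have "openin (profinite_topology G) {z \<in> carrier completion. f z ?K = f y ?K}"
    by (simp add: topspace_profinite fc cong: conj_cong)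
  then have "\<exists>M\<in>fin_index_normals G. \<forall>z\<in>carrier completion. z M = y M \<longrightarrow> f z ?K = f y ?K"
    unfolding openin_profinite_iff using y(1) by simp
  then obtain M where M: "M \<in> fin_index_normals G"
    "\<And>z. \<lbrakk>z \<in> carrier completion; z M = y M\<rbrakk> \<Longrightarrow> f z ?K = f y ?K"
    by auto
  \<comment> \<open>Representing \<open>y\<close> at the intersection gives an element close to
    \<open>y\<close> for continuity that also lies in \<open>core N\<close>.\<close>
  have L: "M \<inter> ?K \<in> fin_index_normals G" by (rule fin_index_normals_Int[OF M(1) K])
  obtain g where g: "g \<in> y (M \<inter> ?K)" using completion_nonempty[OF y(1) L] .
  have gM: "g \<in> y M" and gK: "g \<in> ?K" and gc: "g \<in> carrier G"
    using completion_mono[OF y(1) L M(1) _ g] completion_mono[OF y(1) L K _ g] y(2) completion_mem(1)[OF y(1) L g] by auto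
  have tg: "to_completion G g \<in> carrier completion" by (rule to_completion_carrier[OF gc])
  have "to_completion G g M = y M"
    using completion_mem(2)[OF y(1) M(1) gM] M(1) by (simp add: to_completion_def)
  then have eq: "f (to_completion G g) ?K = f y ?K" using M(2) tg by blast
  have "(\<lambda>g. f (to_completion G g) ?K) \<in> hom G (G Mod ?K)"
  proof (rule homI)
    fix a assume a: "a \<in> carrier G"
    show "f (to_completion G a) ?K \<in> carrier (G Mod ?K)"
      using fc[OF to_completion_carrier[OF a]] K by (simp add: carrier_profinite_completion FactGroup_def)
    fix b assume b: "b \<in> carrier G"
    show "f (to_completion G (a \<otimes> b)) ?K = f (to_completion G a) ?K \<otimes>\<^bsub>G Mod ?K\<^esub> f (to_completion G b) ?K"
      using a b K hom_mult[OF cont_autoD(2)[OF f]] to_completion_carrier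
      by (simp add: to_completion_mult) (simp add: mult_profinite_completion)
  qed
  then have "f (to_completion G g) ?K = ?K" using hom_core[OF N _ gK] by blast
  then show ?thesis using eq by simp
qed

lemma cont_auto_coset:
  assumes f: "f \<in> carrier (cont_auto_group G)" and N: "N \<in> fin_index_normals G"
    and y: "y \<in> carrier completion" "z \<in> carrier completion" "y (core N) = z (core N)"
  shows "f y (core N) = f z (core N)"
proof -
  let ?w = "y \<otimes>\<^bsub>completion\<^esub> inv\<^bsub>completion\<^esub> z"
  have w: "?w \<in> carrier completion" "?w \<otimes>\<^bsub>completion\<^esub> z = y" using y by (simp_all add: C.m_assoc)
  have "f ?w (core N) = core N"
    by (rule cont_auto_core[OF f N w(1) completion_diff[OF y(1,2) core_fin_index[OF N] y(3)]])
  then have "(f ?w \<otimes>\<^bsub>completion\<^esub> f z) (core N) = f z (core N)"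
    using completion_mult_left_trivial[OF _ _ core_fin_index[OF N]] cont_autoD(6)[OF f] w(1) y(2) by blast
  then show ?thesis using hom_mult[OF cont_autoD(2)[OF f] w(1) y(2)] w(2) by simp
qed

text \<open>The induced surjection of the finite set of cosets is injective.\<close>

lemma cont_auto_core_converse:
  assumes f: "f \<in> carrier (cont_auto_group G)" and N: "N \<in> fin_index_normals G"
    and y: "y \<in> carrier completion" "f y (core N) = core N"
  shows "y (core N) = core N"
proof -
  let ?K = "core N"
  have K: "?K \<in> fin_index_normals G" by (rule core_fin_index[OF N])
  interpret K: normal ?K G using K by (rule fin_index_normalsD)
  define m where "m = (\<lambda>C. f (to_completion G (SOME g. g \<in> C)) ?K)"
  have m: "m (z ?K) = f z ?K" if z: "z \<in> carrier completion" for z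
  proof -
    define g where "g = (SOME g. g \<in> z ?K)"
    have g: "g \<in> z ?K" unfolding g_def using completion_nonempty[OF z K] by (metis someI_ex)
    have "to_completion G g ?K = z ?K" using completion_mem(2)[OF z K g] K by (simp add: to_completion_def)
    then show ?thesis
      unfolding m_def g_def[symmetric]
      using cont_auto_coset[OF f N to_completion_carrier[OF completion_mem(1)[OF z K g]] z] by simp
  qed
  have "rcosets ?K \<subseteq> m ` (rcosets ?K)"
  proof
    fix D assume "D \<in> rcosets ?K"
    then obtain h where h: "h \<in> carrier G" "D = ?K #> h" by (auto simp: RCOSETS_def)
    obtain z where z: "z \<in> carrier completion" "f z = to_completion G h"
      using cont_autoD(4)[OF f] to_completion_carrier[OF h(1)] unfolding bij_betw_def by (metis imageE)
    have "m (z ?K) = D" using m[OF z(1)] z(2) h K by (simp add: to_completion_def)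
    moreover have "z ?K \<in> rcosets ?K" using z(1) K by (simp add: carrier_profinite_completion)
    ultimately show "D \<in> m ` (rcosets ?K)" by blast
  qed
  then have inj: "inj_on m (rcosets ?K)"
    using fin_index_normalsD(2)[OF K] by (meson card_image_le card_mono eq_card_imp_inj_on finite_imageI le_antisym)
  have "m ?K = ?K"
    using m[OF C.one_closed] one_completion[OF K] hom_one[OF cont_autoD(2)[OF f] C.is_group C.is_group] by simp
  then have "m (y ?K) = m ?K" using m[OF y(1)] y(2) by simp
  moreover have "y ?K \<in> rcosets ?K" "?K \<in> rcosets ?K"
    using y(1) K K.subgroup_in_rcosets[OF is_group] by (simp_all add: carrier_profinite_completion)
  ultimately show ?thesis using inj by (simp add: inj_on_eq_iff)
qed

text \<open>The kernel of the projection to \<open>G Mod core N\<close>.\<close>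

definition core_neighbourhood :: "'a set \<Rightarrow> ('a set \<Rightarrow> 'a set) set" where
  "core_neighbourhood N = {y \<in> carrier completion. y (core N) = core N}"

lemma core_neighbourhood_open_characteristic:
  assumes N: "N \<in> fin_index_normals G"
  shows "open_characteristic G (core_neighbourhood N)"
  unfolding open_characteristic_def
proof (intro conjI ballI)
  note K = core_fin_index[OF N]
  show "subgroup (core_neighbourhood N) completion"
  proof (rule C.subgroupI)
    show "core_neighbourhood N \<subseteq> carrier completion" by (auto simp: core_neighbourhood_def)
    have "\<one>\<^bsub>completion\<^esub> \<in> core_neighbourhood N" by (simp add: core_neighbourhood_def one_completion[OF K])
    then show "core_neighbourhood N \<noteq> {}" by blast
    fix a assume a: "a \<in> core_neighbourhood N"
    then show "inv\<^bsub>completion\<^esub> a \<in> core_neighbourhood N"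
      using completion_diff[OF C.one_closed _ K, of a] one_completion[OF K] by (simp add: core_neighbourhood_def)
    fix b assume "b \<in> core_neighbourhood N"
    then show "a \<otimes>\<^bsub>completion\<^esub> b \<in> core_neighbourhood N"
      using a completion_mult_left_trivial[OF _ _ K] by (simp add: core_neighbourhood_def)
  qed
  show "openin (profinite_topology G) (core_neighbourhood N)"
    unfolding openin_profinite_iff using K by (auto simp: core_neighbourhood_def)
  fix f assume f: "f \<in> carrier (cont_auto_group G)"
  show "f ` core_neighbourhood N = core_neighbourhood N"
  proof
    show "f ` core_neighbourhood N \<subseteq> core_neighbourhood N"
      using cont_auto_core[OF f N] cont_autoD(6)[OF f] by (auto simp: core_neighbourhood_def)
    show "core_neighbourhood N \<subseteq> f ` core_neighbourhood N"
    proof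
      fix v assume v: "v \<in> core_neighbourhood N"
      then obtain y where y: "y \<in> carrier completion" "v = f y"
        using cont_autoD(4)[OF f] unfolding bij_betw_def core_neighbourhood_def by blast
      then have "y \<in> core_neighbourhood N"
        using v cont_auto_core_converse[OF f N] by (simp add: core_neighbourhood_def)
      then show "v \<in> f ` core_neighbourhood N" using y by blast
    qed
  qed
qed

lemma one_cont_auto_eq: "\<one>\<^bsub>cont_auto_group G\<^esub> = completion_action \<one>\<^bsub>A.completion\<^esub>"
  unfolding one_cont_auto
  by (rule extensionalityI[of _ "carrier completion"])
     (auto simp: completion_action_one, simp add: completion_action_def)

lemma one_auto_congruence:
  assumes "open_characteristic G U"
  shows "\<one>\<^bsub>cont_auto_group G\<^esub> \<in> auto_congruence_subgroup G U"
proof -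
  have "subgroup U completion" using assms by (simp add: open_characteristic_def)
  then have "C \<subseteq> carrier completion" if "C \<in> carrier (completion Mod U)" for C
    using that C.r_coset_subset_G[OF subgroup.subset] by (auto simp: FactGroup_def RCOSETS_def)
  then have "(\<lambda>y\<in>carrier completion. y) ` C = C" if "C \<in> carrier (completion Mod U)" for C
    using that by (force simp: subset_iff)
  then show ?thesis
    using completion_action_cont_auto[OF AC.one_closed]
    by (simp add: auto_congruence_subgroup_def one_cont_auto_eq[symmetric]) (simp add: one_cont_auto)
qed

lemma one_cont_auto_mult:
  assumes f: "f \<in> carrier (cont_auto_group G)"
  shows "\<one>\<^bsub>cont_auto_group G\<^esub> \<otimes>\<^bsub>cont_auto_group G\<^esub> f = f"
proof -
  have "\<one>\<^bsub>cont_auto_group G\<^esub> \<in> carrier (cont_auto_group G)"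
    using completion_action_cont_auto[OF AC.one_closed] by (simp add: one_cont_auto_eq)
  then show ?thesis
    using cont_autoD(3,6)[OF f] by (simp add: mult_cont_auto f) (simp add: one_cont_auto Pi_iff)
qed

lemma auto_congruence_core:
  assumes N: "N \<in> fin_index_normals G" and \<gamma>: "\<gamma> \<in> auto_congruence_subgroup G (core_neighbourhood N)"
    and z: "z \<in> carrier completion"
  shows "\<gamma> z (core N) = z (core N)"
proof -
  let ?U = "core_neighbourhood N"
  have U: "subgroup ?U completion"
    using core_neighbourhood_open_characteristic[OF N] by (simp add: open_characteristic_def)
  let ?C = "?U #>\<^bsub>completion\<^esub> z"
  have "?C \<in> carrier (completion Mod ?U)" using z by (auto simp: FactGroup_def RCOSETS_def)
  then have "\<gamma> ` ?C = ?C" using \<gamma> by (simp add: auto_congruence_subgroup_def)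
  then have "\<gamma> z \<in> ?C" using C.rcos_self[OF z U] by blast
  then obtain u where u: "u \<in> ?U" "\<gamma> z = u \<otimes>\<^bsub>completion\<^esub> z" by (auto simp: r_coset_def)
  then show ?thesis
    using completion_mult_left_trivial[OF _ z core_fin_index[OF N], of u] by (simp add: core_neighbourhood_def)
qed

text \<open>Uniqueness of the lift to the completion of the automorphism group depends on this.
  Distinct automorphisms differ at some point in a coordinate \<open>core N\<close>, and that
  coordinate is constant on the cosets of the subgroup attached to
  \<open>core_neighbourhood N\<close>.\<close>

lemma Hausdorff_cont_auto: "Hausdorff_space (cont_auto_topology G)"
  unfolding Hausdorff_space_def
proof (intro allI impI, elim conjE)
  let ?S = "{auto_congruence_subgroup G U #>\<^bsub>cont_auto_group G\<^esub> f | U f.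
          open_characteristic G U \<and> f \<in> carrier (cont_auto_group G)}"
  have carr: "f \<in> carrier (cont_auto_group G)" if "f \<in> topspace (cont_auto_topology G)" for f
    using that cont_auto_mult_closed
    by (auto simp: cont_auto_topology_def topology_generated_by_topspace r_coset_def auto_congruence_subgroup_def)
  fix f f' assume "f \<in> topspace (cont_auto_topology G)" "f' \<in> topspace (cont_auto_topology G)" and ne: "f \<noteq> f'"
  then have f: "f \<in> carrier (cont_auto_group G)" and f': "f' \<in> carrier (cont_auto_group G)" by (auto intro: carr)
  obtain y where y: "y \<in> carrier completion" "f y \<noteq> f' y"
    using ne cont_autoD(3)[OF f] cont_autoD(3)[OF f'] by (meson extensionalityI)
  note c = cont_autoD(6)[OF f y(1)] cont_autoD(6)[OF f' y(1)]
  obtain N where N: "N \<in> fin_index_normals G" "f y N \<noteq> f' y N"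
    using completion_eqI[OF c] y(2) by blast
  have K: "core N \<in> fin_index_normals G" by (rule core_fin_index[OF N(1)])
  have neK: "f y (core N) \<noteq> f' y (core N)"
  proof
    assume eq: "f y (core N) = f' y (core N)"
    obtain g where g: "g \<in> f y (core N)" using completion_nonempty[OF c(1) K] .
    then have gN: "g \<in> f y N" "g \<in> f' y N"
      using completion_mono[OF c(1) K N(1) core_subset[OF N(1)]] completion_mono[OF c(2) K N(1) core_subset[OF N(1)]] eq by auto
    show False using N(2) completion_mem(2)[OF c(1) N(1) gN(1)] completion_mem(2)[OF c(2) N(1) gN(2)] by simp
  qed
  let ?U = "core_neighbourhood N"
  have U: "open_characteristic G ?U" by (rule core_neighbourhood_open_characteristic[OF N(1)])
  let ?B = "\<lambda>f. auto_congruence_subgroup G ?U #>\<^bsub>cont_auto_group G\<^esub> f"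
  have op: "openin (cont_auto_topology G) (?B h)" if "h \<in> carrier (cont_auto_group G)" for h
    unfolding cont_auto_topology_def by (rule topology_generated_by_Basis) (use U that in blast)
  have mem: "h \<in> ?B h" if "h \<in> carrier (cont_auto_group G)" for h
    using one_auto_congruence[OF U] one_cont_auto_mult[OF that] unfolding r_coset_def by force
  have "disjnt (?B f) (?B f')"
  proof (rule ccontr)
    assume "\<not> disjnt (?B f) (?B f')"
    then obtain \<gamma> \<gamma>' where \<gamma>: "\<gamma> \<in> auto_congruence_subgroup G ?U" "\<gamma>' \<in> auto_congruence_subgroup G ?U"
      "\<gamma> \<otimes>\<^bsub>cont_auto_group G\<^esub> f = \<gamma>' \<otimes>\<^bsub>cont_auto_group G\<^esub> f'"
      by (auto simp: disjnt_def r_coset_def)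
    have "\<gamma> \<in> carrier (cont_auto_group G)" "\<gamma>' \<in> carrier (cont_auto_group G)"
      using \<gamma> by (auto simp: auto_congruence_subgroup_def)
    then have "\<gamma> (f y) = \<gamma>' (f' y)"
      using fun_cong[OF \<gamma>(3), of y] y(1) f f' by (simp add: mult_cont_auto compose_def)
    then show False
      using auto_congruence_core[OF N(1) \<gamma>(1) c(1)] auto_congruence_core[OF N(1) \<gamma>(2) c(2)] neK by simp
  qed
  then show "\<exists>V W. openin (cont_auto_topology G) V \<and> openin (cont_auto_topology G) W \<and> f \<in> V \<and> f' \<in> W \<and> disjnt V W"
    using op[OF f] op[OF f'] mem[OF f] mem[OF f'] by blast
qed

text \<open>An element trivial at \<open>congruence_core M\<close> displaces every point by an
  element trivial at \<open>core M\<close>, and all such displacements lie in \<open>U\<close> for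
  suitable \<open>M\<close>. This is continuity at the identity.\<close>

lemma completion_action_congruence:
  assumes U: "open_characteristic G U"
  obtains M where "M \<in> fin_index_normals G"
    "\<And>z. \<lbrakk>z \<in> carrier A.completion; z (congruence_core M) = congruence_core M\<rbrakk>
      \<Longrightarrow> completion_action z \<in> auto_congruence_subgroup G U"
proof -
  have Us: "subgroup U completion" and Uo: "openin (profinite_topology G) U"
    using U by (simp_all add: open_characteristic_def)
  interpret U: subgroup U completion by (rule Us)
  have "\<exists>M\<in>fin_index_normals G. \<forall>y\<in>carrier completion. y M = \<one>\<^bsub>completion\<^esub> M \<longrightarrow> y \<in> U"
    using Uo U.one_closed unfolding openin_profinite_iff by simp
  then obtain M where M: "M \<in> fin_index_normals G"
    "\<And>y. \<lbrakk>y \<in> carrier completion; y M = \<one>\<^bsub>completion\<^esub> M\<rbrakk> \<Longrightarrow> y \<in> U"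
    by auto
  note K = core_fin_index[OF M(1)]
  have closed: "completion_action z w \<in> U #>\<^bsub>completion\<^esub> v"
    if z: "z \<in> carrier A.completion" "z (congruence_core M) = congruence_core M"
      and v: "v \<in> carrier completion" "w \<in> U #>\<^bsub>completion\<^esub> v" for z v w
  proof -
    have w: "w \<in> carrier completion" using v C.r_coset_subset_G[OF U.subset] by blast
    note zw = completion_action_closed[OF z(1) w]
    let ?d = "completion_action z w \<otimes>\<^bsub>completion\<^esub> inv\<^bsub>completion\<^esub> w"
    have d: "?d \<in> carrier completion" "?d \<otimes>\<^bsub>completion\<^esub> w = completion_action z w"
      using zw w by (simp_all add: C.m_assoc)
    have "?d (core M) = core M"
      by (rule completion_diff[OF zw w K completion_action_trivial[OF z(1) w M(1) z(2)]])
    then have "?d M = \<one>\<^bsub>completion\<^esub> M"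
      using completion_trivial_mono[OF d(1) K M(1) core_subset[OF M(1)]] one_completion[OF M(1)] by simp
    then have "?d \<in> U" using M(2) d(1) by blast
    then have "completion_action z w \<in> U #>\<^bsub>completion\<^esub> w" using d(2) unfolding r_coset_def by force
    then show ?thesis using C.repr_independence[OF v(2,1) Us] by simp
  qed
  have "completion_action z \<in> auto_congruence_subgroup G U"
    if z: "z \<in> carrier A.completion" "z (congruence_core M) = congruence_core M" for z
    unfolding auto_congruence_subgroup_def
  proof (intro CollectI conjI ballI completion_action_cont_auto z)
    fix D assume "D \<in> carrier (completion Mod U)"
    then obtain v where v: "v \<in> carrier completion" "D = U #>\<^bsub>completion\<^esub> v"
      by (auto simp: FactGroup_def RCOSETS_def)
    let ?z = "inv\<^bsub>A.completion\<^esub> z"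
    note cM = congruence_subgroup_fin_index[OF M(1)]
    have z': "?z \<in> carrier A.completion" "?z (congruence_core M) = congruence_core M"
      using A.completion_diff[OF AC.one_closed z(1) cM] A.one_completion[OF cM] z by simp_all
    have D: "D \<subseteq> carrier completion" using v C.r_coset_subset_G[OF U.subset] by simp
    show "completion_action z ` D = D"
    proof
      show "completion_action z ` D \<subseteq> D" using closed[OF z v(1)] v(2) by blast
      show "D \<subseteq> completion_action z ` D"
      proof
        fix w assume w: "w \<in> D"
        then have "completion_action z (completion_action ?z w) = w"
          using completion_action_comp[OF z(1) z'(1), of w] D z(1) completion_action_one[of w] by auto
        moreover have "completion_action ?z w \<in> D" using closed[OF z' v(1)] v(2) w by blast
        ultimately show "w \<in> completion_action z ` D" by (metis image_eqI)
      qed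
    qed
  qed
  then show thesis using that[OF M(1)] by blast
qed

text \<open>Basic open sets are cosets, so continuity at the identity spreads by multiplicativity to
  every point.\<close>

lemma completion_action_continuous_cont_auto:
  "continuous_map (profinite_topology (AutoGroup G)) (cont_auto_topology G) completion_action"
  unfolding cont_auto_topology_def
proof (rule continuous_on_generated_topo)
  let ?CA = "cont_auto_group G"
  let ?S = "{auto_congruence_subgroup G U #>\<^bsub>?CA\<^esub> f | U f. open_characteristic G U \<and> f \<in> carrier ?CA}"
  show "completion_action ` topspace (profinite_topology (AutoGroup G)) \<subseteq> \<Union> ?S"
  proof
    fix f assume "f \<in> completion_action ` topspace (profinite_topology (AutoGroup G))"
    then have f: "f \<in> carrier ?CA" using completion_action_cont_auto by (auto simp: A.topspace_profinite)
    have U: "open_characteristic G (core_neighbourhood (carrier G))"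
      by (rule core_neighbourhood_open_characteristic[OF fin_index_normals_carrier])
    have "f \<in> auto_congruence_subgroup G (core_neighbourhood (carrier G)) #>\<^bsub>?CA\<^esub> f"
      using one_auto_congruence[OF U] one_cont_auto_mult[OF f] unfolding r_coset_def by force
    then show "f \<in> \<Union> ?S" using U f by blast
  qed
  fix B assume "B \<in> ?S"
  then obtain U f0 where U: "open_characteristic G U" and f0: "f0 \<in> carrier ?CA"
    and B: "B = auto_congruence_subgroup G U #>\<^bsub>?CA\<^esub> f0" by blast
  obtain M where M: "M \<in> fin_index_normals G"
    "\<And>z. \<lbrakk>z \<in> carrier A.completion; z (congruence_core M) = congruence_core M\<rbrakk>
      \<Longrightarrow> completion_action z \<in> auto_congruence_subgroup G U"
    using completion_action_congruence[OF U] by blast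
  note cM = congruence_subgroup_fin_index[OF M(1)]
  show "openin (profinite_topology (AutoGroup G)) (completion_action -` B \<inter> topspace (profinite_topology (AutoGroup G)))"
    unfolding A.openin_profinite_iff A.topspace_profinite
  proof (intro conjI ballI bexI[OF _ cM] impI)
    fix x0 x assume x0: "x0 \<in> completion_action -` B \<inter> carrier A.completion"
      and x: "x \<in> carrier A.completion" and eq: "x (congruence_core M) = x0 (congruence_core M)"
    then have x0c: "x0 \<in> carrier A.completion" by blast
    obtain \<gamma> where \<gamma>: "\<gamma> \<in> auto_congruence_subgroup G U" "completion_action x0 = \<gamma> \<otimes>\<^bsub>?CA\<^esub> f0"
      using x0 by (auto simp: B r_coset_def)
    have \<gamma>c: "\<gamma> \<in> carrier ?CA" using \<gamma>(1) by (simp add: auto_congruence_subgroup_def)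
    let ?z = "x \<otimes>\<^bsub>A.completion\<^esub> inv\<^bsub>A.completion\<^esub> x0"
    have z: "?z \<in> carrier A.completion" "?z \<otimes>\<^bsub>A.completion\<^esub> x0 = x" using x x0c by (simp_all add: AC.m_assoc)
    have \<zeta>: "completion_action ?z \<in> auto_congruence_subgroup G U"
      using M(2)[OF z(1) A.completion_diff[OF x x0c cM eq]] .
    note \<zeta>c = completion_action_cont_auto[OF z(1)]
    have "completion_action x = completion_action ?z \<otimes>\<^bsub>?CA\<^esub> (\<gamma> \<otimes>\<^bsub>?CA\<^esub> f0)"
      using completion_action_comp_eq[OF z(1) x0c] z(2) \<gamma>(2) by simp
    also have "\<dots> = (completion_action ?z \<otimes>\<^bsub>?CA\<^esub> \<gamma>) \<otimes>\<^bsub>?CA\<^esub> f0"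
      using \<gamma>c f0 \<zeta>c cont_auto_mult_closed[OF \<zeta>c \<gamma>c] cont_auto_mult_closed[OF \<gamma>c f0] cont_autoD(6)[OF f0]
      by (simp add: mult_cont_auto) (auto simp: compose_def fun_eq_iff)
    finally have eq': "completion_action x = (completion_action ?z \<otimes>\<^bsub>?CA\<^esub> \<gamma>) \<otimes>\<^bsub>?CA\<^esub> f0" .
    have "completion_action ?z \<otimes>\<^bsub>?CA\<^esub> \<gamma> \<in> auto_congruence_subgroup G U"
      unfolding auto_congruence_subgroup_def
    proof (intro CollectI conjI ballI cont_auto_mult_closed \<zeta>c \<gamma>c)
      fix D assume D: "D \<in> carrier (completion Mod U)"
      have "subgroup U completion" using U by (simp add: open_characteristic_def)
      then have sub: "D \<subseteq> carrier completion"
        using D C.r_coset_subset_G[OF subgroup.subset] by (auto simp: FactGroup_def RCOSETS_def)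
      have "(completion_action ?z \<otimes>\<^bsub>?CA\<^esub> \<gamma>) ` D = completion_action ?z ` \<gamma> ` D"
        unfolding mult_cont_auto[OF \<zeta>c \<gamma>c] image_image
        by (rule image_cong[OF refl]) (use sub in \<open>auto simp: compose_def\<close>)
      then show "(completion_action ?z \<otimes>\<^bsub>?CA\<^esub> \<gamma>) ` D = D"
        using \<zeta> \<gamma>(1) D by (simp add: auto_congruence_subgroup_def)
    qed
    then show "x \<in> completion_action -` B \<inter> carrier A.completion"
      using x eq' unfolding B r_coset_def by blast
  qed blast
qed

text \<open>The action is a continuous homomorphism extending \<open>auto_extension\<close>, so it
  is the unique lift.\<close>

lemma aut_completion_map_eq:
  "aut_completion_map G = restrict completion_action (carrier A.completion)"
  unfolding aut_completion_map_def
proof (rule A.completion_lift_eqI[OF Hausdorff_cont_auto])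
  show "restrict completion_action (carrier A.completion) \<in> hom A.completion (cont_auto_group G)"
    by (rule homI) (simp_all add: completion_action_cont_auto completion_action_comp_eq)
  show "continuous_map (profinite_topology (AutoGroup G)) (cont_auto_topology G)
     (restrict completion_action (carrier A.completion))"
    by (rule continuous_map_eq[OF completion_action_continuous_cont_auto]) (simp add: A.topspace_profinite)
  show "restrict completion_action (carrier A.completion) (to_completion (AutoGroup G) \<phi>) = auto_extension G \<phi>"
    if "\<phi> \<in> carrier (AutoGroup G)" for \<phi>
    using that A.to_completion_carrier[OF that] auto_extension_eq[of \<phi>] by simp
qed simp

text \<open>If \<open>x\<close> acts trivially, a representative of its coordinate at
  \<open>congruence_core L\<close> fixes every coset of \<open>core L\<close>, hence lies in that
  subgroup and in \<open>N\<close>. The passage from \<open>L\<close> to \<open>core L\<close> is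
  needed because \<open>L\<close> itself may fail to be characteristic.\<close>

theorem congruence_kernel_trivial:
  assumes csp: "\<And>N. N \<in> fin_index_normals (AutoGroup G) \<Longrightarrow> \<exists>K\<in>fin_index_normals G. congruence_subgroup G K \<subseteq> N"
  shows "congruence_kernel G = {\<one>\<^bsub>A.completion\<^esub>}" "inj_on (aut_completion_map G) (carrier A.completion)"
proof -
  have trivial: "x = \<one>\<^bsub>A.completion\<^esub>"
    if x: "x \<in> carrier A.completion" and one: "completion_action x = \<one>\<^bsub>cont_auto_group G\<^esub>" for x
  proof (rule A.completion_eqI[OF x AC.one_closed])
    fix N assume N: "N \<in> fin_index_normals (AutoGroup G)"
    interpret N: normal N "AutoGroup G" using N by (rule fin_index_normalsD)
    obtain L where L: "L \<in> fin_index_normals G" "congruence_subgroup G L \<subseteq> N" using csp[OF N] by blast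
    note K = core_fin_index[OF L(1)] and cL = congruence_subgroup_fin_index[OF L(1)]
    interpret K: normal "core L" G using K by (rule fin_index_normalsD)
    obtain \<phi> where \<phi>: "\<phi> \<in> x (congruence_core L)" using A.completion_nonempty[OF x cL] .
    have \<phi>a: "\<phi> \<in> auto G" by (rule auto_completion_mem[OF x L(1) \<phi>])
    have "\<phi> \<in> congruence_core L"
      unfolding congruence_subgroup_def
    proof (intro CollectI conjI ballI \<phi>a)
      fix g assume g: "g \<in> carrier G"
      \<comment> \<open>Testing on the image of \<open>G\<close> is enough to see how the
        representative acts on cosets.\<close>
      have "completion_action x (to_completion G g) (core L) = core L #> \<phi> g"
        by (rule completion_action_eq[where x = x and y = "to_completion G g", OF x to_completion_carrier[OF g] K L(1) subset_refl \<phi> to_completion_mem[OF g K]])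
      then have "core L #> \<phi> g = core L #> g"
        using to_completion_carrier[OF g] K by (simp add: one one_cont_auto) (simp add: to_completion_def)
      then have "\<phi> g \<in> core L #> g" using rcos_self[OF auto_closed[OF \<phi>a g] K.is_subgroup] by simp
      then show "\<phi> g \<otimes> inv g \<in> core L" using K.rcos_module_imp[OF is_group g] by simp
    qed
    then have "\<phi> \<in> N" using congruence_subgroup_mono[OF core_subset[OF L(1)]] L(2) by blast
    moreover have xN: "\<phi> \<in> x N"
      using A.completion_mono[OF x cL N _ \<phi>] congruence_subgroup_mono[OF core_subset[OF L(1)]] L(2) by blast
    ultimately have "x N = N"
      using A.completion_mem(2)[OF x N xN] A.coset_join2[OF _ N.is_subgroup] \<phi>a by simp
    then show "x N = \<one>\<^bsub>A.completion\<^esub> N" using A.one_completion[OF N] by simp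
  qed
  show "congruence_kernel G = {\<one>\<^bsub>A.completion\<^esub>}"
    unfolding congruence_kernel_def kernel_def aut_completion_map_eq
    using trivial one_cont_auto_eq by auto
  show "inj_on (aut_completion_map G) (carrier A.completion)"
    unfolding aut_completion_map_eq
  proof (rule inj_onI)
    fix x y assume x: "x \<in> carrier A.completion" and y: "y \<in> carrier A.completion"
      and "restrict completion_action (carrier A.completion) x = restrict completion_action (carrier A.completion) y"
    then have eq: "completion_action x = completion_action y" by simp
    let ?d = "x \<otimes>\<^bsub>A.completion\<^esub> inv\<^bsub>A.completion\<^esub> y"
    have i: "inv\<^bsub>A.completion\<^esub> y \<in> carrier A.completion" using y by simp
    have "completion_action ?d = completion_action (y \<otimes>\<^bsub>A.completion\<^esub> inv\<^bsub>A.completion\<^esub> y)"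
      unfolding completion_action_comp_eq[OF x i] completion_action_comp_eq[OF y i] eq ..
    also have "\<dots> = \<one>\<^bsub>cont_auto_group G\<^esub>" using y one_cont_auto_eq by simp
    finally have "?d = \<one>\<^bsub>A.completion\<^esub>" using trivial x i by blast
    then show "x = y" using x y AC.inv_solve_right'[of "\<one>\<^bsub>A.completion\<^esub>" x y] by simp
  qed
qed

end

theorem theorem1p1:
  shows "congruence_kernel F2 = {\<one>\<^bsub>profinite_completion (AutoGroup F2)\<^esub>} \<and>
    inj_on (aut_completion_map F2) (carrier (profinite_completion (AutoGroup F2)))"
  using F2.congruence_kernel_trivial F2_congruence_subgroup_property by metis

end
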